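(* Let $(V_N)_{N\ge 2}$ be finite connected vertex-transitive graphs with $|V_N|=N$, and let $(A(t))_{t\ge 0}$ denote an IDLA process on the cylinder $\mathbb{G}_N=V_N\times\mathbb{Z}$ starting from $A(0)=R_0$. For every $\nu>0$ and every $m\ge 1$ there exists a constant $C=C(\nu,m)<\infty$ such that, with $$T^\sharp := N\sqrt{\tau_{mix}}\,(\log N)^2,\qquad \Delta_N := C\max\left\{\log N,\ \sqrt{\frac{\min(T,T^\sharp)}{N}\Big(\log N+\log_+(T/N)\Big)}\right\},$$ we have $$\mathbb{P}\Big(R_{\lfloor T/N-\Delta_N\rfloor}\subseteq A(T)\subseteq R_{T/N+\Delta_N}\Big)\ \ge\ 1-N^{-\nu}$$ uniformly over integers $T$ with $1\le T\le N^m$, for every $N$ large enough.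
   Context: For each integer $N\ge2$, $V_N$ is a finite, connected, vertex-transitive graph on $N$ vertices (the automorphism group acts transitively on vertices), of common degree $d=d(N)\ge 1$ (allowed to depend on $N$); $V_N$ also denotes its vertex set. $P_N$ is the transition matrix of the lazy simple random walk on $V_N$: $P_N(x,x')=1/(2d)$ if $x\sim x'$, $P_N(x,x)=1/2$, and $0$ otherwise. $\pi_N$ is the uniform distribution on $V_N$. $\tau_{mix}$ is the smallest integer $t\ge0$ with $\max_{x\in V_N}\|P_N^t(x,\cdot)-\pi_N\|_{TV}\le 1/4$. The cylinder walk on $\mathbb{G}_N=V_N\times\mathbb{Z}$ is the discrete-time Markov chain which from $(x,y)$ moves to $(x,y+1)$ with probability $1/4$, to $(x,y-1)$ with probability $1/4$, and to $(x',y)$ with probability $\tfrac12P_N(x,x')$ for each $x'\in V_N$. For real $k$, $R_k:=\{(x,y)\in\mathbb{G}_N: y\le k\}$. The IDLA process is defined by $A(0)=R_0$ and, for $t\ge1$, $A(t)=A(t-1)\cup\{(X_t,Y_t)\}$, where $(X_t,Y_t)$ is the exit location from $A(t-1)$ (the first site visited outside $A(t-1)$) of an independent cylinder walk started at a uniformly chosen site of $V_N\times\{0\}$. $\log_+(s):=\max(\log s,0)$. *)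

theory Defs
  imports "HOL-Probability.Probability" "Graph_Theory.Graph_Theory"
begin

text \<open>
  A finite simple graph is a \<^locale>\<open>pair_graph\<close>: a finite vertex set with a finite, irreflexive,
  symmetric arc relation. As arcs come in opposite pairs, the degree of a vertex is its out-degree.
\<close>

definition graph_automorphism :: "'a pair_pre_digraph \<Rightarrow> ('a \<Rightarrow> 'a) \<Rightarrow> bool" where
  "graph_automorphism G f \<longleftrightarrow>
     bij_betw f (pverts G) (pverts G) \<and>
     (\<forall>x\<in>pverts G. \<forall>y\<in>pverts G. (f x, f y) \<in> parcs G \<longleftrightarrow> (x, y) \<in> parcs G)"

definition vertex_transitive :: "'a pair_pre_digraph \<Rightarrow> bool" where
  "vertex_transitive G \<longleftrightarrow>
     (\<forall>x\<in>pverts G. \<forall>y\<in>pverts G. \<exists>f. graph_automorphism G f \<and> f x = y)"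

definition lazy_srw :: "'a pair_pre_digraph \<Rightarrow> 'a \<Rightarrow> 'a \<Rightarrow> real" where
  "lazy_srw G x x' =
     (if (x, x') \<in> parcs G then 1 / (2 * real (out_degree (with_proj G) x))
      else if x = x' then 1 / 2
      else 0)"

primrec lazy_srw_power :: "'a pair_pre_digraph \<Rightarrow> nat \<Rightarrow> 'a \<Rightarrow> 'a \<Rightarrow> real" where
  "lazy_srw_power G 0 x z = (if x = z then 1 else 0)"
| "lazy_srw_power G (Suc t) x z = (\<Sum>y\<in>pverts G. lazy_srw G x y * lazy_srw_power G t y z)"

definition uniform_dist :: "'a set \<Rightarrow> 'a \<Rightarrow> real" where
  "uniform_dist V x = (if x \<in> V then 1 / real (card V) else 0)"

text \<open>Total variation distance of two mass functions on a finite set, as a maximum over events.\<close>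

definition tv_dist :: "'a set \<Rightarrow> ('a \<Rightarrow> real) \<Rightarrow> ('a \<Rightarrow> real) \<Rightarrow> real" where
  "tv_dist V \<mu> \<nu> = (MAX B\<in>Pow V. \<bar>(\<Sum>x\<in>B. \<mu> x) - (\<Sum>x\<in>B. \<nu> x)\<bar>)"

definition mixing_time :: "'a pair_pre_digraph \<Rightarrow> nat" where
  "mixing_time G =
     (LEAST t. (MAX x\<in>pverts G.
        tv_dist (pverts G) (lazy_srw_power G t x) (uniform_dist (pverts G))) \<le> 1 / 4)"

definition cylinder :: "'a pair_pre_digraph \<Rightarrow> ('a \<times> int) set" where
  "cylinder G = pverts G \<times> UNIV"

fun cylinder_kernel :: "'a pair_pre_digraph \<Rightarrow> 'a \<times> int \<Rightarrow> 'a \<times> int \<Rightarrow> real" where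
  "cylinder_kernel G (x, y) (x', y') =
     (if x' = x \<and> y' = y + 1 then 1 / 4 else 0) +
     (if x' = x \<and> y' = y - 1 then 1 / 4 else 0) +
     (if y' = y then lazy_srw G x x' / 2 else 0)"

definition path_space :: "'a pair_pre_digraph \<Rightarrow> (nat \<Rightarrow> 'a \<times> int) measure" where
  "path_space G = (\<Pi>\<^sub>M n\<in>UNIV. count_space (cylinder G))"

text \<open>
  \<open>X \<omega> n\<close> is the position at time \<open>n\<close> of a cylinder walk started uniformly on level \<open>0\<close>: a Markov
  chain with this initial law and kernel, specified by its finite-dimensional distributions.
\<close>

definition cylinder_walk ::
    "'w measure \<Rightarrow> 'a pair_pre_digraph \<Rightarrow> ('w \<Rightarrow> nat \<Rightarrow> 'a \<times> int) \<Rightarrow> bool" where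
  "cylinder_walk M G X \<longleftrightarrow>
     X \<in> M \<rightarrow>\<^sub>M path_space G \<and>
     (\<forall>n z. measure M {\<omega> \<in> space M. \<forall>i\<le>n. X \<omega> i = z i} =
        (if snd (z 0) = 0 then uniform_dist (pverts G) (fst (z 0)) else 0) *
        (\<Prod>i<n. cylinder_kernel G (z i) (z (Suc i))))"

definition below :: "'a pair_pre_digraph \<Rightarrow> real \<Rightarrow> ('a \<times> int) set" where
  "below G k = {(x, y) \<in> cylinder G. real_of_int y \<le> k}"

definition exit_site :: "('a \<times> int) set \<Rightarrow> (nat \<Rightarrow> 'a \<times> int) \<Rightarrow> 'a \<times> int" where
  "exit_site A p = p (LEAST n. p n \<notin> A)"

text \<open>
  \<open>w t\<close> is the path of the \<open>t\<close>-th walk, for \<open>t \<ge> 1\<close>. On the null event that it never leaves the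
  current cluster, \<^const>\<open>exit_site\<close> is one of its sites inside the cluster, which is then unchanged.
\<close>

primrec idla :: "'a pair_pre_digraph \<Rightarrow> (nat \<Rightarrow> nat \<Rightarrow> 'a \<times> int) \<Rightarrow> nat \<Rightarrow> ('a \<times> int) set" where
  "idla G w 0 = below G 0"
| "idla G w (Suc t) = idla G w t \<union> {exit_site (idla G w t) (w (Suc t))}"

definition idla_walks ::
    "'w measure \<Rightarrow> 'a pair_pre_digraph \<Rightarrow> (nat \<Rightarrow> 'w \<Rightarrow> nat \<Rightarrow> 'a \<times> int) \<Rightarrow> bool" where
  "idla_walks M G W \<longleftrightarrow>
     prob_space M \<and>
     prob_space.indep_vars M (\<lambda>_. path_space G) W {1..} \<and>
     (\<forall>t\<ge>1. cylinder_walk M G (W t))"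

definition log_plus :: "real \<Rightarrow> real" where
  "log_plus s = max (ln s) 0"

definition T_sharp :: "'a pair_pre_digraph \<Rightarrow> nat \<Rightarrow> real" where
  "T_sharp G N = real N * sqrt (real (mixing_time G)) * (ln (real N))\<^sup>2"

definition Delta :: "real \<Rightarrow> 'a pair_pre_digraph \<Rightarrow> nat \<Rightarrow> nat \<Rightarrow> real" where
  "Delta C G N T =
     C * max (ln (real N))
           (sqrt (min (real T) (T_sharp G N) / real N
                  * (ln (real N) + log_plus (real T / real N))))"

end

theory Submission
  imports Defs
begin

text \<open>
  Why the cluster is close to a half-cylinder. Fix a site \<open>(z, k)\<close> with \<open>k \<ge> 1\<close>, and for a site \<open>w\<close> on
  or below level \<open>k\<close> let \<open>H(w)\<close> be the probability that a walk from \<open>w\<close> first reaches level \<open>k\<close> at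
  \<open>z\<close>. This function is harmonic below level \<open>k\<close>, and it sums to \<open>1\<close> over every level because the
  lazy walk is symmetric on a regular graph. Stop every walk when it leaves the cluster or reaches
  level \<open>k\<close>, whichever is first. A walk from a uniform site of level \<open>0\<close> then has mean value
  \<open>1/N\<close> of \<open>H\<close> at its stopping site, whatever the cluster is, so the sum of \<open>H - 1/N\<close> over the
  stopping sites of the first \<open>T\<close> walks is a martingale. Settled sites are distinct, so they
  contribute at most one per level, and a walk stopped on level \<open>k\<close> contributes \<open>1\<close> if it is at \<open>z\<close>
  and \<open>0\<close> otherwise. If \<open>(z, k)\<close> is missed by all the walks, the martingale is therefore at most
  \<open>(k - 1) - T/N\<close>; if all levels below \<open>k\<close> are full, it equals the number of visits to \<open>(z, k)\<close> plus
  \<open>(k - 1) - T/N\<close>.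

  The fluctuations of this martingale are governed by the sum of \<open>(H - 1/N)\<^sup>+\<close> over the settled
  sites (\<open>exp_supermartingale\<close>). This sum is at most \<open>k - 1\<close> trivially. It is also at most a constant
  times \<open>\<surd>\<tau>\<^sub>m\<^sub>i\<^sub>x log N\<close>, since a walk that has to climb further than that is mixed on arrival and
  \<open>H\<close> is almost \<open>1/N\<close> (\<open>total_excess_le_mixing\<close>). Both bounds are deterministic, so the estimate
  holds at each \<open>T\<close> separately, with fluctuations of order
  \<open>max (log N) (\<surd>(min (T/N) (\<surd>\<tau>\<^sub>m\<^sub>i\<^sub>x log N) log N))\<close>. The inner bound follows by a union bound over
  the sites below \<open>T/N\<close> minus this margin.

  For the outer bound take \<open>k\<close> to be \<open>T/N\<close> minus the margin and pause the walks that reach level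
  \<open>k\<close>. With high probability the levels below \<open>k\<close> are then full and each site of level \<open>k\<close> holds at
  most \<open>h\<close> paused walks, where \<open>h\<close> is four times the margin. The order in which walks are run does
  not change the law of the final cluster (\<open>agg_commute\<close>), so the paused walks may be released at
  the end (\<open>growth_eq_stage\<close>), and releasing more walks can only enlarge the cluster. They may hence
  be replaced by a constant times \<open>N (h + log N)\<close> walks from independent uniform sites of level \<open>k\<close>,
  which contain \<open>h\<close> walks from each site with probability at least one half. A walk from a uniform
  site first hits any level \<open>j\<close> at a uniform site, and it passes beyond \<open>j\<close> only if this site is
  occupied. The expected number of sites at or above level \<open>k + i\<close> after \<open>n\<close> releases is thus at
  most \<open>N (n/N)\<^bsup>i+1\<^esup> / (i+1)!\<close> (\<open>expected_above\<close>), which is negligible once \<open>i\<close> is a large multiple of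
  \<open>h + log N\<close>.
\<close>

section \<open>Exit distributions of the cylinder walk\<close>

abbreviation pr :: "'b pmf \<Rightarrow> 'b set \<Rightarrow> real" where
  "pr \<equiv> measure_pmf.prob"

text \<open>
  A convex sequence with a positive increment grows at least linearly from there on. This is the
  one-dimensional Liouville property of the vertical walk; it is used for survival probabilities and
  for the total mass of hitting probabilities.
\<close>
lemma bounded_convex_le_start:
  fixes f :: "nat \<Rightarrow> real"
  assumes convex: "\<And>j. 2 * f (Suc j) \<le> f j + f (Suc (Suc j))" and bounded: "\<And>j. f j \<le> B"
  shows "f j \<le> f 0"
proof -
  have "f (Suc i) \<le> f i" for i
  proof (rule ccontr)
    assume "\<not> f (Suc i) \<le> f i"
    then have pos: "f (Suc i) - f i > 0" by simp
    have slope: "f (Suc i) - f i \<le> f (Suc (i + n)) - f (i + n)" for n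
    proof (induction n)
      case (Suc n) then show ?case using convex[of "i + n"] by simp
    qed simp
    have linear: "f i + real n * (f (Suc i) - f i) \<le> f (i + n)" for n
    proof (induction n)
      case (Suc n) then show ?case using slope[of n] by (simp add: algebra_simps)
    qed simp
    obtain n :: nat where "real n * (f (Suc i) - f i) > B - f i"
      using pos ex_less_of_nat_mult by blast
    with linear[of n] bounded[of "i + n"] show False by simp
  qed
  then show ?thesis by (induction j) (auto intro: order_trans)
qed

lemma prob_bind_pmf:
  "pr (bind_pmf p f) S = measure_pmf.expectation p (\<lambda>x. pr (f x) S)"
proof -
  have "ennreal (pr (bind_pmf p f) S) = (\<integral>\<^sup>+ x. ennreal (pr (f x) S) \<partial>p)"
    by (simp add: measure_pmf.emeasure_eq_measure[symmetric])
  also have "\<dots> = ennreal (measure_pmf.expectation p (\<lambda>x. pr (f x) S))"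
    by (intro nn_integral_eq_integral measure_pmf.integrable_const_bound[where B=1]) auto
  finally show ?thesis
    by (subst (asm) ennreal_inj) (auto intro!: integral_nonneg_AE)
qed

text \<open>
  Vertex-transitivity makes the graph regular and hence the lazy walk symmetric. The walk on the
  cylinder and the growth process are studied on the basis of the properties below; mixing comes later.
\<close>
locale regular_cylinder =
  fixes G :: "'a pair_pre_digraph"
  assumes finite_verts: "finite (pverts G)"
    and verts_nonempty: "pverts G \<noteq> {}"
    and lazy_srw_stochastic: "x \<in> pverts G \<Longrightarrow> (\<Sum>x'\<in>pverts G. lazy_srw G x x') = 1"
    and lazy_srw_sym: "\<lbrakk>x \<in> pverts G; x' \<in> pverts G\<rbrakk> \<Longrightarrow> lazy_srw G x x' = lazy_srw G x' x"
begin

abbreviation "V \<equiv> pverts G"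
abbreviation "P \<equiv> lazy_srw G"
abbreviation "cyl \<equiv> cylinder G"

lemma P_nonneg [simp]: "0 \<le> P x x'"
  by (simp add: lazy_srw_def)

lemma in_cyl [simp]: "(x, y) \<in> cyl \<longleftrightarrow> x \<in> V"
  by (simp add: cylinder_def)

lemma cylinder_kernel_nonneg [simp]: "0 \<le> cylinder_kernel G z w"
  by (cases z; cases w) simp

definition mean_step :: "('a \<times> int \<Rightarrow> real) \<Rightarrow> 'a \<times> int \<Rightarrow> real" where
  "mean_step g = (\<lambda>(x, y).
     g (x, y + 1) / 4 + g (x, y - 1) / 4 + (\<Sum>x'\<in>V. P x x' * g (x', y)) / 2)"

text \<open>
  A finite set, convenient for sums, that contains all possible next positions.
\<close>
definition neighbours :: "'a \<times> int \<Rightarrow> ('a \<times> int) set" where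
  "neighbours z = V \<times> {snd z - 1, snd z, snd z + 1}"

lemma finite_neighbours [simp]: "finite (neighbours z)"
  by (simp add: neighbours_def finite_verts)

lemma sum_cylinder_kernel:
  assumes "z \<in> cyl"
  shows "(\<Sum>w\<in>neighbours z. cylinder_kernel G z w * g w) = mean_step g z"
proof (cases z)
  case (Pair x y)
  with assms have x: "x \<in> V" by simp
  have "(\<Sum>w\<in>neighbours z. cylinder_kernel G z w * g w)
      = (\<Sum>x'\<in>V. \<Sum>y'\<in>{y - 1, y, y + 1}. cylinder_kernel G (x, y) (x', y') * g (x', y'))"
    unfolding neighbours_def Pair snd_conv
    by (subst sum.cartesian_product) (auto intro!: sum.cong simp del: cylinder_kernel.simps)
  also have "\<dots> = (\<Sum>x'\<in>V. (if x' = x then g (x', y + 1) / 4 else 0)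
      + (if x' = x then g (x', y - 1) / 4 else 0) + P x x' * g (x', y) / 2)"
    by (intro sum.cong) (auto simp: algebra_simps)
  also have "\<dots> = mean_step g z"
    using x finite_verts by (simp add: sum.distrib mean_step_def Pair sum_divide_distrib)
  finally show ?thesis .
qed

lemma sum_cylinder_kernel_1: "z \<in> cyl \<Longrightarrow> (\<Sum>w\<in>neighbours z. cylinder_kernel G z w) = 1"
  using sum_cylinder_kernel[of z "\<lambda>_. 1"] by (auto simp: mean_step_def lazy_srw_stochastic split: prod.splits)

lemma cylinder_kernel_outside:
  assumes "w \<in> cyl" "w \<notin> neighbours z" shows "cylinder_kernel G z w = 0"
  using assms by (cases z; cases w) (auto simp: neighbours_def)

text \<open>
  The restriction to the cylinder makes this a distribution by the row sums over \<open>V\<close> alone.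
\<close>
definition step :: "'a \<times> int \<Rightarrow> ('a \<times> int) pmf" where
  "step z = embed_pmf (\<lambda>w. if w \<in> cyl then cylinder_kernel G z w else 0)"

lemma pmf_step:
  assumes "z \<in> cyl"
  shows "pmf (step z) w = (if w \<in> cyl then cylinder_kernel G z w else 0)"
proof -
  have "(\<integral>\<^sup>+ w. ennreal (if w \<in> cyl then cylinder_kernel G z w else 0) \<partial>count_space UNIV)
      = (\<Sum>w\<in>neighbours z. ennreal (if w \<in> cyl then cylinder_kernel G z w else 0))"
    by (intro nn_integral_count_space') (auto simp: cylinder_kernel_outside)
  also have "\<dots> = (\<Sum>w\<in>neighbours z. ennreal (cylinder_kernel G z w))"
    by (intro sum.cong) (auto simp: neighbours_def)
  also have "\<dots> = 1" using assms by (simp add: sum_ennreal sum_cylinder_kernel_1)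
  finally show ?thesis
    unfolding step_def by (subst pmf_embed_pmf) auto
qed

lemma set_step: "z \<in> cyl \<Longrightarrow> set_pmf (step z) \<subseteq> neighbours z"
  using cylinder_kernel_outside[of _ z] by (force simp: set_pmf_eq pmf_step split: if_splits)

lemma neighbours_in_cyl: "w \<in> neighbours z \<Longrightarrow> w \<in> cyl"
  by (auto simp: neighbours_def)

lemma set_step_cyl: "z \<in> cyl \<Longrightarrow> w \<in> set_pmf (step z) \<Longrightarrow> w \<in> cyl"
  using set_step neighbours_in_cyl by blast

lemma expectation_step:
  assumes "z \<in> cyl"
  shows "measure_pmf.expectation (step z) g = mean_step g z"
proof -
  have "measure_pmf.expectation (step z) g = (\<Sum>w\<in>neighbours z. pmf (step z) w * g w)"
    using set_step[OF assms] by (subst integral_measure_pmf_real[of "neighbours z"]) (auto simp: mult.commute)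
  also have "\<dots> = (\<Sum>w\<in>neighbours z. cylinder_kernel G z w * g w)"
    by (intro sum.cong) (simp_all add: pmf_step[OF assms] neighbours_in_cyl)
  finally show ?thesis using sum_cylinder_kernel[OF assms] by simp
qed

lemma nn_integral_step:
  assumes "z \<in> cyl" "\<And>w. 0 \<le> g w"
  shows "(\<integral>\<^sup>+ w. ennreal (g w) \<partial>step z) = ennreal (mean_step g z)"
  using assms(2) expectation_step[OF assms(1), of g] finite_subset[OF set_step[OF assms(1)]]
  by (subst nn_integral_eq_integral) (auto intro!: integrable_measure_pmf_finite)

text \<open>
  The walk frozen at its first site outside \<open>A\<close>, after \<open>n\<close> steps.
\<close>
primrec run :: "('a \<times> int) set \<Rightarrow> nat \<Rightarrow> 'a \<times> int \<Rightarrow> ('a \<times> int) pmf" where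
  "run A 0 z = return_pmf z"
| "run A (Suc n) z = (if z \<in> A then bind_pmf (step z) (run A n) else return_pmf z)"

text \<open>
  Walks leave such a set almost surely, by recurrence of their vertical component. Every cluster
  is of this kind.
\<close>
definition bounded_above :: "('a \<times> int) set \<Rightarrow> bool" where
  "bounded_above A \<longleftrightarrow> (\<exists>K. \<forall>(x, y)\<in>A. y \<le> K)"

lemma set_run_cyl: "z \<in> cyl \<Longrightarrow> set_pmf (run A n z) \<subseteq> cyl"
proof (induction n arbitrary: z)
  case (Suc n)
  show ?case
  proof (cases "z \<in> A")
    case True
    have "set_pmf (run A n w) \<subseteq> cyl" if "w \<in> set_pmf (step z)" for w
      using Suc.IH set_step_cyl[OF Suc.prems that] .
    then show ?thesis using True by (simp add: UN_least)
  qed (use Suc.prems in simp)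
qed simp

abbreviation survival :: "('a \<times> int) set \<Rightarrow> nat \<Rightarrow> 'a \<times> int \<Rightarrow> real" where
  "survival A n z \<equiv> pr (run A n z) A"

lemma survival_Suc:
  assumes "z \<in> cyl"
  shows "survival A (Suc n) z = (if z \<in> A then mean_step (survival A n) z else 0)"
  using assms by (simp add: prob_bind_pmf expectation_step indicator_def)

lemma mean_step_mono:
  assumes "z \<in> cyl" "\<And>w. w \<in> cyl \<Longrightarrow> g w \<le> g' w"
  shows "mean_step g z \<le> mean_step g' z"
  using assms
  by (cases z) (auto simp: mean_step_def intro!: add_mono divide_right_mono sum_mono mult_left_mono)

lemma survival_decreasing: "z \<in> cyl \<Longrightarrow> survival A (Suc n) z \<le> survival A n z"
proof (induction n arbitrary: z)
  case 0
  show ?case by (auto simp: indicator_def)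
next
  case (Suc n)
  then show ?case by (subst (1 2) survival_Suc) (auto intro: mean_step_mono)
qed

lemma mean_step_tendsto:
  assumes "z \<in> cyl" "\<And>w. w \<in> cyl \<Longrightarrow> (\<lambda>n. g n w) \<longlonglongrightarrow> L w"
  shows "(\<lambda>n. mean_step (g n) z) \<longlonglongrightarrow> mean_step L z"
  using assms by (cases z) (auto simp: mean_step_def intro!: tendsto_intros)

text \<open>
  The limiting survival probability is harmonic inside \<open>A\<close>. Its maximum over a level is a bounded
  convex function of the depth below the top of \<open>A\<close> which vanishes just above \<open>A\<close>, so it is zero.
\<close>
lemma survival_tendsto_0:
  assumes A: "bounded_above A" and z: "z \<in> cyl"
  shows "(\<lambda>n. survival A n z) \<longlonglongrightarrow> 0"
proof -
  obtain K where K: "\<And>x y. (x, y) \<in> A \<Longrightarrow> y \<le> K" using A by (auto simp: bounded_above_def)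
  define L where "L w = lim (\<lambda>n. survival A n w)" for w
  have L: "(\<lambda>n. survival A n w) \<longlonglongrightarrow> L w" if "w \<in> cyl" for w
  proof -
    have "decseq (\<lambda>n. survival A n w)"
      using survival_decreasing[OF that] by (intro decseq_SucI)
    then have "convergent (\<lambda>n. survival A n w)"
      using decseq_convergent[of "\<lambda>n. survival A n w" 0] by (auto simp: convergent_def)
    then show ?thesis unfolding L_def by (simp add: convergent_LIMSEQ_iff)
  qed
  have L01: "0 \<le> L w \<and> L w \<le> 1" if "w \<in> cyl" for w
    using LIMSEQ_le_const[OF L[OF that], of 0] LIMSEQ_le_const2[OF L[OF that], of 1] by auto
  have L_eq: "L w = (if w \<in> A then mean_step L w else 0)" if "w \<in> cyl" for w
  proof (rule LIMSEQ_unique[OF LIMSEQ_Suc[OF L[OF that]]])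
    show "(\<lambda>n. survival A (Suc n) w) \<longlonglongrightarrow> (if w \<in> A then mean_step L w else 0)"
      using mean_step_tendsto[OF that, of "\<lambda>n. survival A n" L] L
      by (cases "w \<in> A") (simp_all only: survival_Suc[OF that] if_True if_False tendsto_const)
  qed
  define m where "m j = (MAX x\<in>V. L (x, K + 1 - int j))" for j
  have le_m: "L (x, K + 1 - int j) \<le> m j" if "x \<in> V" for x j
    unfolding m_def using that finite_verts by auto
  have m_in: "\<exists>x\<in>V. m j = L (x, K + 1 - int j)" for j
  proof -
    have "m j \<in> (\<lambda>x. L (x, K + 1 - int j)) ` V"
      unfolding m_def using finite_verts verts_nonempty by (intro Max_in) auto
    then show ?thesis by blast
  qed
  have m_nonneg: "0 \<le> m j" for j using m_in[of j] L01 by force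
  have "m j \<le> m 0" for j
  proof (rule bounded_convex_le_start[where B = 1])
    show "m j \<le> 1" for j using m_in[of j] L01 by force
    fix j
    obtain x where x: "x \<in> V" "m (Suc j) = L (x, K + 1 - int (Suc j))" using m_in by blast
    have "L (x, K + 1 - int (Suc j)) \<le> m j / 4 + m (Suc (Suc j)) / 4 + m (Suc j) / 2"
    proof (cases "(x, K + 1 - int (Suc j)) \<in> A")
      case True
      have "L (x, K + 1 - int (Suc j)) = mean_step L (x, K + 1 - int (Suc j))"
        using L_eq[of "(x, K + 1 - int (Suc j))"] x True by simp
      also have "\<dots> = L (x, K + 1 - int j) / 4 + L (x, K + 1 - int (Suc (Suc j))) / 4
          + (\<Sum>x'\<in>V. P x x' * L (x', K + 1 - int (Suc j))) / 2"
        by (simp add: mean_step_def algebra_simps)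
      also have "(\<Sum>x'\<in>V. P x x' * L (x', K + 1 - int (Suc j))) \<le> (\<Sum>x'\<in>V. P x x' * m (Suc j))"
        by (intro sum_mono mult_left_mono le_m) auto
      also have "\<dots> = m (Suc j)" using lazy_srw_stochastic[OF x(1)] by (simp add: sum_distrib_right[symmetric])
      finally show ?thesis using le_m[OF x(1), of j] le_m[OF x(1), of "Suc (Suc j)"] by simp
    next
      case False
      then show ?thesis using L_eq[of "(x, K + 1 - int (Suc j))"] x m_nonneg[of j] m_nonneg[of "Suc j"]
        m_nonneg[of "Suc (Suc j)"] by simp
    qed
    then show "2 * m (Suc j) \<le> m j + m (Suc (Suc j))" using x by simp
  qed
  moreover have "m 0 = 0" using m_in[of 0] L_eq K by fastforce
  ultimately have m0: "m j = 0" for j using m_nonneg[of j] by (simp add: order_antisym)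
  have "L z = 0"
  proof (cases "z \<in> A")
    case True
    obtain x y where zz: "z = (x, y)" by (cases z)
    have "y = K + 1 - int (nat (K + 1 - y))" using K True zz by fastforce
    then show ?thesis using le_m[of x "nat (K + 1 - y)"] m0 L01[OF z] z zz by auto
  qed (use L_eq z in auto)
  then show ?thesis using L[OF z] by simp
qed

text \<open>
  The pmf of the frozen walk at a site outside \<open>A\<close> increases with time, so the supremum is the
  exit probability.
\<close>
definition exit :: "('a \<times> int) set \<Rightarrow> 'a \<times> int \<Rightarrow> ('a \<times> int) pmf" where
  "exit A z = embed_pmf (\<lambda>w. if w \<in> A then 0 else SUP n. pmf (run A n z) w)"

lemma pmf_run_incseq:
  assumes "w \<notin> A" shows "incseq (\<lambda>n. pmf (run A n z) w)"
proof (rule incseq_SucI)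
  show "pmf (run A n z) w \<le> pmf (run A (Suc n) z) w" for n
  proof (induction n arbitrary: z)
    case 0
    show ?case using assms by (auto simp: indicator_def)
  next
    case (Suc n)
    show ?case
    proof (cases "z \<in> A")
      case True
      have "pmf (bind_pmf (step z) (run A n)) w \<le> pmf (bind_pmf (step z) (run A (Suc n))) w"
        unfolding pmf_bind using Suc.IH
        by (intro integral_mono measure_pmf.integrable_const_bound[where B = 1])
           (auto simp: pmf_le_1 simp del: run.simps)
      then show ?thesis using True by (metis run.simps(2))
    qed simp
  qed
qed

lemma bdd_above_pmf_run: "bdd_above (range (\<lambda>n. pmf (run A n z) w))"
  by (auto intro!: bdd_aboveI[where M = 1] simp: pmf_le_1)

lemma ennreal_SUP_pmf_run:
  "ennreal (SUP n. pmf (run A n z) w) = (SUP n. ennreal (pmf (run A n z) w))"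
proof (rule ennreal_SUP)
  show "(SUP n. ennreal (pmf (run A n z) w)) \<noteq> \<top>"
    using SUP_least[of UNIV "\<lambda>n. ennreal (pmf (run A n z) w)" 1]
    by (metis ennreal_le_1 ennreal_one_less_top leD pmf_le_1)
qed auto

lemma nn_integral_run_limit:
  "(\<integral>\<^sup>+ w. ennreal (if w \<in> A then 0 else SUP n. pmf (run A n z) w) * g w \<partial>count_space UNIV)
     = (SUP n. \<integral>\<^sup>+ w. g w * indicator (- A) w \<partial>run A n z)"
proof -
  have "(\<integral>\<^sup>+ w. ennreal (if w \<in> A then 0 else SUP n. pmf (run A n z) w) * g w \<partial>count_space UNIV)
     = (\<integral>\<^sup>+ w. (SUP n. ennreal (pmf (run A n z) w) * (g w * indicator (- A) w)) \<partial>count_space UNIV)"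
    by (intro nn_integral_cong) (auto simp: ennreal_SUP_pmf_run SUP_mult_right_ennreal)
  also have "\<dots> = (SUP n. \<integral>\<^sup>+ w. ennreal (pmf (run A n z) w) * (g w * indicator (- A) w) \<partial>count_space UNIV)"
  proof (rule nn_integral_monotone_convergence_SUP)
    show "incseq (\<lambda>n w. ennreal (pmf (run A n z) w) * (g w * indicator (- A) w))"
      using pmf_run_incseq[of _ A z]
      by (auto simp: incseq_def le_fun_def indicator_def intro!: mult_right_mono ennreal_leI)
  qed simp
  finally show ?thesis by (simp add: nn_integral_measure_pmf)
qed

text \<open>
  No mass is lost in the limit, so the exit probabilities form a distribution.
\<close>
lemma SUP_run_complement:
  assumes "bounded_above A" "z \<in> cyl"
  shows "(SUP n. emeasure (run A n z) (- A)) = 1"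
proof -
  have "(\<lambda>n. ennreal (1 - survival A n z)) \<longlonglongrightarrow> ennreal (1 - 0)"
    by (intro tendsto_ennrealI tendsto_diff tendsto_const survival_tendsto_0 assms)
  moreover have "ennreal (1 - survival A n z) = emeasure (run A n z) (- A)" for n
    by (simp add: measure_pmf.emeasure_eq_measure measure_pmf.prob_compl[of A, simplified, unfolded Compl_eq_Diff_UNIV[symmetric]])
  moreover have "incseq (\<lambda>n. ennreal (1 - survival A n z))"
    using survival_decreasing[OF assms(2)] by (auto intro!: incseq_SucI ennreal_leI)
  ultimately show ?thesis using LIMSEQ_SUP[of "\<lambda>n. emeasure (run A n z) (- A)"] 
    by (auto dest: LIMSEQ_unique)
qed

context
  fixes A z
  assumes A: "bounded_above A" and z: "z \<in> cyl"
begin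

lemma pmf_exit: "pmf (exit A z) w = (if w \<in> A then 0 else SUP n. pmf (run A n z) w)"
  unfolding exit_def
proof (rule pmf_embed_pmf)
  show "0 \<le> (if w \<in> A then 0 else SUP n. pmf (run A n z) w)" for w
    by (auto intro!: cSUP_upper2[OF bdd_above_pmf_run])
  show "(\<integral>\<^sup>+ w. ennreal (if w \<in> A then 0 else SUP n. pmf (run A n z) w) \<partial>count_space UNIV) = 1"
    using nn_integral_run_limit[of A z "\<lambda>_. 1"] SUP_run_complement[OF A z] by simp
qed

lemma nn_integral_exit:
  "(\<integral>\<^sup>+ w. g w \<partial>exit A z) = (SUP n. \<integral>\<^sup>+ w. g w * indicator (- A) w \<partial>run A n z)"
  unfolding nn_integral_measure_pmf[of "exit A z"] pmf_exit by (rule nn_integral_run_limit)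

lemma pmf_exit_LIMSEQ: "w \<notin> A \<Longrightarrow> (\<lambda>n. pmf (run A n z) w) \<longlonglongrightarrow> pmf (exit A z) w"
  unfolding pmf_exit using LIMSEQ_incseq_SUP[OF bdd_above_pmf_run pmf_run_incseq[of w A z]] by simp

lemma set_exit_run: "w \<in> set_pmf (exit A z) \<Longrightarrow> w \<notin> A \<and> (\<exists>n. w \<in> set_pmf (run A n z))"
proof -
  assume w: "w \<in> set_pmf (exit A z)"
  then have "w \<notin> A" by (auto simp: set_pmf_eq pmf_exit split: if_splits)
  moreover have "\<exists>n. w \<in> set_pmf (run A n z)"
  proof (rule ccontr)
    assume "\<nexists>n. w \<in> set_pmf (run A n z)"
    then have "pmf (run A n z) w = 0" for n by (simp add: set_pmf_eq)
    then show False using w by (simp add: set_pmf_eq pmf_exit split: if_splits)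
  qed
  ultimately show ?thesis by blast
qed

lemma set_exit: "set_pmf (exit A z) \<subseteq> cyl - A"
  using set_exit_run set_run_cyl[OF z] by blast

end

lemma set_run_level:
  assumes A: "\<And>x y. (x, y) \<in> A \<Longrightarrow> y \<le> K"
  shows "z \<in> cyl \<Longrightarrow> snd z \<le> K + 1 \<Longrightarrow> w \<in> set_pmf (run A n z) \<Longrightarrow> snd w \<le> K + 1"
proof (induction n arbitrary: z)
  case (Suc n)
  show ?case
  proof (cases "z \<in> A")
    case True
    then obtain z' where z': "z' \<in> set_pmf (step z)" "w \<in> set_pmf (run A n z')" using Suc.prems by auto
    have "z' \<in> neighbours z" using set_step Suc.prems z' by blast
    moreover have "snd z \<le> K" using True A by (cases z) auto
    ultimately have "z' \<in> cyl" "snd z' \<le> K + 1" by (auto simp: neighbours_def)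
    then show ?thesis using Suc.IH z' by blast
  qed (use Suc.prems in simp)
qed simp

lemma exit_level:
  assumes "\<And>x y. (x, y) \<in> A \<Longrightarrow> y \<le> K" "z \<in> cyl" "snd z \<le> K + 1" "w \<in> set_pmf (exit A z)"
  shows "snd w \<le> K + 1"
proof -
  have "bounded_above A" using assms(1) by (auto simp: bounded_above_def)
  then show ?thesis using set_exit_run assms set_run_level[of A K] by meson
qed

lemma exit_outside:
  assumes "z \<in> cyl" "z \<notin> A" "bounded_above A" shows "exit A z = return_pmf z"
proof (rule pmf_eqI)
  fix w
  have "run A n z = return_pmf z" for n using assms by (cases n) auto
  then show "pmf (exit A z) w = pmf (return_pmf z) w"
    using assms by (auto simp: pmf_exit indicator_def)
qed

lemma nn_integral_run_harmonic:
  assumes g: "\<And>w. 0 \<le> g w" and harm: "\<And>w. w \<in> A \<Longrightarrow> w \<in> cyl \<Longrightarrow> mean_step g w = g w"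
  shows "z \<in> cyl \<Longrightarrow> (\<integral>\<^sup>+ w. ennreal (g w) \<partial>run A n z) = ennreal (g z)"
proof (induction n arbitrary: z)
  case (Suc n)
  show ?case
  proof (cases "z \<in> A")
    case True
    have "(\<integral>\<^sup>+ w. ennreal (g w) \<partial>run A (Suc n) z) = (\<integral>\<^sup>+ z'. \<integral>\<^sup>+ w. ennreal (g w) \<partial>run A n z' \<partial>step z)"
      using True by simp
    also have "\<dots> = (\<integral>\<^sup>+ z'. ennreal (g z') \<partial>step z)"
      using Suc set_step_cyl
      by (intro nn_integral_cong_AE) (auto simp: AE_measure_pmf_iff)
    also have "\<dots> = ennreal (g z)" using nn_integral_step[OF Suc.prems] g harm[OF True] Suc.prems by simp
    finally show ?thesis .
  qed (use g in \<open>simp add: nn_integral_return\<close>)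
qed (use g in simp)

text \<open>
  The mean of a harmonic function is preserved up to any finite time, and boundedness controls the
  contribution of the walks that are still inside \<open>A\<close>, whose probability tends to \<open>0\<close>.
\<close>
lemma optional_stopping:
  assumes A: "bounded_above A" and z: "z \<in> cyl"
    and g: "\<And>w. 0 \<le> g w" "\<And>w. g w \<le> B"
    and harm: "\<And>w. w \<in> A \<Longrightarrow> w \<in> cyl \<Longrightarrow> mean_step g w = g w"
  shows "(\<integral>\<^sup>+ w. ennreal (g w) \<partial>exit A z) = ennreal (g z)"
proof (rule antisym)
  have run: "(\<integral>\<^sup>+ w. ennreal (g w) \<partial>run A n z) = ennreal (g z)" for n
    by (rule nn_integral_run_harmonic[OF g(1) harm z])
  have "(\<integral>\<^sup>+ w. ennreal (g w) * indicator (- A) w \<partial>run A n z) \<le> ennreal (g z)" for n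
    unfolding run[symmetric, of n] by (intro nn_integral_mono) (auto simp: indicator_def)
  then show "(\<integral>\<^sup>+ w. ennreal (g w) \<partial>exit A z) \<le> ennreal (g z)"
    unfolding nn_integral_exit[OF A z] by (intro SUP_least)
  have "ennreal (g z) \<le> (\<integral>\<^sup>+ w. ennreal (g w) \<partial>exit A z) + ennreal (B * survival A n z)" for n
  proof -
    have B: "0 \<le> B" using g order_trans by blast
    have "ennreal (g z) = (\<integral>\<^sup>+ w. ennreal (g w) * indicator (- A) w + ennreal (g w) * indicator A w \<partial>run A n z)"
      unfolding run[symmetric, of n] by (intro nn_integral_cong) (auto simp: indicator_def)
    also have "\<dots> = (\<integral>\<^sup>+ w. ennreal (g w) * indicator (- A) w \<partial>run A n z)
        + (\<integral>\<^sup>+ w. ennreal (g w) * indicator A w \<partial>run A n z)"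
      by (rule nn_integral_add) auto
    also have "\<dots> \<le> (\<integral>\<^sup>+ w. ennreal (g w) \<partial>exit A z) + (\<integral>\<^sup>+ w. ennreal B * indicator A w \<partial>run A n z)"
      unfolding nn_integral_exit[OF A z] using g
      by (intro add_mono nn_integral_mono SUP_upper) (auto simp: indicator_def intro!: ennreal_leI)
    also have "(\<integral>\<^sup>+ w. ennreal B * indicator A w \<partial>run A n z) = ennreal (B * survival A n z)"
      using B by (simp add: nn_integral_cmult_indicator measure_pmf.emeasure_eq_measure ennreal_mult)
    finally show ?thesis .
  qed
  moreover have "(\<lambda>n. (\<integral>\<^sup>+ w. ennreal (g w) \<partial>exit A z) + ennreal (B * survival A n z))
      \<longlonglongrightarrow> (\<integral>\<^sup>+ w. ennreal (g w) \<partial>exit A z) + ennreal (B * 0)"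
    by (intro tendsto_add tendsto_const tendsto_ennrealI tendsto_mult survival_tendsto_0[OF A z])
  ultimately show "ennreal (g z) \<le> (\<integral>\<^sup>+ w. ennreal (g w) \<partial>exit A z)"
    by (intro LIMSEQ_le_const[of "\<lambda>n. (\<integral>\<^sup>+ w. ennreal (g w) \<partial>exit A z) + ennreal (B * survival A n z)"])
       auto
qed

lemma bounded_above_subset: "A \<subseteq> B \<Longrightarrow> bounded_above B \<Longrightarrow> bounded_above A"
  unfolding bounded_above_def by blast

lemma mean_step_cong: "z \<in> cyl \<Longrightarrow> (\<And>w. w \<in> cyl \<Longrightarrow> g w = g' w) \<Longrightarrow> mean_step g z = mean_step g' z"
  by (cases z) (simp add: mean_step_def)

lemma pmf_exit_harmonic:
  assumes B: "bounded_above B" and w: "w \<in> B" "w \<in> cyl"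
  shows "mean_step (\<lambda>z. pmf (exit B z) c) w = pmf (exit B w) c"
proof (cases "c \<in> B")
  case True
  have "mean_step (\<lambda>z. pmf (exit B z) c) w = mean_step (\<lambda>_. 0) w"
    by (rule mean_step_cong) (use True B w in \<open>simp_all add: pmf_exit\<close>)
  then show ?thesis using True B w by (simp add: mean_step_def pmf_exit split: prod.split)
next
  case False
  show ?thesis
  proof (rule LIMSEQ_unique)
    show "(\<lambda>n. mean_step (\<lambda>z. pmf (run B n z) c) w) \<longlonglongrightarrow> mean_step (\<lambda>z. pmf (exit B z) c) w"
      by (intro mean_step_tendsto w pmf_exit_LIMSEQ B False)
    show "(\<lambda>n. mean_step (\<lambda>z. pmf (run B n z) c) w) \<longlonglongrightarrow> pmf (exit B w) c"
      using LIMSEQ_Suc[OF pmf_exit_LIMSEQ[OF B w(2) False]] w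
      by (simp add: pmf_bind expectation_step)
  qed
qed

text \<open>
  For a fixed exit site of the larger set, its probability is a harmonic function of the starting
  point on the larger set, hence on \<open>A\<close>, so optional stopping at the exit from \<open>A\<close> applies.
\<close>
lemma exit_strong_markov:
  assumes AB: "A \<subseteq> B" and B: "bounded_above B" and z: "z \<in> cyl"
  shows "exit B z = bind_pmf (exit A z) (exit B)"
proof (rule pmf_eqI)
  fix c
  have A: "bounded_above A" using AB B by (rule bounded_above_subset)
  have "ennreal (pmf (bind_pmf (exit A z) (exit B)) c) = (\<integral>\<^sup>+ w. ennreal (pmf (exit B w) c) \<partial>exit A z)"
    by (rule ennreal_pmf_bind)
  also have "\<dots> = ennreal (pmf (exit B z) c)"
    by (rule optional_stopping[OF A z, where B = 1]) (use AB B in \<open>auto simp: pmf_le_1 pmf_exit_harmonic\<close>)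
  finally show "pmf (exit B z) c = pmf (bind_pmf (exit A z) (exit B)) c" by simp
qed

end

section \<open>Aggregation, the abelian property and paused walks\<close>

lemma prob_le_bind_pmf:
  assumes "\<And>x. x \<in> set_pmf p \<Longrightarrow> x \<in> S \<Longrightarrow> set_pmf (f x) \<subseteq> T"
  shows "pr p S \<le> pr (bind_pmf p f) T"
proof -
  have "pr p S = measure_pmf.expectation p (indicator S)" by simp
  also have "\<dots> \<le> measure_pmf.expectation p (\<lambda>x. pr (f x) T)"
  proof (intro integral_mono_AE)
    have "pr (f x) T = 1" if "x \<in> set_pmf p" "x \<in> S" for x
      using assms[OF that] by (subst measure_pmf.prob_eq_1) (auto simp: AE_measure_pmf_iff)
    then show "AE x in p. indicator S x \<le> pr (f x) T"
      by (auto simp: AE_measure_pmf_iff indicator_def)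
  qed (auto intro!: measure_pmf.integrable_const_bound[where B = 1])
  finally show ?thesis by (simp only: prob_bind_pmf)
qed

context regular_cylinder
begin

text \<open>
  \<open>D\<close> is the set of sites where particles may settle; a particle that exits at a site outside \<open>D\<close>
  leaves the cluster unchanged. The growth of the actual cluster is the case \<open>D = UNIV\<close>, and the
  sites below level \<open>k\<close> are used to pause walks at level \<open>k\<close>.
\<close>
definition settle :: "('a \<times> int) set \<Rightarrow> 'a \<times> int \<Rightarrow> ('a \<times> int) set \<Rightarrow> ('a \<times> int) set" where
  "settle D c A = (if c \<in> D then insert c A else A)"

definition agg :: "('a \<times> int) set \<Rightarrow> 'a \<times> int \<Rightarrow> ('a \<times> int) set \<Rightarrow> ('a \<times> int) set pmf" where
  "agg D z A = map_pmf (\<lambda>c. settle D c A) (exit A z)"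

primrec aggs :: "('a \<times> int) set \<Rightarrow> ('a \<times> int) list \<Rightarrow> ('a \<times> int) set \<Rightarrow> ('a \<times> int) set pmf" where
  "aggs D [] A = return_pmf A"
| "aggs D (z # zs) A = bind_pmf (agg D z A) (aggs D zs)"

lemma bounded_above_insert [simp]: "bounded_above (insert c A) \<longleftrightarrow> bounded_above A"
proof
  assume "bounded_above A"
  then obtain K where "\<forall>(x, y)\<in>A. y \<le> K" by (auto simp: bounded_above_def)
  then have "\<forall>(x, y)\<in>insert c A. y \<le> max K (snd c)" by (auto simp: le_max_iff_disj)
  then show "bounded_above (insert c A)" unfolding bounded_above_def by blast
qed (auto simp: bounded_above_def)

lemma set_agg:
  assumes "B \<in> set_pmf (agg D z A)"
  shows "A \<subseteq> B" "bounded_above A \<Longrightarrow> bounded_above B"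
  using assms by (auto simp: agg_def settle_def split: if_splits)

lemma set_aggs:
  assumes "B \<in> set_pmf (aggs D zs A)"
  shows "A \<subseteq> B \<and> (bounded_above A \<longrightarrow> bounded_above B)"
  using assms
proof (induction zs arbitrary: A)
  case (Cons z zs)
  then obtain A' where "A' \<in> set_pmf (agg D z A)" "B \<in> set_pmf (aggs D zs A')" by auto
  then show ?case using Cons.IH[of A'] set_agg[of A' D z A] by auto
qed simp

text \<open>
  The abelian property for two particles. Let \<open>a\<close> and \<open>b\<close> be the exit sites from the same \<open>A\<close>. If they
  differ, the second particle is not affected by the first. If both are \<open>a\<close>, one of them settles there
  and the other one continues from \<open>a\<close>, by the strong Markov property. Both descriptions are symmetric
  in the two particles, and \<open>F\<close> is their common form.
\<close>
lemma agg_commute: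
  assumes A: "bounded_above A" and x: "x \<in> cyl" and y: "y \<in> cyl"
  shows "bind_pmf (agg D x A) (agg D y) = bind_pmf (agg D y A) (agg D x)"
proof -
  define F where "F a b = (if a = b \<and> a \<in> D then agg D a (insert a A)
    else return_pmf (settle D b (settle D a A)))" for a b
  have F_sym: "F a b = F b a" for a b
    by (auto simp: F_def settle_def insert_commute)
  have expand: "bind_pmf (agg D x A) (agg D y) = bind_pmf (exit A x) (\<lambda>a. bind_pmf (exit A y) (F a))"
    if y: "y \<in> cyl" and x: "x \<in> cyl" for x y
    unfolding agg_def[of D x A] bind_map_pmf
  proof (rule bind_pmf_cong[OF refl])
    fix a assume a: "a \<in> set_pmf (exit A x)"
    then have aA: "a \<in> cyl" "a \<notin> A" using set_exit[OF A x] by auto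
    show "agg D y (settle D a A) = bind_pmf (exit A y) (F a)"
    proof (cases "a \<in> D")
      case False
      then have "F a = (\<lambda>b. return_pmf (settle D b A))" by (auto simp: F_def settle_def)
      then show ?thesis using False by (simp add: agg_def settle_def map_pmf_def)
    next
      case True
      have "agg D y (settle D a A)
          = bind_pmf (exit A y) (\<lambda>b. map_pmf (\<lambda>c. settle D c (insert a A)) (exit (insert a A) b))"
        using True A exit_strong_markov[of A "insert a A" y] y
        by (simp add: agg_def settle_def map_bind_pmf subset_insertI)
      also have "\<dots> = bind_pmf (exit A y) (F a)"
      proof (rule bind_pmf_cong[OF refl])
        fix b assume "b \<in> set_pmf (exit A y)"
        then have "b \<in> cyl" "b \<notin> A" using set_exit[OF A y] by auto
        then show "map_pmf (\<lambda>c. settle D c (insert a A)) (exit (insert a A) b) = F a b"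
          using A True by (auto simp: F_def agg_def exit_outside settle_def)
      qed
      finally show ?thesis .
    qed
  qed
  have "bind_pmf (agg D x A) (agg D y) = bind_pmf (exit A y) (\<lambda>b. bind_pmf (exit A x) (\<lambda>a. F a b))"
    unfolding expand[OF y x] by (rule bind_commute_pmf)
  then show ?thesis unfolding expand[OF x y] by (simp add: F_sym)
qed

lemma aggs_append: "aggs D (xs @ ys) A = bind_pmf (aggs D xs A) (aggs D ys)"
proof (induction xs arbitrary: A)
  case (Cons x xs)
  have "aggs D (xs @ ys) = (\<lambda>A. bind_pmf (aggs D xs A) (aggs D ys))"
    using Cons.IH by blast
  then show ?case by (simp add: bind_assoc_pmf)
qed (simp add: bind_return_pmf)

lemma aggs_append_fun: "aggs D (xs @ ys) = (\<lambda>A. bind_pmf (aggs D xs A) (aggs D ys))"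
  by (simp add: aggs_append fun_eq_iff)

lemma aggs_Cons_fun: "aggs D (x # xs) = (\<lambda>A. bind_pmf (agg D x A) (aggs D xs))"
  by (simp add: fun_eq_iff)

lemma aggs_singleton: "aggs D [x] = agg D x"
proof -
  have nil: "aggs D [] = return_pmf" by (simp add: fun_eq_iff)
  show ?thesis by (simp add: aggs_Cons_fun nil bind_return_pmf')
qed

lemma aggs_rotate1:
  "\<lbrakk>bounded_above A; z \<in> cyl; set zs \<subseteq> cyl\<rbrakk> \<Longrightarrow> aggs D (zs @ [z]) A = aggs D (z # zs) A"
proof (induction zs arbitrary: A)
  case (Cons y zs)
  have "aggs D ((y # zs) @ [z]) A = bind_pmf (agg D y A) (\<lambda>B. aggs D (z # zs) B)"
    using Cons set_agg(2) by (simp del: aggs.simps(2) add: aggs.simps(2)[of D y] cong: bind_pmf_cong)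
  also have "\<dots> = bind_pmf (bind_pmf (agg D y A) (agg D z)) (aggs D zs)"
    by (simp add: bind_assoc_pmf)
  also have "\<dots> = bind_pmf (bind_pmf (agg D z A) (agg D y)) (aggs D zs)"
    using agg_commute[of A y z D] Cons.prems by simp
  finally show ?case by (simp add: bind_assoc_pmf aggs_Cons_fun)
qed (simp add: bind_return_pmf aggs_singleton bind_return_pmf')

lemma aggs_permute:
  "\<lbrakk>mset xs = mset ys; bounded_above A; set xs \<subseteq> cyl\<rbrakk> \<Longrightarrow> aggs D xs A = aggs D ys A"
proof (induction xs arbitrary: ys A)
  case (Cons x xs)
  then have "x \<in> set ys" by (metis list.set_intros(1) mset_eq_setD)
  then obtain us vs where ys: "ys = us @ x # vs" by (meson split_list)
  have perm: "mset xs = mset (us @ vs)" using Cons.prems(1) ys by simp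
  have us: "set us \<subseteq> cyl" using mset_eq_setD[OF Cons.prems(1)] Cons.prems(3) ys by auto
  have "aggs D ys A = bind_pmf (aggs D (us @ [x]) A) (aggs D vs)"
    using aggs_append[of D "us @ [x]" vs A] ys by simp
  also have "\<dots> = bind_pmf (agg D x A) (aggs D (us @ vs))"
    using aggs_rotate1[of A x us D] us Cons.prems by (simp add: bind_assoc_pmf aggs_append_fun)
  also have "\<dots> = bind_pmf (agg D x A) (aggs D xs)"
    using Cons.IH[OF perm] Cons.prems set_agg(2)[of _ D x A] by (intro bind_pmf_cong) simp_all
  finally show ?case by simp
qed simp

text \<open>
  By the abelian property the particle at \<open>z\<close> may go first; it settles there unless \<open>z\<close> is occupied.
\<close>
lemma aggs_contains_start:
  assumes "z \<in> set zs" "z \<in> D" "bounded_above A" "set zs \<subseteq> cyl" "B \<in> set_pmf (aggs D zs A)"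
  shows "z \<in> B"
proof -
  have "mset zs = mset (z # remove1 z zs)" using assms(1) by simp
  from aggs_permute[OF this assms(3,4)] assms(5)
  obtain A' where A': "A' \<in> set_pmf (agg D z A)" "B \<in> set_pmf (aggs D (remove1 z zs) A')" by auto
  have "z \<in> A'"
  proof (cases "z \<in> A")
    case True then show ?thesis using set_agg(1)[OF A'(1)] by blast
  next
    case False then show ?thesis using A'(1) assms by (auto simp: agg_def settle_def exit_outside)
  qed
  then show ?thesis using set_aggs[OF A'(2)] by blast
qed

definition up_closed :: "'b set set \<Rightarrow> bool" where
  "up_closed S \<longleftrightarrow> (\<forall>A\<in>S. \<forall>B. A \<subseteq> B \<longrightarrow> B \<in> S)"

lemma prob_aggs_mono:
  assumes S: "up_closed S" and sub: "mset xs \<subseteq># mset ys" and A: "bounded_above A" and ys: "set ys \<subseteq> cyl"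
  shows "pr (aggs D xs A) S \<le> pr (aggs D ys A) S"
proof -
  obtain zs where zs: "mset zs = mset ys - mset xs" using ex_mset by blast
  then have "mset ys = mset (xs @ zs)" using sub by simp
  then have "aggs D ys A = bind_pmf (aggs D xs A) (aggs D zs)"
    using aggs_permute[of ys "xs @ zs" A D] A ys by (simp add: aggs_append)
  moreover have "set_pmf (aggs D zs B) \<subseteq> S" if "B \<in> S" for B
    using set_aggs S that unfolding up_closed_def by blast
  ultimately show ?thesis using prob_le_bind_pmf[of "aggs D xs A" S "aggs D zs" S] by simp
qed

definition unif :: "int \<Rightarrow> ('a \<times> int) pmf" where
  "unif y = map_pmf (\<lambda>x. (x, y)) (pmf_of_set V)"

lemma set_unif [simp]: "set_pmf (unif y) = V \<times> {y}"
  by (auto simp: unif_def finite_verts verts_nonempty)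

primrec growth :: "('a \<times> int) set \<Rightarrow> int \<Rightarrow> nat \<Rightarrow> ('a \<times> int) set \<Rightarrow> ('a \<times> int) set pmf" where
  "growth D y 0 A = return_pmf A"
| "growth D y (Suc n) A = bind_pmf (growth D y n A) (\<lambda>B. bind_pmf (unif y) (\<lambda>z. agg D z B))"

abbreviation "idla_pmf D n \<equiv> growth D 0 n (below G 0)"

lemma set_growth:
  assumes "B \<in> set_pmf (growth D y n A)"
  shows "A \<subseteq> B \<and> (bounded_above A \<longrightarrow> bounded_above B)"
  using assms
proof (induction n arbitrary: B)
  case (Suc n)
  then obtain B' z where "B' \<in> set_pmf (growth D y n A)" "B \<in> set_pmf (agg D z B')" by auto
  then show ?case using Suc.IH[of B'] set_agg[of B D z B'] by auto
qed simp

lemma unif_after_aggs: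
  assumes "bounded_above A" "set zs \<subseteq> cyl"
  shows "bind_pmf (aggs D zs A) (\<lambda>B. bind_pmf (unif y) (\<lambda>z. agg D z B))
    = bind_pmf (unif y) (\<lambda>z. aggs D (z # zs) A)"
proof -
  have "bind_pmf (aggs D zs A) (\<lambda>B. bind_pmf (unif y) (\<lambda>z. agg D z B))
      = bind_pmf (unif y) (\<lambda>z. bind_pmf (aggs D zs A) (agg D z))"
    by (rule bind_commute_pmf)
  also have "\<dots> = bind_pmf (unif y) (\<lambda>z. aggs D (zs @ [z]) A)"
    by (simp add: aggs_append aggs_singleton)
  also have "\<dots> = bind_pmf (unif y) (\<lambda>z. aggs D (z # zs) A)"
    using assms by (intro bind_pmf_cong refl aggs_rotate1) (auto simp: cylinder_def)
  finally show ?thesis .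
qed

lemma growth_eq_replicate:
  assumes "bounded_above A"
  shows "growth D y n A = bind_pmf (replicate_pmf n (unif y)) (\<lambda>zs. aggs D zs A)"
proof (induction n)
  case (Suc n)
  have "growth D y (Suc n) A = bind_pmf (replicate_pmf n (unif y))
      (\<lambda>zs. bind_pmf (aggs D zs A) (\<lambda>B. bind_pmf (unif y) (\<lambda>z. agg D z B)))"
    using Suc by (simp add: bind_assoc_pmf)
  also have "\<dots> = bind_pmf (replicate_pmf n (unif y)) (\<lambda>zs. bind_pmf (unif y) (\<lambda>z. aggs D (z # zs) A))"
    using assms by (intro bind_pmf_cong refl unif_after_aggs) (auto simp: set_replicate_pmf cylinder_def)
  also have "\<dots> = bind_pmf (unif y) (\<lambda>z. bind_pmf (replicate_pmf n (unif y)) (\<lambda>zs. aggs D (z # zs) A))"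
    by (rule bind_commute_pmf)
  finally show ?case by (simp add: bind_assoc_pmf bind_return_pmf)
qed (simp add: bind_return_pmf)

definition cluster :: "('a \<times> int) set \<Rightarrow> ('a \<times> int) list \<Rightarrow> ('a \<times> int) set" where
  "cluster D X = below G 0 \<union> (set X \<inter> D)"

text \<open>
  The list of exit sites of the walks started at level \<open>0\<close>, latest first. Exit sites in \<open>D\<close> have been
  added to the cluster; the others record where the remaining walks are paused.
\<close>
primrec stage :: "('a \<times> int) set \<Rightarrow> nat \<Rightarrow> ('a \<times> int) list pmf" where
  "stage D 0 = return_pmf []"
| "stage D (Suc n) = bind_pmf (stage D n)
     (\<lambda>X. bind_pmf (unif 0) (\<lambda>z. map_pmf (\<lambda>c. c # X) (exit (cluster D X) z)))"

lemma bounded_above_below [simp]: "bounded_above (below G k)"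
  unfolding bounded_above_def below_def by (auto intro!: exI[of _ "\<lfloor>k\<rfloor>"] simp: le_floor_iff)

lemma bounded_above_Un_finite: "finite F \<Longrightarrow> bounded_above A \<Longrightarrow> bounded_above (A \<union> F)"
  by (induction F rule: finite_induct) auto

lemma bounded_above_cluster [simp]: "bounded_above (cluster D X)"
  by (simp add: cluster_def bounded_above_Un_finite)

lemma unif_in_cyl: "z \<in> set_pmf (unif y) \<Longrightarrow> z \<in> cyl"
  by (auto simp: cylinder_def)

lemma set_stage:
  assumes "X \<in> set_pmf (stage D n)"
  shows "length X = n \<and> set X \<subseteq> cyl - below G 0 \<and> distinct (filter (\<lambda>c. c \<in> D) X)"
  using assms
proof (induction n arbitrary: X)
  case (Suc n)
  then obtain Y z c where Y: "Y \<in> set_pmf (stage D n)" and z: "z \<in> set_pmf (unif 0)"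
    and c: "c \<in> set_pmf (exit (cluster D Y) z)" and X: "X = c # Y" by auto
  have "c \<in> cyl - cluster D Y"
    using set_exit[OF bounded_above_cluster unif_in_cyl[OF z]] c by blast
  then show ?case using Suc.IH[OF Y] X by (auto simp: cluster_def)
qed simp

abbreviation "lower k \<equiv> {c :: 'a \<times> int. snd c < k}"

abbreviation "full k \<equiv> below G (real_of_int (k - 1))"

lemma stage_level:
  assumes "X \<in> set_pmf (stage (lower k) n)" "k \<ge> 1" "c \<in> set X"
  shows "1 \<le> snd c \<and> snd c \<le> k"
  using assms
proof (induction n arbitrary: X c)
  case (Suc n)
  then obtain Y z c' where Y: "Y \<in> set_pmf (stage (lower k) n)" and z: "z \<in> set_pmf (unif 0)"
    and c': "c' \<in> set_pmf (exit (cluster (lower k) Y) z)" and X: "X = c' # Y" by auto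
  have "snd c' \<le> (k - 1) + 1"
  proof (rule exit_level[OF _ unif_in_cyl[OF z] _ c'])
    show "y \<le> k - 1" if "(x, y) \<in> cluster (lower k) Y" for x y
      using that \<open>k \<ge> 1\<close> by (auto simp: cluster_def below_def)
    show "snd z \<le> k - 1 + 1" using z \<open>k \<ge> 1\<close> by auto
  qed
  moreover have "1 \<le> snd c'"
  proof -
    have "c' \<in> cyl - below G 0" using set_stage[OF Suc.prems(1)] X by auto
    then show ?thesis by (cases c') (auto simp: below_def)
  qed
  ultimately show ?case using Suc.IH[OF Y Suc.prems(2), of c] Suc.prems(3) X by (cases "c = c'") simp_all
qed simp

text \<open>
  The growth process can be run in two stages: first all the walks until they exit into \<open>D\<close> or are
  paused, then the paused walks. Each new walk that is paused is moved behind the walks that come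
  later, which is allowed by the abelian property.
\<close>
lemma growth_eq_stage:
  assumes D: "D \<subseteq> D'"
  shows "idla_pmf D' n
    = bind_pmf (stage D n) (\<lambda>X. aggs D' (filter (\<lambda>c. c \<notin> D) X) (cluster D X))"
proof (induction n)
  case 0
  show ?case by (simp add: bind_return_pmf cluster_def)
next
  case (Suc n)
  let ?paused = "filter (\<lambda>c. c \<notin> D)"
  have one_step: "agg D' z (cluster D X) \<bind> aggs D' (?paused X)
      = exit (cluster D X) z \<bind> (\<lambda>c. aggs D' (?paused (c # X)) (cluster D (c # X)))"
    if X: "X \<in> set_pmf (stage D n)" and z: "z \<in> set_pmf (unif 0)" for X z
    unfolding agg_def bind_map_pmf
  proof (rule bind_pmf_cong[OF refl])
    fix c assume "c \<in> set_pmf (exit (cluster D X) z)"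
    then have c: "c \<in> cyl" "c \<notin> cluster D X"
      using set_exit[OF bounded_above_cluster unif_in_cyl[OF z]] by blast+
    show "aggs D' (?paused X) (settle D' c (cluster D X)) = aggs D' (?paused (c # X)) (cluster D (c # X))"
    proof (cases "c \<in> D")
      case True
      moreover have "insert c (cluster D X) = cluster D (c # X)" using True by (auto simp: cluster_def)
      ultimately show ?thesis using D by (auto simp: settle_def)
    next
      case False
      moreover have "cluster D (c # X) = cluster D X" using False by (auto simp: cluster_def)
      ultimately show ?thesis using c by (simp add: agg_def exit_outside bind_return_pmf)
    qed
  qed
  have "idla_pmf D' (Suc n) = stage D n \<bind> (\<lambda>X. aggs D' (?paused X) (cluster D X)
      \<bind> (\<lambda>B. unif 0 \<bind> (\<lambda>z. agg D' z B)))"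
    using Suc by (simp add: bind_assoc_pmf)
  also have "\<dots> = stage D n \<bind> (\<lambda>X. unif 0 \<bind> (\<lambda>z. aggs D' (z # ?paused X) (cluster D X)))"
    using set_stage by (intro bind_pmf_cong refl unif_after_aggs bounded_above_cluster) fastforce
  also have "\<dots> = stage D n \<bind> (\<lambda>X. unif 0 \<bind> (\<lambda>z. exit (cluster D X) z
      \<bind> (\<lambda>c. aggs D' (?paused (c # X)) (cluster D (c # X)))))"
    unfolding aggs.simps(2) by (intro bind_pmf_cong refl one_step)
  also have "\<dots> = stage D (Suc n) \<bind> (\<lambda>X. aggs D' (?paused X) (cluster D X))"
    by (simp add: bind_assoc_pmf bind_map_pmf)
  finally show ?case .
qed

text \<open>
  A walk that is paused at \<open>z\<close> occupies \<open>z\<close> when it is released, so it suffices to know whether some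
  walk is paused there.
\<close>
lemma prob_unvisited_le:
  assumes "D \<subseteq> D'" "z \<in> D'" "z \<notin> D"
  shows "pr (idla_pmf D' n) {A. z \<notin> A} \<le> pr (stage D n) {X. z \<notin> set X}"
proof -
  have "pr (stage D n) {X. z \<in> set X} \<le> pr (idla_pmf D' n) {A. z \<in> A}"
    unfolding growth_eq_stage[OF assms(1)]
  proof (rule prob_le_bind_pmf, intro subsetI CollectI)
    fix X B assume X: "X \<in> set_pmf (stage D n)" "X \<in> {X. z \<in> set X}"
      and B: "B \<in> set_pmf (aggs D' (filter (\<lambda>c. c \<notin> D) X) (cluster D X))"
    show "z \<in> B"
      by (rule aggs_contains_start[OF _ _ bounded_above_cluster _ B])
         (use X set_stage[OF X(1)] assms in auto)
  qed
  moreover have compl: "pr p {x. Q x} = 1 - pr p {x. \<not> Q x}" for p :: "'b pmf" and Q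
    using measure_pmf.prob_compl[of "{x. \<not> Q x}" p] by (simp add: Compl_eq_Diff_UNIV[symmetric] Collect_neg_eq[symmetric])
  ultimately show ?thesis 
    using compl[of "idla_pmf D' n" "\<lambda>A. z \<notin> A"] compl[of "stage D n" "\<lambda>X. z \<notin> set X"]
    by simp
qed

end

section \<open>Hitting probabilities and the exponential supermartingale\<close>

lemma exp_le_quadratic: "x \<le> 1 \<Longrightarrow> exp x \<le> 1 + x + x\<^sup>2" for x :: real
proof (cases "0 \<le> x")
  case False
  have "exp x = 1 / exp (- x)" by (simp add: exp_minus divide_inverse)
  also have "\<dots> \<le> 1 / (1 - x)" using exp_ge_add_one_self[of "- x"] False by (intro divide_left_mono) auto
  also have "\<dots> \<le> 1 + x + x\<^sup>2"
  proof -
    have "x ^ 3 \<le> 0" using False by (simp add: power3_eq_cube mult_nonneg_nonpos mult_nonpos_nonpos)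
    then have "1 \<le> (1 + x + x\<^sup>2) * (1 - x)" by (simp add: algebra_simps power2_eq_square power3_eq_cube)
    then show ?thesis using False by (simp add: divide_le_eq)
  qed
  finally show ?thesis .
qed (use exp_bound in auto)

text \<open>
  A pointwise bound that replaces the usual variance estimate. For a variable with mean zero and
  absolute value at most \<open>1\<close> the second moment is at most twice the mean of the positive part, so
  the positive part itself may serve as compensator. Its advantage is that it vanishes at the many
  small negative values \<open>-1/N\<close>.
\<close>
lemma exp_compensated_le_linear:
  fixes u l :: real
  assumes u: "\<bar>u\<bar> \<le> 1" and l: "\<bar>l\<bar> \<le> 1/16"
  shows "exp (l * u - 4 * l\<^sup>2 * max u 0) \<le> 1 + (l - 25/16 * l\<^sup>2) * u"
proof -
  define x where "x = l * u - 4 * l\<^sup>2 * max u 0"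
  have l2: "l\<^sup>2 \<le> \<bar>l\<bar> / 16"
    using mult_right_mono[OF l, of "\<bar>l\<bar>"] by (simp add: power2_eq_square)
  have "\<bar>x\<bar> \<le> \<bar>l * u\<bar> + 4 * l\<^sup>2 * \<bar>u\<bar>"
    unfolding x_def by (rule order_trans[OF abs_triangle_ineq4]) (auto simp: abs_mult intro!: mult_left_mono)
  also have "\<dots> \<le> \<bar>l\<bar> * \<bar>u\<bar> + \<bar>l\<bar> / 4 * \<bar>u\<bar>"
    using l2 by (intro add_mono mult_right_mono) (auto simp: abs_mult)
  finally have x: "\<bar>x\<bar> \<le> 5/4 * (\<bar>l\<bar> * \<bar>u\<bar>)" by simp
  have "\<bar>l\<bar> * \<bar>u\<bar> \<le> 1/16 * 1" using u l by (intro mult_mono) auto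
  with x have "x \<le> 1" by simp
  have "x\<^sup>2 \<le> (5/4 * (\<bar>l\<bar> * \<bar>u\<bar>))\<^sup>2" using x by (metis abs_ge_zero power2_abs power_mono)
  also have "\<dots> = 25/16 * (l\<^sup>2 * u\<^sup>2)" by (simp add: power2_eq_square)
  also have "\<dots> \<le> 25/16 * (l\<^sup>2 * (2 * max u 0 - u))"
  proof -
    have "u\<^sup>2 \<le> \<bar>u\<bar>"
      using mult_right_mono[OF u, of "\<bar>u\<bar>"] by (simp add: power2_eq_square)
    also have "\<bar>u\<bar> = 2 * max u 0 - u" by auto
    finally show ?thesis by (intro mult_left_mono) auto
  qed
  finally have "x\<^sup>2 \<le> 25/16 * (l\<^sup>2 * (2 * max u 0 - u))" .
  also have "25/16 * (l\<^sup>2 * (2 * max u 0 - u)) = 25/8 * (l\<^sup>2 * max u 0) - 25/16 * (l\<^sup>2 * u)"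
    by (simp add: right_diff_distrib)
  finally have "x\<^sup>2 \<le> 25/8 * (l\<^sup>2 * max u 0) - 25/16 * (l\<^sup>2 * u)" .
  moreover have "0 \<le> l\<^sup>2 * max u 0" by simp
  ultimately have "x\<^sup>2 \<le> 4 * (l\<^sup>2 * max u 0) - 25/16 * (l\<^sup>2 * u)" by linarith
  moreover have "x = l * u - 4 * (l\<^sup>2 * max u 0)" by (simp add: x_def)
  moreover have "(l - 25/16 * l\<^sup>2) * u = l * u - 25/16 * (l\<^sup>2 * u)" by (simp add: left_diff_distrib)
  ultimately have "1 + x + x\<^sup>2 \<le> 1 + (l - 25/16 * l\<^sup>2) * u" by linarith
  then show ?thesis using exp_le_quadratic[OF \<open>x \<le> 1\<close>] unfolding x_def by linarith
qed

lemma nn_integral_exp_compensated: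
  fixes u :: "'b \<Rightarrow> real"
  assumes u: "\<And>x. \<bar>u x\<bar> \<le> 1" and l: "\<bar>l\<bar> \<le> 1/16" and mean: "measure_pmf.expectation p u = 0"
  shows "(\<integral>\<^sup>+ x. ennreal (exp (l * u x - 4 * l\<^sup>2 * max (u x) 0)) \<partial>p) \<le> 1"
proof -
  let ?a = "l - 25/16 * l\<^sup>2"
  have int: "integrable p u"
    using u by (intro measure_pmf.integrable_const_bound[where B = 1]) auto
  have "(\<integral>\<^sup>+ x. ennreal (exp (l * u x - 4 * l\<^sup>2 * max (u x) 0)) \<partial>p) \<le> (\<integral>\<^sup>+ x. ennreal (1 + ?a * u x) \<partial>p)"
    using exp_compensated_le_linear[OF u l] by (intro nn_integral_mono ennreal_leI) auto
  also have "\<dots> = ennreal (measure_pmf.expectation p (\<lambda>x. 1 + ?a * u x))"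
  proof (intro nn_integral_eq_integral AE_I2)
    show "0 \<le> 1 + ?a * u x" for x
      using exp_compensated_le_linear[OF u l, of x] by (metis exp_ge_zero order_trans)
  qed (use int in simp)
  also have "measure_pmf.expectation p (\<lambda>x. 1 + ?a * u x) = 1" using int mean by simp
  finally show ?thesis by simp
qed

lemma incseq_bounded_LIMSEQ_lim:
  fixes X :: "nat \<Rightarrow> real"
  assumes "\<And>i. X i \<le> X (Suc i)" "\<And>i. X i \<le> B"
  shows "X \<longlonglongrightarrow> lim X"
proof -
  have "bdd_above (range X)" using assms(2) by (intro bdd_aboveI[where M = B]) blast
  then have "convergent X" using LIMSEQ_incseq_SUP[OF _ incseq_SucI[of X]] assms(1) convergentI by blast
  then show ?thesis by (simp add: convergent_LIMSEQ_iff)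
qed

context regular_cylinder
begin

abbreviation "pw \<equiv> lazy_srw_power G"
abbreviation "N \<equiv> card V"

lemma N_pos: "0 < real N"
  using finite_verts verts_nonempty by (simp add: card_gt_0_iff)

lemma pw_nonneg [simp]: "0 \<le> pw n x z"
  by (induction n arbitrary: x) (auto intro: sum_nonneg)

lemma sum_P_column: "x' \<in> V \<Longrightarrow> (\<Sum>x\<in>V. P x x') = 1"
  using lazy_srw_stochastic[of x'] lazy_srw_sym[of x'] by simp

lemma sum_pw_column: "z \<in> V \<Longrightarrow> (\<Sum>x\<in>V. pw n x z) = 1"
proof (induction n)
  case (Suc n)
  have "(\<Sum>x\<in>V. pw (Suc n) x z) = (\<Sum>y\<in>V. \<Sum>x\<in>V. P x y * pw n y z)"
    by (simp, rule sum.swap)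
  then show ?case using Suc by (simp add: sum_distrib_right[symmetric] sum_P_column)
qed (simp add: finite_verts)

lemma deviation_from_mean:
  fixes f :: "'a \<Rightarrow> real"
  assumes mean: "(\<Sum>x\<in>V. f x) = 1" and x: "x \<in> V" and f: "\<And>x'. x' \<in> V \<Longrightarrow> \<bar>f x - f x'\<bar> \<le> r"
  shows "\<bar>f x - 1 / N\<bar> \<le> r"
proof -
  have "N * (f x - 1 / N) = (\<Sum>x'\<in>V. f x - f x')"
    using N_pos mean by (simp add: sum_subtractf right_diff_distrib)
  also have "\<bar>\<dots>\<bar> \<le> (\<Sum>x'\<in>V. r)" using f by (intro order_trans[OF sum_abs] sum_mono)
  finally have "N * \<bar>f x - 1 / N\<bar> \<le> N * r" by (simp add: abs_mult)
  then show ?thesis using N_pos by (simp only: mult_le_cancel_left_pos)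
qed

text \<open>
  For \<open>n = 0\<close> this is the probability that a walk starting at \<open>x\<close>, on a level that is \<open>j\<close> below the
  target level, reaches the target level within \<open>i\<close> steps and does so at \<open>z\<close>. For general \<open>n\<close> the
  starting point is first moved by \<open>n\<close> steps of the lazy walk on the base graph. The parameter \<open>n\<close>
  turns the horizontal step into the shift \<open>n \<mapsto> n + 1\<close> and so allows decay in \<open>n\<close> to be carried
  through an induction on \<open>i\<close>.
\<close>
primrec hit :: "nat \<Rightarrow> 'a \<Rightarrow> nat \<Rightarrow> nat \<Rightarrow> 'a \<Rightarrow> real" where
  "hit 0 z j n x = (if j = 0 then pw n x z else 0)"
| "hit (Suc i) z j n x = (case j of 0 \<Rightarrow> pw n x z
     | Suc j' \<Rightarrow> hit i z j' n x / 4 + hit i z (Suc (Suc j')) n x / 4 + hit i z (Suc j') (Suc n) x / 2)"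

lemma hit_step: "hit (Suc i) z (Suc j) n x
    = hit i z j n x / 4 + hit i z (Suc (Suc j)) n x / 4 + hit i z (Suc j) (Suc n) x / 2"
  by simp

lemma hit_nonneg [simp]: "0 \<le> hit i z j n x"
  by (induction i arbitrary: j n) (auto split: nat.split)

lemma hit_increasing: "hit i z j n x \<le> hit (Suc i) z j n x"
proof (induction i arbitrary: j n)
  case 0
  show ?case by (auto split: nat.split)
next
  case (Suc i)
  show ?case
  proof (cases j)
    case (Suc j')
    show ?thesis unfolding Suc
      using Suc.IH[of j' n] Suc.IH[of "Suc j'" "Suc n"] Suc.IH[of "Suc (Suc j')" n]
        hit_step[of i z j' n x] hit_step[of "Suc i" z j' n x] by linarith
  qed simp
qed

lemma hit_le_1: "z \<in> V \<Longrightarrow> x \<in> V \<Longrightarrow> hit i z j n x \<le> 1"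
proof (induction i arbitrary: j n)
  case 0
  then show ?case
    using member_le_sum[of x V "\<lambda>x. pw n x z"] sum_pw_column[of z n] finite_verts by simp
next
  case (Suc i)
  show ?case
  proof (cases j)
    case 0
    then show ?thesis using Suc.IH[of 0 n] Suc.prems by (cases i) auto
  next
    case (Suc j')
    then show ?thesis using Suc.IH[of j' n] Suc.IH[of "Suc j'" "Suc n"] Suc.IH[of "Suc (Suc j')" n] Suc.prems
      by simp
  qed
qed

lemma hit_average: "(\<Sum>x'\<in>V. P x x' * hit i z j n x') = hit i z j (Suc n) x"
proof (induction i arbitrary: j n)
  case (Suc i)
  show ?case
  proof (cases j)
    case (Suc j')
    have "(\<Sum>x'\<in>V. P x x' * hit (Suc i) z j n x') = (\<Sum>x'\<in>V. P x x' * hit i z j' n x') / 4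
        + (\<Sum>x'\<in>V. P x x' * hit i z (Suc (Suc j')) n x') / 4
        + (\<Sum>x'\<in>V. P x x' * hit i z (Suc j') (Suc n) x') / 2"
      by (simp add: Suc sum.distrib sum_divide_distrib algebra_simps)
    then show ?thesis by (simp add: Suc Suc.IH)
  qed simp
qed simp

text \<open>
  If the dependence on the starting point decays like \<open>s\<^sup>n\<close> under horizontal steps, then \<open>q\<^sup>j\<close> is a
  supersolution of the recursion as soon as \<open>1/4 + q\<^sup>2/4 + s q/2 \<le> q\<close>. A contraction per time step
  becomes a contraction per level in this way.
\<close>
lemma hit_spread:
  assumes pw: "\<And>n. \<bar>pw n x z - pw n x' z\<bar> \<le> c * s ^ n"
    and s: "0 \<le> s" and q: "0 \<le> q" and c: "0 \<le> c" and sub: "1/4 + q\<^sup>2 / 4 + s * q / 2 \<le> q"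
  shows "\<bar>hit i z j n x - hit i z j n x'\<bar> \<le> c * s ^ n * q ^ j"
proof (induction i arbitrary: j n)
  case 0
  show ?case using pw[of n] s q c by simp
next
  case (Suc i)
  show ?case
  proof (cases j)
    case 0
    then show ?thesis using pw[of n] by simp
  next
    case (Suc j')
    let ?e = "\<lambda>j n. hit i z j n x - hit i z j n x'"
    have weighted: "\<bar>a / 4 + b / 4 + d / 2\<bar> \<le> a' / 4 + b' / 4 + d' / 2"
      if "\<bar>a\<bar> \<le> a'" "\<bar>b\<bar> \<le> b'" "\<bar>d\<bar> \<le> d'" for a b d a' b' d' :: real
      using that by linarith
    have "hit (Suc i) z j n x - hit (Suc i) z j n x'
        = ?e j' n / 4 + ?e (Suc (Suc j')) n / 4 + ?e (Suc j') (Suc n) / 2"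
      by (simp add: Suc diff_divide_distrib)
    also have "\<bar>\<dots>\<bar> \<le> c * s ^ n * q ^ j' / 4 + c * s ^ n * q ^ Suc (Suc j') / 4
        + c * s ^ Suc n * q ^ Suc j' / 2"
      by (rule weighted[OF Suc.IH[of j' n] Suc.IH[of "Suc (Suc j')" n] Suc.IH[of "Suc j'" "Suc n"]])
    also have "\<dots> = c * s ^ n * q ^ j' * (1/4 + q\<^sup>2 / 4 + s * q / 2)"
      by (simp add: algebra_simps power2_eq_square)
    also have "\<dots> \<le> c * s ^ n * q ^ j' * q"
      using sub s q c by (intro mult_left_mono) auto
    also have "\<dots> = c * s ^ n * q ^ j" by (simp add: Suc)
    finally show ?thesis .
  qed
qed

definition hitting :: "'a \<Rightarrow> nat \<Rightarrow> 'a \<Rightarrow> real" where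
  "hitting z j x = lim (\<lambda>i. hit i z j 0 x)"

lemma hit_LIMSEQ:
  "\<lbrakk>z \<in> V; x \<in> V\<rbrakk> \<Longrightarrow> (\<lambda>i. hit i z j 0 x) \<longlonglongrightarrow> hitting z j x"
  unfolding hitting_def
  by (rule incseq_bounded_LIMSEQ_lim[of "\<lambda>i. hit i z j 0 x" 1]) (rule hit_increasing hit_le_1)+

context
  fixes z assumes z: "z \<in> V"
begin

lemma hitting_bounds: "x \<in> V \<Longrightarrow> 0 \<le> hitting z j x \<and> hitting z j x \<le> 1"
  using LIMSEQ_le_const[OF hit_LIMSEQ[OF z], of x 0 j] LIMSEQ_le_const2[OF hit_LIMSEQ[OF z], of x j 1]
    hit_le_1[OF z] by auto

lemma hitting_0: "x \<in> V \<Longrightarrow> hitting z 0 x = (if x = z then 1 else 0)"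
proof -
  assume x: "x \<in> V"
  have "hit i z 0 0 x = (if x = z then 1 else 0)" for i by (cases i) auto
  then have "(\<lambda>i. hit i z 0 0 x) \<longlonglongrightarrow> (if x = z then 1 else 0)" by simp
  then show ?thesis using LIMSEQ_unique[OF hit_LIMSEQ[OF z x]] by blast
qed

lemma hitting_harmonic:
  assumes x: "x \<in> V"
  shows "hitting z (Suc j) x = hitting z j x / 4 + hitting z (Suc (Suc j)) x / 4
    + (\<Sum>x'\<in>V. P x x' * hitting z (Suc j) x') / 2"
proof (rule LIMSEQ_unique[OF LIMSEQ_Suc[OF hit_LIMSEQ[OF z x]]])
  have "(\<lambda>i. hit i z j 0 x / 4 + hit i z (Suc (Suc j)) 0 x / 4
      + (\<Sum>x'\<in>V. P x x' * hit i z (Suc j) 0 x') / 2) \<longlonglongrightarrow> hitting z j x / 4 + hitting z (Suc (Suc j)) x / 4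
    + (\<Sum>x'\<in>V. P x x' * hitting z (Suc j) x') / 2"
    by (intro tendsto_intros hit_LIMSEQ z x) auto
  then show "(\<lambda>i. hit (Suc i) z (Suc j) 0 x) \<longlonglongrightarrow> hitting z j x / 4 + hitting z (Suc (Suc j)) x / 4
    + (\<Sum>x'\<in>V. P x x' * hitting z (Suc j) x') / 2"
    by (simp add: hit_average)
qed

text \<open>
  As a function of the depth the sum is bounded and harmonic, hence constant.
\<close>
lemma sum_hitting: "(\<Sum>x\<in>V. hitting z j x) = 1"
proof -
  define S where "S j = (\<Sum>x\<in>V. hitting z j x)" for j
  have average: "(\<Sum>x\<in>V. \<Sum>x'\<in>V. P x x' * hitting z j x') = S j" for j
    unfolding S_def by (subst sum.swap) (simp add: sum_distrib_right[symmetric] sum_P_column)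
  have "S (Suc j) = S j / 4 + S (Suc (Suc j)) / 4 + (\<Sum>x\<in>V. \<Sum>x'\<in>V. P x x' * hitting z (Suc j) x') / 2" for j
    unfolding S_def using hitting_harmonic[of _ j] by (simp add: sum.distrib sum_divide_distrib[symmetric])
  then have rec: "2 * S (Suc j) = S j + S (Suc (Suc j))" for j
    unfolding average by (simp add: field_simps)
  have S: "0 \<le> S j" "S j \<le> N" for j
    using hitting_bounds sum_mono[of V "hitting z j" "\<lambda>_. 1"] unfolding S_def by (auto intro: sum_nonneg)
  have "S 0 = 1" using z finite_verts by (simp add: S_def hitting_0)
  moreover have "S j \<le> S 0" using rec S by (intro bounded_convex_le_start[where B = N]) simp_all
  moreover have "- S j \<le> - S 0"
    using rec S by (intro bounded_convex_le_start[where B = 0]) (simp_all add: algebra_simps)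
  ultimately show ?thesis by (simp add: S_def)
qed

lemma hitting_near_uniform:
  assumes x: "x \<in> V" and pw: "\<And>n x'. x' \<in> V \<Longrightarrow> \<bar>pw n x z - pw n x' z\<bar> \<le> c * s ^ n"
    and s: "0 \<le> s" and q: "0 \<le> q" and c: "0 \<le> c" and sub: "1/4 + q\<^sup>2 / 4 + s * q / 2 \<le> q"
  shows "\<bar>hitting z j x - 1 / N\<bar> \<le> c * q ^ j"
proof (rule deviation_from_mean[OF sum_hitting x])
  fix x' assume x': "x' \<in> V"
  show "\<bar>hitting z j x - hitting z j x'\<bar> \<le> c * q ^ j"
  proof (rule LIMSEQ_le_const2)
    show "(\<lambda>i. \<bar>hit i z j 0 x - hit i z j 0 x'\<bar>) \<longlonglongrightarrow> \<bar>hitting z j x - hitting z j x'\<bar>"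
      by (intro tendsto_intros hit_LIMSEQ z x x')
    show "\<exists>i0. \<forall>i\<ge>i0. \<bar>hit i z j 0 x - hit i z j 0 x'\<bar> \<le> c * q ^ j"
      using hit_spread[OF pw[OF x'] s q c sub, of _ j 0] by simp
  qed
qed

definition potential :: "int \<Rightarrow> 'a \<times> int \<Rightarrow> real" where
  "potential k = (\<lambda>(x, y). if x \<in> V \<and> y \<le> k then hitting z (nat (k - y)) x else 0)"

lemma potential_bounds: "0 \<le> potential k c \<and> potential k c \<le> 1"
  using hitting_bounds by (cases c) (auto simp: potential_def)

text \<open>
  On level \<open>k\<close> itself the potential is the boundary value, so harmonicity is restricted to lower
  levels.
\<close>
lemma potential_harmonic:
  assumes "snd c < k" "c \<in> cyl"
  shows "mean_step (potential k) c = potential k c"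
proof (cases c)
  case (Pair x y)
  with assms have x: "x \<in> V" and y: "y < k" by auto
  define j where "j = nat (k - y) - 1"
  have "nat (k - y) = Suc j" "nat (k - (y + 1)) = j" "nat (k - (y - 1)) = Suc (Suc j)"
    using y unfolding j_def by linarith+
  then show ?thesis using x y hitting_harmonic[OF x, of j] by (simp add: Pair mean_step_def potential_def)
qed

lemma sum_potential_level: "y \<le> k \<Longrightarrow> (\<Sum>x\<in>V. potential k (x, y)) = 1"
  using sum_hitting by (simp add: potential_def)

text \<open>
  A uniform starting level sees the same average of the potential at the start and at the exit.
\<close>
lemma expectation_potential:
  assumes A: "A \<subseteq> lower k" and y: "y \<le> k"
  shows "measure_pmf.expectation (bind_pmf (unif y) (exit A)) (potential k) = 1 / N"
proof -
  have bdd: "bounded_above A" using A unfolding bounded_above_def by (intro exI[of _ k]) fastforce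
  have "ennreal (measure_pmf.expectation (bind_pmf (unif y) (exit A)) (potential k))
      = (\<integral>\<^sup>+ c. ennreal (potential k c) \<partial>bind_pmf (unif y) (exit A))"
    using potential_bounds
    by (intro nn_integral_eq_integral[symmetric] measure_pmf.integrable_const_bound[where B = 1]) auto
  also have "\<dots> = (\<integral>\<^sup>+ w. (\<integral>\<^sup>+ c. ennreal (potential k c) \<partial>exit A w) \<partial>unif y)"
    by simp
  also have "\<dots> = (\<integral>\<^sup>+ w. ennreal (potential k w) \<partial>unif y)"
  proof (intro nn_integral_cong_AE AE_pmfI)
    fix w assume "w \<in> set_pmf (unif y)"
    then show "(\<integral>\<^sup>+ c. ennreal (potential k c) \<partial>exit A w) = ennreal (potential k w)"
      by (intro optional_stopping[OF bdd unif_in_cyl, where B = 1])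
         (use A potential_bounds potential_harmonic in auto)
  qed
  also have "\<dots> = ennreal (1 / N)"
  proof -
    have "(\<integral>\<^sup>+ w. ennreal (potential k w) \<partial>unif y) = (\<Sum>x\<in>V. ennreal (potential k (x, y))) / N"
      unfolding unif_def nn_integral_map_pmf by (subst nn_integral_pmf_of_set) (auto simp: finite_verts verts_nonempty)
    also have "(\<Sum>x\<in>V. ennreal (potential k (x, y))) = 1"
      using potential_bounds sum_potential_level[OF y] by (subst sum_ennreal) auto
    also have "1 / of_nat N = ennreal (1 / N)" using N_pos by (simp add: divide_ennreal[symmetric] ennreal_of_nat_eq_real_of_nat)
    finally show ?thesis .
  qed
  finally show ?thesis using potential_bounds by (subst (asm) ennreal_inj) (auto intro!: integral_nonneg_AE)
qed

definition gain :: "int \<Rightarrow> 'a \<times> int \<Rightarrow> real" where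
  "gain k c = potential k c - 1 / N"

definition total_excess :: "int \<Rightarrow> real" where
  "total_excess k = (\<Sum>y\<in>{1..k - 1}. \<Sum>x\<in>V. max (gain k (x, y)) 0)"

lemma gain_bounded: "\<bar>gain k c\<bar> \<le> 1"
proof -
  have "0 \<le> 1 / real N" "1 / real N \<le> 1" using N_pos by auto
  then show ?thesis using potential_bounds[of k c] unfolding gain_def by linarith
qed

definition log_weight :: "int \<Rightarrow> real \<Rightarrow> ('a \<times> int) list \<Rightarrow> real" where
  "log_weight k l X = l * (\<Sum>c\<leftarrow>X. gain k c) - 4 * l\<^sup>2 * (\<Sum>c\<leftarrow>X. max (gain k c) 0)"

text \<open>
  The increments \<^const>\<open>gain\<close> have conditional mean zero whatever the current cluster is, by
  \<open>expectation_potential\<close>.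
\<close>
lemma exp_supermartingale:
  assumes k: "k \<ge> 1" and l: "\<bar>l\<bar> \<le> 1/16"
  shows "(\<integral>\<^sup>+ X. ennreal (exp (log_weight k l X)) \<partial>stage (lower k) n) \<le> 1"
proof (induction n)
  case 0
  show ?case by (simp add: log_weight_def)
next
  case (Suc n)
  let ?D = "{c :: 'a \<times> int. snd c < k}"
  let ?w = "\<lambda>c. l * gain k c - 4 * l\<^sup>2 * max (gain k c) 0"
  have one: "(\<integral>\<^sup>+ z. \<integral>\<^sup>+ c. ennreal (exp (?w c)) \<partial>exit (cluster ?D X) z \<partial>unif 0) \<le> 1" for X
  proof -
    let ?p = "bind_pmf (unif 0) (exit (cluster ?D X))"
    have "cluster ?D X \<subseteq> ?D" using k by (auto simp: cluster_def below_def)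
    then have "measure_pmf.expectation ?p (potential k) = 1 / N"
      using k by (intro expectation_potential) auto
    moreover have "integrable ?p (potential k)"
      using potential_bounds by (intro measure_pmf.integrable_const_bound[where B = 1]) auto
    ultimately have "measure_pmf.expectation ?p (gain k) = 0"
      unfolding gain_def[abs_def] by simp
    from nn_integral_exp_compensated[OF gain_bounded l this] show ?thesis by simp
  qed
  have "(\<integral>\<^sup>+ X. ennreal (exp (log_weight k l X)) \<partial>stage ?D (Suc n))
      = (\<integral>\<^sup>+ X. \<integral>\<^sup>+ z. \<integral>\<^sup>+ c. ennreal (exp (log_weight k l X)) * ennreal (exp (?w c))
          \<partial>exit (cluster ?D X) z \<partial>unif 0 \<partial>stage ?D n)"
    by (simp add: log_weight_def ennreal_mult[symmetric] exp_add[symmetric] algebra_simps)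
  also have "\<dots> = (\<integral>\<^sup>+ X. ennreal (exp (log_weight k l X))
      * (\<integral>\<^sup>+ z. \<integral>\<^sup>+ c. ennreal (exp (?w c)) \<partial>exit (cluster ?D X) z \<partial>unif 0) \<partial>stage ?D n)"
    by (simp add: nn_integral_cmult)
  also have "\<dots> \<le> (\<integral>\<^sup>+ X. ennreal (exp (log_weight k l X)) * 1 \<partial>stage ?D n)"
    by (intro nn_integral_mono mult_left_mono one) auto
  finally show ?case using Suc by simp
qed

lemma prob_log_weight:
  assumes k: "k \<ge> 1" and l: "\<bar>l\<bar> \<le> 1/16"
    and b: "\<And>X. X \<in> set_pmf (stage (lower k) n) \<Longrightarrow> X \<in> E \<Longrightarrow> b \<le> log_weight k l X"
  shows "pr (stage (lower k) n) E \<le> exp (- b)"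
proof -
  let ?p = "stage (lower k) n"
  have "ennreal (exp b) * emeasure ?p E = (\<integral>\<^sup>+ X. ennreal (exp b) * indicator E X \<partial>?p)"
    by (simp add: nn_integral_cmult_indicator)
  also have "\<dots> \<le> (\<integral>\<^sup>+ X. ennreal (exp (log_weight k l X)) \<partial>?p)"
    using b by (intro nn_integral_mono_AE AE_pmfI) (auto simp: indicator_def intro!: ennreal_leI)
  also have "\<dots> \<le> 1" by (rule exp_supermartingale[OF k l])
  finally have "ennreal (exp b * pr ?p E) \<le> ennreal 1"
    by (simp add: measure_pmf.emeasure_eq_measure ennreal_mult)
  then have "exp b * pr ?p E \<le> 1" by (subst (asm) ennreal_le_iff) auto
  then show ?thesis by (simp add: exp_minus field_simps)
qed

lemma stage_sum_list:
  assumes X: "X \<in> set_pmf (stage (lower k) n)" and k: "k \<ge> 1"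
    and f: "\<And>x. x \<in> V \<Longrightarrow> x \<noteq> z \<Longrightarrow> f (x, k) = r"
  shows "(\<Sum>c\<leftarrow>X. f c) = (\<Sum>c\<in>set X \<inter> lower k. f c) + real (count_list X (z, k)) * f (z, k)
    + r * real (length (filter (\<lambda>c. snd c = k \<and> c \<noteq> (z, k)) X))"
proof -
  have "(\<Sum>c\<leftarrow>Y. f c) = (\<Sum>c\<leftarrow>filter (\<lambda>c. snd c < k) Y. f c) + real (count_list Y (z, k)) * f (z, k)
    + r * real (length (filter (\<lambda>c. snd c = k \<and> c \<noteq> (z, k)) Y))" if "set Y \<subseteq> set X" for Y
    using that
  proof (induction Y)
    case (Cons c Y)
    then have "c \<in> cyl" "snd c \<le> k" using set_stage[OF X] stage_level[OF X k] by auto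
    then show ?case using Cons f by (cases c) (auto simp: algebra_simps)
  qed simp
  from this[of X] show ?thesis
    using set_stage[OF X] by (simp add: sum_list_distinct_conv_sum_set Int_def conj_commute)
qed

lemma sum_layers: "(\<Sum>c\<in>V \<times> {1..k - 1}. f c) = (\<Sum>y\<in>{1..k - 1}. \<Sum>x\<in>V. f (x, y))"
  for f :: "'a \<times> int \<Rightarrow> real"
  by (subst sum.swap) (simp add: sum.cartesian_product)

lemma sum_potential_layers: "k \<ge> 1 \<Longrightarrow> (\<Sum>c\<in>V \<times> {1..k - 1}. potential k c) = real_of_int (k - 1)"
  by (simp add: sum_layers sum_potential_level)

text \<open>
  Settled sites are distinct and lie on the levels \<open>1\<close> to \<open>k - 1\<close>, so their contributions are bounded
  by sums over all sites of these levels. Paused walks are on level \<open>k\<close>, where the potential is the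
  indicator of \<open>z\<close>.
\<close>
lemma stage_gain_sums:
  assumes X: "X \<in> set_pmf (stage (lower k) n)" and k: "k \<ge> 1"
  shows "(\<Sum>c\<leftarrow>X. gain k c)
      = real (count_list X (z, k)) + (\<Sum>c\<in>set X \<inter> lower k. potential k c) - n / N"
    and "(\<Sum>c\<leftarrow>X. max (gain k c) 0) \<le> real (count_list X (z, k)) + total_excess k"
    and "(\<Sum>c\<in>set X \<inter> lower k. potential k c) \<le> real_of_int (k - 1)"
proof -
  have top: "potential k (x, k) = (if x = z then 1 else 0)" if "x \<in> V" for x
    using that by (simp add: potential_def hitting_0)
  have "(\<Sum>c\<leftarrow>X. gain k c) = (\<Sum>c\<leftarrow>X. potential k c) - real (length X) / N"
    unfolding gain_def by (induction X) (auto simp: add_divide_distrib)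
  then show "(\<Sum>c\<leftarrow>X. gain k c)
      = real (count_list X (z, k)) + (\<Sum>c\<in>set X \<inter> lower k. potential k c) - n / N"
    using stage_sum_list[OF X k, of "potential k" 0] set_stage[OF X] top z by simp
  have layer: "set X \<inter> lower k \<subseteq> V \<times> {1..k - 1}"
    using set_stage[OF X] stage_level[OF X k] by (force simp: cylinder_def)
  have fin: "finite (V \<times> {1..k - 1})" using finite_verts by simp
  have "(\<Sum>c\<in>set X \<inter> lower k. potential k c) \<le> (\<Sum>c\<in>V \<times> {1..k - 1}. potential k c)"
    using potential_bounds by (intro sum_mono2 fin layer) auto
  also note sum_potential_layers[OF k]
  finally show "(\<Sum>c\<in>set X \<inter> lower k. potential k c) \<le> real_of_int (k - 1)" .
  have "(\<Sum>c\<in>set X \<inter> lower k. max (gain k c) 0) \<le> total_excess k"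
    unfolding total_excess_def sum_layers[of "\<lambda>c. max (gain k c) 0", symmetric] by (intro sum_mono2 fin layer) auto
  moreover have "max (gain k (z, k)) 0 \<le> 1" using gain_bounded[of k "(z, k)"] by auto
  moreover have "max (gain k (x, k)) 0 = 0" if "x \<in> V" "x \<noteq> z" for x
    using top[of x] that N_pos by (simp add: gain_def)
  ultimately show "(\<Sum>c\<leftarrow>X. max (gain k c) 0) \<le> real (count_list X (z, k)) + total_excess k"
    using stage_sum_list[OF X k, of "\<lambda>c. max (gain k c) 0" 0]
      mult_left_mono[of "max (gain k (z, k)) 0" 1 "real (count_list X (z, k))"] by simp
qed

text \<open>
  If no walk is paused at \<open>z\<close> then the martingale is at most \<open>(k - 1) - n/N\<close>.
\<close>
lemma prob_not_reached:
  assumes k: "k \<ge> 1" and l: "0 \<le> l" "l \<le> 1/16"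
  shows "pr (stage (lower k) n) {X. (z, k) \<notin> set X}
    \<le> exp (- (l * (n / N - real_of_int (k - 1)) - 4 * l\<^sup>2 * total_excess k))"
proof (rule prob_log_weight[OF k])
  show "\<bar>- l\<bar> \<le> 1/16" using l by simp
  fix X assume X: "X \<in> set_pmf (stage (lower k) n)" and "X \<in> {X. (z, k) \<notin> set X}"
  then have 0: "count_list X (z, k) = 0" by (simp add: count_list_0_iff)
  have "l * (n / N - real_of_int (k - 1)) \<le> l * - (\<Sum>c\<leftarrow>X. gain k c)"
    using stage_gain_sums(1,3)[OF X k] 0 l by (intro mult_left_mono) auto
  moreover have "4 * l\<^sup>2 * (\<Sum>c\<leftarrow>X. max (gain k c) 0) \<le> 4 * l\<^sup>2 * total_excess k"
    using stage_gain_sums(2)[OF X k] 0 by (intro mult_left_mono) auto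
  ultimately show "l * (n / N - real_of_int (k - 1)) - 4 * l\<^sup>2 * total_excess k \<le> log_weight k (- l) X"
    by (simp add: log_weight_def)
qed

text \<open>
  If all levels below \<open>k\<close> are full, the martingale is the number of walks paused at \<open>z\<close>, up to a
  constant. That number also enters the compensator, where it is absorbed at the cost of a quarter
  of the gain because \<open>4 l\<^sup>2 \<le> l/4\<close>.
\<close>
lemma prob_many_reach:
  assumes k: "k \<ge> 1" and l: "0 \<le> l" "l \<le> 1/16"
  shows "pr (stage (lower k) n)
      {X. h \<le> count_list X (z, k) \<and> full k \<subseteq> cluster (lower k) X}
    \<le> exp (- (l * (3/4 * h - (n / N - real_of_int (k - 1))) - 4 * l\<^sup>2 * total_excess k))"
proof (rule prob_log_weight[OF k])
  show "\<bar>l\<bar> \<le> 1/16" using l by simp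
  fix X assume X: "X \<in> set_pmf (stage (lower k) n)"
    and "X \<in> {X. h \<le> count_list X (z, k) \<and> full k \<subseteq> cluster (lower k) X}"
  then have h: "h \<le> count_list X (z, k)" and full: "full k \<subseteq> cluster (lower k) X" by auto
  let ?m = "real (count_list X (z, k))"
  have "V \<times> {1..k - 1} \<subseteq> set X \<inter> lower k"
  proof
    fix c assume "c \<in> V \<times> {1..k - 1}"
    then have "c \<in> full k" "c \<notin> below G 0" "snd c < k"
      by (auto simp: below_def cylinder_def)
    then show "c \<in> set X \<inter> lower k" using full by (auto simp: cluster_def)
  qed
  then have "(\<Sum>c\<in>V \<times> {1..k - 1}. potential k c) \<le> (\<Sum>c\<in>set X \<inter> lower k. potential k c)"
    using potential_bounds by (intro sum_mono2) auto
  then have "?m + real_of_int (k - 1) - n / N \<le> (\<Sum>c\<leftarrow>X. gain k c)"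
    using stage_gain_sums(1)[OF X k] sum_potential_layers[OF k] by simp
  from mult_left_mono[OF this l(1)]
  have A: "l * (?m - (n / N - real_of_int (k - 1))) \<le> l * (\<Sum>c\<leftarrow>X. gain k c)" by (simp add: algebra_simps)
  have B: "4 * l\<^sup>2 * (\<Sum>c\<leftarrow>X. max (gain k c) 0) \<le> 4 * l\<^sup>2 * (?m + total_excess k)"
    using stage_gain_sums(2)[OF X k] by (intro mult_left_mono) auto
  have "4 * l\<^sup>2 * ?m \<le> 1/4 * l * ?m"
    using l mult_right_mono[of l "1/16" l] by (intro mult_right_mono) (auto simp: power2_eq_square)
  moreover have "l * (3/4 * h) \<le> l * (3/4 * ?m)" using h l by (intro mult_left_mono) auto
  ultimately show "l * (3/4 * h - (n / N - real_of_int (k - 1))) - 4 * l\<^sup>2 * total_excess k \<le> log_weight k l X"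
    using A B unfolding log_weight_def by (simp add: algebra_simps)
qed

end

end

section \<open>Filling below and overshoot above a level\<close>

lemma prob_bind_pmf_le:
  assumes "\<And>x. x \<in> set_pmf p \<Longrightarrow> pr (f x) S \<le> g x" "\<And>x. \<bar>g x\<bar> \<le> B"
  shows "pr (bind_pmf p f) S \<le> measure_pmf.expectation p g"
  unfolding prob_bind_pmf using assms
  by (intro integral_mono_AE measure_pmf.integrable_const_bound[where B = 1]
        measure_pmf.integrable_const_bound[where B = B]) (auto simp: AE_measure_pmf_iff)

lemma exp_minus_1_le_half: "exp (- 1 :: real) \<le> 1 / 2"
  using exp_ge_add_one_self[of "1 :: real"] by (simp add: exp_minus field_simps)

lemma exp_count_replicate_pmf:
  "(\<integral>\<^sup>+ zs. ennreal (exp (- real (count_list zs w))) \<partial>replicate_pmf n p) \<le> ennreal (exp (- real n * pmf p w / 2))"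
proof (induction n)
  case (Suc n)
  have one: "(\<integral>\<^sup>+ z. ennreal (exp (- indicator {w} z)) \<partial>p) \<le> ennreal (exp (- pmf p w / 2))"
  proof -
    have "(\<integral>\<^sup>+ z. ennreal (exp (- indicator {w} z)) \<partial>p) \<le> (\<integral>\<^sup>+ z. ennreal (1 - indicator {w} z / 2) \<partial>p)"
      using exp_minus_1_le_half by (intro nn_integral_mono ennreal_leI) (auto simp: indicator_def)
    also have "\<dots> = ennreal (measure_pmf.expectation p (\<lambda>z. 1 - indicator {w} z / 2))"
      by (intro nn_integral_eq_integral measure_pmf.integrable_const_bound[where B = 1])
         (auto simp: indicator_def)
    also have "measure_pmf.expectation p (\<lambda>z. 1 - indicator {w} z / 2) = 1 - pmf p w / 2"
    proof -
      have "integrable p (\<lambda>z. indicat_real {w} z / 2)"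
        by (intro measure_pmf.integrable_const_bound[where B = 1]) (auto simp: indicator_def)
      then show ?thesis by (simp add: measure_pmf_single)
    qed
    also have "ennreal (1 - pmf p w / 2) \<le> ennreal (exp (- pmf p w / 2))"
      using exp_ge_add_one_self[of "- pmf p w / 2"] by (intro ennreal_leI) simp
    finally show ?thesis .
  qed
  have "(\<integral>\<^sup>+ zs. ennreal (exp (- real (count_list zs w))) \<partial>replicate_pmf (Suc n) p)
     = (\<integral>\<^sup>+ z. \<integral>\<^sup>+ zs. ennreal (exp (- indicator {w} z)) * ennreal (exp (- real (count_list zs w)))
         \<partial>replicate_pmf n p \<partial>p)"
    by (auto simp: ennreal_mult[symmetric] exp_add[symmetric] indicator_def intro!: nn_integral_cong)
  also have "\<dots> = (\<integral>\<^sup>+ z. ennreal (exp (- indicator {w} z)) \<partial>p)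
      * (\<integral>\<^sup>+ zs. ennreal (exp (- real (count_list zs w))) \<partial>replicate_pmf n p)"
    by (simp add: nn_integral_cmult nn_integral_multc)
  also have "\<dots> \<le> ennreal (exp (- pmf p w / 2)) * ennreal (exp (- real n * pmf p w / 2))"
    using Suc one by (intro mult_mono) auto
  also have "\<dots> = ennreal (exp (- real (Suc n) * pmf p w / 2))"
    by (simp add: ennreal_mult[symmetric] exp_add[symmetric] field_simps)
  finally show ?case .
qed simp

text \<open>
  Markov's inequality for \<open>exp (- count)\<close>; the factor \<open>1/2\<close> comes from \<open>exp (-1) \<le> 1/2\<close>.
\<close>
lemma prob_count_replicate_pmf:
  "pr (replicate_pmf n p) {zs. count_list zs w < h} \<le> exp (h - n * pmf p w / 2)"
proof -
  let ?p = "replicate_pmf n p" and ?E = "{zs. count_list zs w < h}"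
  have "ennreal (exp (- real h)) * emeasure ?p ?E = (\<integral>\<^sup>+ zs. ennreal (exp (- real h)) * indicator ?E zs \<partial>?p)"
    by (simp add: nn_integral_cmult_indicator)
  also have "\<dots> \<le> (\<integral>\<^sup>+ zs. ennreal (exp (- real (count_list zs w))) \<partial>?p)"
    by (intro nn_integral_mono) (auto simp: indicator_def intro!: ennreal_leI)
  also note exp_count_replicate_pmf
  finally have "ennreal (exp (- real h) * pr ?p ?E) \<le> ennreal (exp (- real n * pmf p w / 2))"
    by (simp add: measure_pmf.emeasure_eq_measure ennreal_mult)
  then have "exp (- real h) * pr ?p ?E \<le> exp (- real n * pmf p w / 2)"
    by (subst (asm) ennreal_le_iff) auto
  then have "pr ?p ?E \<le> exp (- real n * pmf p w / 2) * exp (real h)"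
    by (simp add: exp_minus field_simps)
  also have "\<dots> = exp (h - n * pmf p w / 2)" by (simp add: exp_add[symmetric])
  finally show ?thesis .
qed

lemma power_step_ge:
  fixes a d :: real
  assumes "0 \<le> a" "0 \<le> d"
  shows "a ^ Suc m + real (Suc m) * d * a ^ m \<le> (a + d) ^ Suc m"
proof (induction m)
  case (Suc m)
  have "a ^ Suc (Suc m) + real (Suc (Suc m)) * d * a ^ Suc m
      \<le> (a ^ Suc m + real (Suc m) * d * a ^ m) * (a + d)"
    using assms by (simp add: algebra_simps)
  also have "\<dots> \<le> (a + d) ^ Suc m * (a + d)"
    using Suc assms by (intro mult_right_mono) auto
  finally show ?case by (simp add: mult.commute)
qed simp

context regular_cylinder
begin

lemma pmf_exit_level_le:
  assumes A: "A \<subseteq> lower j" and y: "y \<le> j" and z: "z \<in> V"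
  shows "pmf (bind_pmf (unif y) (exit A)) (z, j) \<le> 1 / real N"
proof -
  let ?p = "bind_pmf (unif y) (exit A)"
  have "pmf ?p (z, j) = measure_pmf.expectation ?p (indicator {(z, j)})"
    by (simp add: measure_pmf_single)
  also have "\<dots> \<le> measure_pmf.expectation ?p (potential z j)"
    using potential_bounds[OF z] z
    by (intro integral_mono measure_pmf.integrable_const_bound[where B = 1])
       (auto simp: indicator_def potential_def[OF z] hitting_0[OF z])
  finally show ?thesis using expectation_potential[OF z A y] by simp
qed

text \<open>
  A walk that exits above level \<open>j\<close> must first leave the part of \<open>A\<close> below \<open>j\<close> at an occupied site of
  level \<open>j\<close>; each site of that level is the place where this happens with probability at most \<open>1/N\<close>.
\<close>
lemma prob_exit_beyond_level:
  assumes A: "bounded_above A" "A \<subseteq> cyl" and y: "y \<le> j"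
  shows "pr (bind_pmf (unif y) (exit A)) {c. j < snd c} \<le> card {c \<in> A. snd c = j} / N"
proof -
  let ?B = "A \<inter> lower j" and ?L = "{c \<in> A. snd c = j}"
  let ?p = "bind_pmf (unif y) (exit ?B)"
  have fin: "finite ?L"
    by (rule finite_subset[of _ "V \<times> {j}"]) (use A finite_verts in \<open>auto simp: cylinder_def\<close>)
  have B: "bounded_above ?B" using A(1) bounded_above_subset by blast
  have "bind_pmf (unif y) (exit A) = bind_pmf ?p (exit A)"
    unfolding bind_assoc_pmf
    by (intro bind_pmf_cong refl exit_strong_markov A unif_in_cyl) auto
  also have "pr \<dots> {c. j < snd c} \<le> measure_pmf.expectation ?p (indicator ?L)"
  proof (rule prob_bind_pmf_le[where B = 1])
    fix c assume "c \<in> set_pmf ?p"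
    then obtain z where z: "z \<in> set_pmf (unif y)" and c: "c \<in> set_pmf (exit ?B z)" by auto
    have cB: "c \<in> cyl" "c \<notin> ?B" using set_exit[OF B unif_in_cyl[OF z]] c by auto
    have "snd c \<le> (j - 1) + 1"
      by (rule exit_level[OF _ unif_in_cyl[OF z] _ c]) (use z y in auto)
    then show "pr (exit A c) {c. j < snd c} \<le> indicator ?L c"
      using cB A(1) by (cases "c \<in> A") (auto simp: indicator_def exit_outside)
  qed (auto simp: indicator_def)
  also have "\<dots> = (\<Sum>w\<in>?L. pmf ?p w)"
    using fin by (simp add: measure_measure_pmf_finite)
  also have "\<dots> \<le> (\<Sum>w\<in>?L. 1 / real N)"
    using A(2) y by (intro sum_mono) (auto intro!: pmf_exit_level_le)
  finally show ?thesis by simp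
qed

lemma below_subset_cyl: "below G r \<subseteq> cyl"
  by (auto simp: below_def)

lemma set_growth_finite:
  assumes "B \<in> set_pmf (growth D y n A)" "bounded_above A" "A \<subseteq> cyl"
  shows "B \<subseteq> cyl \<and> finite (B - A) \<and> card (B - A) \<le> n"
  using assms(1)
proof (induction n arbitrary: B)
  case (Suc n)
  then obtain B' z c where B': "B' \<in> set_pmf (growth D y n A)" and z: "z \<in> set_pmf (unif y)"
    and c: "c \<in> set_pmf (exit B' z)" and B: "B = settle D c B'" by (auto simp: agg_def)
  have "bounded_above B'" using set_growth[OF B'] assms(2) by blast
  then have "c \<in> cyl" using set_exit unif_in_cyl[OF z] c by blast
  moreover have "B - A \<subseteq> insert c (B' - A)" using B by (auto simp: settle_def split: if_splits)
  moreover have "card (insert c (B' - A)) \<le> Suc n"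
    using Suc.IH[OF B'] by (simp add: card_insert_if)
  ultimately show ?case using Suc.IH[OF B'] B
    by (auto simp: settle_def intro: finite_subset dest: card_mono[rotated] split: if_splits)
qed (use assms in auto)

lemma growth_above_finite:
  assumes B: "B \<in> set_pmf (growth D y n (full k))" and j: "k \<le> j"
  shows "B \<subseteq> cyl" "finite {c \<in> B. j \<le> snd c}" "card {c \<in> B. j \<le> snd c} \<le> n"
proof -
  let ?A = "full k"
  have *: "B \<subseteq> cyl \<and> finite (B - ?A) \<and> card (B - ?A) \<le> n"
    by (rule set_growth_finite[OF B]) (simp_all add: below_subset_cyl)
  have sub: "{c \<in> B. j \<le> snd c} \<subseteq> B - ?A" using j by (auto simp: below_def)
  show "B \<subseteq> cyl" "finite {c \<in> B. j \<le> snd c}" using * finite_subset[OF sub] by auto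
  show "card {c \<in> B. j \<le> snd c} \<le> n" using * card_mono[OF _ sub] by fastforce
qed

definition above :: "int \<Rightarrow> ('a \<times> int) set \<Rightarrow> real" where
  "above j A = real (card {c \<in> A. j \<le> snd c})"

lemma above_growth_step:
  assumes B: "bounded_above B" "B \<subseteq> cyl" and fin: "finite {c \<in> B. j \<le> snd c}" and y: "y \<le> j"
  shows "(\<integral>\<^sup>+ z. \<integral>\<^sup>+ B'. ennreal (above (j + 1) B') \<partial>agg UNIV z B \<partial>unif y)
    \<le> ennreal (above (j + 1) B) + ennreal (above j B / real N)"
proof -
  let ?p = "bind_pmf (unif y) (exit B)"
  have fin': "finite {c \<in> B. j + 1 \<le> snd c}" by (rule finite_subset[OF _ fin]) auto
  have "(\<integral>\<^sup>+ z. \<integral>\<^sup>+ B'. ennreal (above (j + 1) B') \<partial>agg UNIV z B \<partial>unif y)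
      = (\<integral>\<^sup>+ c. ennreal (above (j + 1) (insert c B)) \<partial>?p)"
    by (simp add: agg_def settle_def)
  also have "\<dots> \<le> (\<integral>\<^sup>+ c. ennreal (above (j + 1) B) + indicator {c. j < snd c} c \<partial>?p)"
  proof (intro nn_integral_mono)
    fix c
    have "{c' \<in> insert c B. j + 1 \<le> snd c'}
        = (if j < snd c then insert c {c \<in> B. j + 1 \<le> snd c} else {c \<in> B. j + 1 \<le> snd c})"
      by auto
    then have "above (j + 1) (insert c B) \<le> above (j + 1) B + indicator {c. j < snd c} c"
      using fin' by (auto simp: above_def card_insert_if)
    then have "ennreal (above (j + 1) (insert c B))
        \<le> ennreal (above (j + 1) B + indicator {c. j < snd c} c)"
      by (rule ennreal_leI)
    also have "\<dots> = ennreal (above (j + 1) B) + indicator {c. j < snd c} c"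
      by (subst ennreal_plus) (auto simp: above_def indicator_def)
    finally show "ennreal (above (j + 1) (insert c B)) \<le> ennreal (above (j + 1) B) + indicator {c. j < snd c} c" .
  qed
  also have "\<dots> = ennreal (above (j + 1) B) + ennreal (pr ?p {c. j < snd c})"
    by (simp add: nn_integral_add measure_pmf.emeasure_eq_measure del: emeasure_bind_pmf nn_integral_bind_pmf)
  also have "pr ?p {c. j < snd c} \<le> above j B / real N"
  proof -
    have "card {c \<in> B. snd c = j} \<le> above j B"
      unfolding above_def by (intro of_nat_mono card_mono fin) auto
    then show ?thesis using prob_exit_beyond_level[OF B y] divide_right_mono[of _ "above j B" "real N"]
      by (force intro: order_trans)
  qed
  finally show ?thesis by (simp add: add_left_mono ennreal_leI)
qed

text \<open>
  Particles enter the levels from \<open>j + 1\<close> upwards at a rate of at most \<open>1/N\<close> per particle present on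
  the levels from \<open>j\<close> upwards. Solving this recursion level by level gives the terms of an
  exponential series.
\<close>
lemma expected_above: "(\<integral>\<^sup>+ B. ennreal (above (k + int i) B) \<partial>growth UNIV k n (full k))
    \<le> ennreal (real N * (real n / real N) ^ Suc i / fact (Suc i))"
proof (induction i arbitrary: n)
  case 0
  let ?A = "full k"
  have "(\<integral>\<^sup>+ B. ennreal (above (k + int 0) B) \<partial>growth UNIV k n ?A) \<le> (\<integral>\<^sup>+ B. ennreal n \<partial>growth UNIV k n ?A)"
  proof (intro nn_integral_mono_AE AE_pmfI ennreal_leI)
    fix B assume B: "B \<in> set_pmf (growth UNIV k n ?A)"
    show "above (k + int 0) B \<le> n" using growth_above_finite(3)[OF B, of k] by (simp add: above_def)
  qed
  then show ?case using N_pos by simp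
next
  case (Suc i)
  let ?A = "full k" and ?j = "k + int i"
  show ?case
  proof (induction n)
    case 0
    have "{c \<in> ?A. k + int (Suc i) \<le> snd c} = {}" by (auto simp: below_def)
    then have zero: "above (k + int (Suc i)) ?A = 0" unfolding above_def by (simp only: card.empty of_nat_0)
    have "(\<integral>\<^sup>+ B. ennreal (above (k + int (Suc i)) B) \<partial>growth UNIV k 0 ?A)
        = ennreal (above (k + int (Suc i)) ?A)" by simp
    then show ?case unfolding zero by simp
  next
    case (Suc n)
    let ?p = "growth UNIV k n ?A"
    have "(\<integral>\<^sup>+ B. ennreal (above (k + int (Suc i)) B) \<partial>growth UNIV k (Suc n) ?A)
        = (\<integral>\<^sup>+ B. \<integral>\<^sup>+ z. \<integral>\<^sup>+ B'. ennreal (above (?j + 1) B') \<partial>agg UNIV z B \<partial>unif k \<partial>?p)"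
      by (simp add: algebra_simps)
    also have "\<dots> \<le> (\<integral>\<^sup>+ B. ennreal (above (?j + 1) B) + ennreal (1 / real N) * ennreal (above ?j B) \<partial>?p)"
    proof (intro nn_integral_mono_AE AE_pmfI)
      fix B assume B: "B \<in> set_pmf ?p"
      note * = growth_above_finite[OF B, of ?j, simplified]
      show "(\<integral>\<^sup>+ z. \<integral>\<^sup>+ B'. ennreal (above (?j + 1) B') \<partial>agg UNIV z B \<partial>unif k)
          \<le> ennreal (above (?j + 1) B) + ennreal (1 / real N) * ennreal (above ?j B)"
      proof -
        have "ennreal (1 / real N) * ennreal (above ?j B) = ennreal (above ?j B / real N)"
          by (subst ennreal_mult[symmetric]) (auto simp: above_def)
        then show ?thesis using above_growth_step[of B ?j k] * set_growth[OF B] by simp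
      qed
    qed
    also have "\<dots> = (\<integral>\<^sup>+ B. ennreal (above (k + int (Suc i)) B) \<partial>?p)
        + ennreal (1 / real N) * (\<integral>\<^sup>+ B. ennreal (above ?j B) \<partial>?p)"
      by (simp add: nn_integral_add nn_integral_cmult algebra_simps)
    also have "\<dots> \<le> ennreal (real N * (real n / real N) ^ Suc (Suc i) / fact (Suc (Suc i)))
        + ennreal (1 / real N) * ennreal (real N * (real n / real N) ^ Suc i / fact (Suc i))"
      by (intro add_mono mult_left_mono Suc.IH \<open>\<And>n. (\<integral>\<^sup>+ B. ennreal (above ?j B) \<partial>growth UNIV k n ?A) \<le> _ n\<close>) auto
    also have "\<dots> = ennreal (real N / fact (Suc (Suc i)) * ((real n / real N) ^ Suc (Suc i) + real (Suc (Suc i)) * (1 / real N) * (real n / real N) ^ Suc i))"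
    proof -
      have identity: "M * a / (r * F) + (1 / M) * (M * b / F) = M / (r * F) * (a + r * (1 / M) * b)"
        if "M > 0" "r > 0" "F > 0" for M r F a b :: real
        using that by (simp add: field_simps)
      have fact: "fact (Suc (Suc i)) = real (Suc (Suc i)) * fact (Suc i)" by (rule fact_Suc)
      show ?thesis
        unfolding fact using identity[of "real N" "real (Suc (Suc i))" "fact (Suc i)"
            "(real n / real N) ^ Suc (Suc i)" "(real n / real N) ^ Suc i"] N_pos
        by (simp add: ennreal_mult[symmetric] ennreal_plus[symmetric] del: ennreal_plus fact_Suc power_Suc of_nat_Suc)
    qed
    also have "\<dots> \<le> ennreal (real N / fact (Suc (Suc i)) * (real n / real N + 1 / real N) ^ Suc (Suc i))"
      using N_pos by (intro ennreal_leI mult_left_mono power_step_ge) auto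
    also have "real n / real N + 1 / real N = real (Suc n) / N" by (simp add: add_divide_distrib)
    also have "real N / fact (Suc (Suc i)) * (real (Suc n) / real N) ^ Suc (Suc i)
        = real N * (real (Suc n) / real N) ^ Suc (Suc i) / fact (Suc (Suc i))"
      by (rule times_divide_eq_left)
    finally show ?case .
  qed
qed

definition not_below :: "int \<Rightarrow> ('a \<times> int) set set" where
  "not_below j = {A. \<not> A \<subseteq> below G (real_of_int j)}"

lemma up_closed_not_below: "up_closed (not_below j)"
  by (auto simp: up_closed_def not_below_def)

lemma prob_growth_not_below:
  "pr (growth UNIV k n (full k)) (not_below (k + int i - 1))
    \<le> real N * (real n / real N) ^ Suc i / fact (Suc i)"
proof -
  let ?A = "full k"
  let ?p = "growth UNIV k n ?A"
  have "emeasure ?p (not_below (k + int i - 1)) = (\<integral>\<^sup>+ B. indicator (not_below (k + int i - 1)) B \<partial>?p)"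
    by simp
  also have "\<dots> \<le> (\<integral>\<^sup>+ B. ennreal (above (k + int i) B) \<partial>?p)"
  proof (intro nn_integral_mono_AE AE_pmfI)
    fix B assume B: "B \<in> set_pmf ?p"
    note * = growth_above_finite[OF B, of "k + int i", simplified]
    have "1 \<le> above (k + int i) B" if out: "B \<in> not_below (k + int i - 1)"
    proof -
      obtain x y where c: "(x, y) \<in> B" "(x, y) \<notin> below G (real_of_int (k + int i - 1))"
        using out by (auto simp: not_below_def)
      then have "k + int i \<le> y" using *(1) by (auto simp: below_def)
      then have "{c \<in> B. k + int i \<le> snd c} \<noteq> {}" using c by auto
      then show ?thesis unfolding above_def using *(2) by (simp add: Suc_leI card_gt_0_iff)
    qed
    then show "indicator (not_below (k + int i - 1)) B \<le> ennreal (above (k + int i) B)"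
      by (auto simp: indicator_def)
  qed
  also note expected_above
  finally show ?thesis by (simp add: measure_pmf.emeasure_eq_measure del: fact_Suc)
qed

lemma pmf_unif: "pmf (unif k) (x, k) = (if x \<in> V then 1 / real N else 0)"
proof -
  have "pmf (map_pmf (\<lambda>x. (x, k)) (pmf_of_set V)) (x, k) = pmf (pmf_of_set V) x"
    by (rule pmf_map_inj') (auto simp: inj_on_def)
  then show ?thesis using finite_verts verts_nonempty by (simp add: unif_def indicator_def)
qed

text \<open>
  With probability at least \<open>1/2\<close> a sufficiently large number of uniform particles contains the given
  particles, and additional particles only help an upward closed event.
\<close>
lemma prob_aggs_le_growth:
  assumes S: "up_closed S" and A: "bounded_above A" and ws: "set ws \<subseteq> V \<times> {k}"
    and h: "\<And>x. x \<in> V \<Longrightarrow> count_list ws (x, k) \<le> h"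
    and n: "real N * exp (real h - real n / (2 * real N)) \<le> 1 / 2"
  shows "pr (aggs UNIV ws A) S \<le> 2 * pr (growth UNIV k n A) S"
proof -
  let ?p = "replicate_pmf n (unif k)"
  let ?low = "\<Union>x\<in>V. {zs. count_list zs (x, k) < h}"
  have "pr ?p ?low \<le> (\<Sum>x\<in>V. pr ?p {zs. count_list zs (x, k) < h})"
    by (rule measure_pmf.finite_measure_subadditive_finite) (auto simp: finite_verts)
  also have "\<dots> \<le> (\<Sum>x\<in>V. exp (real h - real n / (2 * real N)))"
    using prob_count_replicate_pmf[of n "unif k"]
    by (intro sum_mono order_trans[OF prob_count_replicate_pmf]) (simp add: pmf_unif mult.commute)
  also have "\<dots> \<le> 1 / 2" using n by simp
  finally have half: "1 / 2 \<le> pr ?p (- ?low)"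
    using measure_pmf.prob_compl[of ?low ?p] by (simp add: Compl_eq_Diff_UNIV)
  have "1 / 2 * pr (aggs UNIV ws A) S
      \<le> pr ?p (- ?low) * pr (aggs UNIV ws A) S"
    using half by (intro mult_right_mono) auto
  also have "\<dots> = measure_pmf.expectation ?p (\<lambda>zs. indicator (- ?low) zs * pr (aggs UNIV ws A) S)"
    by simp
  also have "\<dots> \<le> measure_pmf.expectation ?p (\<lambda>zs. pr (aggs UNIV zs A) S)"
  proof (intro integral_mono_AE AE_pmfI)
    fix zs assume zs: "zs \<in> set_pmf ?p"
    show "indicator (- ?low) zs * pr (aggs UNIV ws A) S \<le> pr (aggs UNIV zs A) S"
    proof (cases "zs \<in> ?low")
      case False
      have "count (mset ws) c \<le> count (mset zs) c" for c
      proof (cases "c \<in> set ws")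
        case True
        then obtain x where x: "c = (x, k)" "x \<in> V" using ws by auto
        then have "h \<le> count_list zs c" using False by (auto simp: not_less)
        then show ?thesis using h[OF x(2)] x by (simp add: count_mset)
      next
        case False then show ?thesis by (simp add: count_list_0_iff count_mset)
      qed
      then have "mset ws \<subseteq># mset zs" by (rule mset_subset_eqI)
      moreover have "set zs \<subseteq> cyl" using zs by (auto simp: set_replicate_pmf cylinder_def)
      ultimately show ?thesis using prob_aggs_mono[OF S _ A] False by simp
    qed simp
  qed (auto intro!: measure_pmf.integrable_const_bound[where B = 1] mult_le_one simp: indicator_def)
  also have "\<dots> = pr (growth UNIV k n A) S"
    unfolding growth_eq_replicate[OF A] prob_bind_pmf ..
  finally show ?thesis by simp
qed

text \<open>
  If paused walks are never released, the two-stage description is the growth process itself.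
\<close>
lemma growth_eq_map_stage:
  "idla_pmf D n = map_pmf (cluster D) (stage D n)"
proof -
  have idle: "aggs D ws A = return_pmf A" if "set ws \<inter> (A \<union> D) = {}" "set ws \<subseteq> cyl" "bounded_above A" for ws A
    using that by (induction ws) (auto simp: agg_def exit_outside settle_def bind_return_pmf)
  have "aggs D (filter (\<lambda>c. c \<notin> D) X) (cluster D X) = return_pmf (cluster D X)" if "X \<in> set_pmf (stage D n)" for X
    using set_stage[OF that] by (intro idle bounded_above_cluster) (auto simp: cluster_def)
  then show ?thesis unfolding growth_eq_stage[OF subset_refl] map_pmf_def by (intro bind_pmf_cong) auto
qed

lemma prob_not_filled:
  assumes D: "lower k \<subseteq> D" and k: "k \<ge> 1" and l: "0 \<le> l" "l \<le> 1/16"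
    and \<delta>: "\<And>z j. z \<in> V \<Longrightarrow> 1 \<le> j \<Longrightarrow> j < k
      \<Longrightarrow> exp (- (l * (real n / real N - real_of_int (j - 1)) - 4 * l\<^sup>2 * total_excess z j)) \<le> \<delta>"
  shows "pr (idla_pmf D n) {A. \<not> full k \<subseteq> A}
    \<le> real N * real_of_int (k - 1) * \<delta>"
proof -
  let ?p = "idla_pmf D n"
  have "pr ?p {A. \<not> full k \<subseteq> A}
      \<le> pr ?p (\<Union>c\<in>V \<times> {1..k - 1}. {A. c \<notin> A})"
  proof (rule measure_pmf.finite_measure_mono_AE)
    have base: "below G 0 \<subseteq> A" if "A \<in> set_pmf ?p" for A using set_growth[OF that] by blast
    have "(x, y) \<in> A" if "below G 0 \<subseteq> A" "(x, y) \<in> full k"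
      "\<forall>c\<in>V \<times> {1..k - 1}. c \<in> A" for A x y
      using that by (cases "y \<le> 0") (auto simp: below_def)
    then have "\<exists>c\<in>V \<times> {1..k - 1}. c \<notin> A"
      if "A \<in> set_pmf ?p" "\<not> full k \<subseteq> A" for A
      using base[OF that(1)] that(2) by (meson subrelI)
    then show "AE A in ?p. A \<in> {A. \<not> full k \<subseteq> A}
        \<longrightarrow> A \<in> (\<Union>c\<in>V \<times> {1..k - 1}. {A. c \<notin> A})"
      by (intro AE_pmfI impI) (simp only: mem_Collect_eq UN_iff)
  qed auto
  also have "\<dots> \<le> (\<Sum>c\<in>V \<times> {1..k - 1}. pr ?p {A. c \<notin> A})"
    by (rule measure_pmf.finite_measure_subadditive_finite) (auto simp: finite_verts)
  also have "\<dots> \<le> (\<Sum>c\<in>V \<times> {1..k - 1}. \<delta>)"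
  proof (rule sum_mono)
    fix c assume "c \<in> V \<times> {1..k - 1}"
    then obtain z j where c: "c = (z, j)" "z \<in> V" "1 \<le> j" "j < k" by auto
    have "pr ?p {A. c \<notin> A} \<le> pr (stage (lower j) n) {X. c \<notin> set X}"
      using c D by (intro prob_unvisited_le) auto
    also have "\<dots> \<le> \<delta>"
      unfolding c(1) by (rule order_trans[OF prob_not_reached[OF c(2,3) l] \<delta>[OF c(2,3,4)]])
    finally show "pr ?p {A. c \<notin> A} \<le> \<delta>" .
  qed
  also have "\<dots> = real N * real_of_int (k - 1) * \<delta>" using k by (simp add: card_cartesian_product)
  finally show ?thesis .
qed

text \<open>
  The first term bounds the probability that a level below \<open>k\<close> is not full or that at least \<open>h\<close>
  walks are paused at some site of level \<open>k\<close>; otherwise the released walks are dominated by \<open>m\<close>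
  uniform ones.
\<close>
lemma prob_overshoot:
  assumes k: "k \<ge> 1" and l: "0 \<le> l" "l \<le> 1/16"
    and \<delta>: "\<And>z j. z \<in> V \<Longrightarrow> 1 \<le> j \<Longrightarrow> j < k
      \<Longrightarrow> exp (- (l * (real n / real N - real_of_int (j - 1)) - 4 * l\<^sup>2 * total_excess z j)) \<le> \<delta>"
    and \<delta>': "\<And>z. z \<in> V
      \<Longrightarrow> exp (- (l * (3/4 * h - (real n / real N - real_of_int (k - 1))) - 4 * l\<^sup>2 * total_excess z k)) \<le> \<delta>"
    and m: "real N * exp (real h - real m / (2 * real N)) \<le> 1 / 2"
  shows "pr (idla_pmf UNIV n) (not_below (k + int i - 1))
    \<le> real N * real_of_int k * \<delta> + 2 * (real N * (real m / real N) ^ Suc i / fact (Suc i))"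
proof -
  let ?D = "{c :: 'a \<times> int. snd c < k}"
  let ?full = "full k"
  let ?p = "stage ?D n" and ?S = "not_below (k + int i - 1)"
  let ?E1 = "{X. \<not> ?full \<subseteq> cluster ?D X}"
  let ?E2 = "\<Union>z\<in>V. {X. h \<le> count_list X (z, k) \<and> ?full \<subseteq> cluster ?D X}"
  let ?q = "pr (growth UNIV k m ?full) ?S"
  have "pr (idla_pmf UNIV n) ?S
      \<le> measure_pmf.expectation ?p (\<lambda>X. indicator (?E1 \<union> ?E2) X + 2 * ?q)"
    unfolding growth_eq_stage[OF subset_UNIV[of ?D]]
  proof (rule prob_bind_pmf_le[where B = 3])
    fix X assume X: "X \<in> set_pmf ?p"
    let ?ws = "filter (\<lambda>c. c \<notin> ?D) X"
    show "pr (aggs UNIV ?ws (cluster ?D X)) ?S \<le> indicator (?E1 \<union> ?E2) X + 2 * ?q"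
    proof (cases "X \<in> ?E1 \<union> ?E2")
      case False
      then have full: "?full \<subseteq> cluster ?D X" and few: "\<And>x. x \<in> V \<Longrightarrow> count_list X (x, k) < h"
        by (auto simp: not_le)
      have "cluster ?D X = ?full"
      proof (intro equalityI full subsetI)
        fix c assume "c \<in> cluster ?D X"
        then show "c \<in> ?full" using set_stage[OF X] k by (cases c) (auto simp: cluster_def below_def)
      qed
      moreover have "set ?ws \<subseteq> V \<times> {k}"
        using stage_level[OF X k] set_stage[OF X] by (force simp: cylinder_def)
      moreover have "count_list ?ws (x, k) \<le> h" if "x \<in> V" for x
      proof -
        have "count_list ?ws (x, k) = count_list X (x, k)" by (induction X) auto
        then show ?thesis using few[OF that] by simp
      qed
      ultimately have "pr (aggs UNIV ?ws (cluster ?D X)) ?S \<le> 2 * ?q"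
        using prob_aggs_le_growth[OF up_closed_not_below bounded_above_below _ _ m, of ?ws k "real_of_int (k - 1)"]
        by simp
      then show ?thesis by (simp add: indicator_def)
    next
      case True
      have "pr (aggs UNIV ?ws (cluster ?D X)) ?S \<le> 1" by simp
      then show ?thesis using True by (simp add: add_increasing2 del: measure_pmf.prob_le_1)
    qed
  next
    show "\<bar>indicator (?E1 \<union> ?E2) X + 2 * ?q\<bar> \<le> 3" for X
    proof -
      have "0 \<le> ?q" "?q \<le> 1" by (rule measure_nonneg measure_pmf.prob_le_1)+
      moreover have "0 \<le> indicat_real (?E1 \<union> ?E2) X" "indicat_real (?E1 \<union> ?E2) X \<le> 1"
        by (rule indicator_pos_le indicator_le_1)+
      ultimately show ?thesis by linarith
    qed
  qed
  also have "\<dots> = pr ?p (?E1 \<union> ?E2) + 2 * ?q"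
  proof -
    have "integrable (measure_pmf ?p) (indicat_real S)" for S
      by (intro measure_pmf.integrable_const_bound[where B = 1]) (auto simp: indicator_def)
    then show ?thesis by (subst Bochner_Integration.integral_add) simp_all
  qed
  also have "pr ?p (?E1 \<union> ?E2) \<le> pr ?p ?E1 + pr ?p ?E2"
    by (rule measure_Un_le) auto
  also have "pr ?p ?E1 \<le> real N * real_of_int (k - 1) * \<delta>"
    using prob_not_filled[OF subset_refl k l \<delta>] unfolding growth_eq_map_stage
    by (simp add: vimage_def)
  also have "pr ?p ?E2 \<le> (\<Sum>z\<in>V. \<delta>)"
  proof (rule order_trans[OF measure_pmf.finite_measure_subadditive_finite], simp add: finite_verts, simp)
    show "(\<Sum>z\<in>V. pr ?p {X. h \<le> count_list X (z, k) \<and> ?full \<subseteq> cluster ?D X}) \<le> (\<Sum>z\<in>V. \<delta>)"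
      by (intro sum_mono order_trans[OF prob_many_reach \<delta>'] k l)
  qed
  also have "?q \<le> real N * (real m / real N) ^ Suc i / fact (Suc i)" by (rule prob_growth_not_below)
  finally show ?thesis by (simp add: algebra_simps)
qed

end

section \<open>The law of the cluster\<close>

lemma (in prob_space) prob_split_finite:
  assumes S: "finite S" and F: "F \<in> events" and E: "E \<in> events" "E \<subseteq> F"
    and Y: "\<And>w. {\<omega> \<in> space M. Y \<omega> = w} \<in> events"
    and total: "(\<Sum>w\<in>S. prob {\<omega> \<in> F. Y \<omega> = w}) = prob F"
  shows "prob E = (\<Sum>w\<in>S. prob {\<omega> \<in> E. Y \<omega> = w})"
proof -
  let ?U = "\<lambda>A. \<Union>w\<in>S. {\<omega> \<in> A. Y \<omega> = w}"
  have piece: "{\<omega> \<in> A. Y \<omega> = w} \<in> events" if "A \<in> events" for A w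
  proof -
    have "{\<omega> \<in> A. Y \<omega> = w} = A \<inter> {\<omega> \<in> space M. Y \<omega> = w}"
      using sets.sets_into_space[OF that] by auto
    then show ?thesis using that Y by simp
  qed
  have U: "?U A \<in> events" "prob (?U A) = (\<Sum>w\<in>S. prob {\<omega> \<in> A. Y \<omega> = w})"
    "prob (A - ?U A) = prob A - prob (?U A)" if A: "A \<in> events" for A
  proof -
    show U: "?U A \<in> events" using S piece[OF A] by (intro sets.finite_UN) auto
    show "prob (?U A) = (\<Sum>w\<in>S. prob {\<omega> \<in> A. Y \<omega> = w})"
      using S piece[OF A] by (intro finite_measure_finite_Union) (auto simp: disjoint_family_on_def)
    show "prob (A - ?U A) = prob A - prob (?U A)" by (rule finite_measure_Diff[OF A U]) auto
  qed
  have "prob (E - ?U E) \<le> prob (F - ?U F)"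
    using F E(2) U(1)[OF F] by (intro finite_measure_mono) auto
  then have "prob (E - ?U E) = 0" using U[OF F] total by (simp add: measure_le_0_iff)
  then show ?thesis using U[OF E(1)] by simp
qed

context regular_cylinder
begin

lemma measurable_path_component: "(\<lambda>p. p n) \<in> path_space G \<rightarrow>\<^sub>M count_space UNIV"
proof -
  have "(\<lambda>p. p n) \<in> path_space G \<rightarrow>\<^sub>M count_space cyl"
    unfolding path_space_def by measurable
  then show ?thesis by (rule measurable_compose) simp
qed

lemma measurable_exit_site: "exit_site A \<in> path_space G \<rightarrow>\<^sub>M count_space UNIV"
proof -
  note measurable_path_component[measurable]
  have [measurable]: "Measurable.pred (path_space G) (\<lambda>p. p n \<notin> A)" for n
    by (rule measurable_compose[OF measurable_path_component]) simp
  show ?thesis unfolding exit_site_def[abs_def]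
    by (rule measurable_compose_countable) measurable
qed

lemma in_path_space: "p \<in> space (path_space G) \<Longrightarrow> p n \<in> cyl"
  by (auto simp: path_space_def space_PiM)

context
  fixes M :: "'w measure" and X
  assumes prob_M: "prob_space M" and walk: "cylinder_walk M G X"
begin

interpretation prob_space M by (rule prob_M)

lemma walk_measurable: "X \<in> M \<rightarrow>\<^sub>M path_space G"
  using walk by (simp add: cylinder_walk_def)

lemma walk_pred: "Measurable.pred M (\<lambda>\<omega>. Q (X \<omega> i))"
  by (rule measurable_compose[OF measurable_compose[OF walk_measurable measurable_path_component]]) simp

abbreviation start_law :: "'a \<times> int \<Rightarrow> real" where
  "start_law z \<equiv> (if snd z = 0 then uniform_dist V (fst z) else 0)"

abbreviation follows :: "nat \<Rightarrow> (nat \<Rightarrow> 'a \<times> int) \<Rightarrow> 'w set" where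
  "follows n z \<equiv> {\<omega> \<in> space M. \<forall>i\<le>n. X \<omega> i = z i}"

lemma prob_follows: "prob (follows n z) = start_law (z 0) * (\<Prod>i<n. cylinder_kernel G (z i) (z (Suc i)))"
  using walk unfolding cylinder_walk_def by blast

lemma prob_follows_extend:
  "prob (follows (Suc j) (z(Suc j := w))) = prob (follows j z) * cylinder_kernel G (z j) w"
  unfolding prob_follows by simp

lemma follows_measurable [measurable]: "follows n z \<in> events"
proof -
  note walk_pred[measurable]
  show ?thesis by measurable
qed

definition exits_at :: "('a \<times> int) set \<Rightarrow> nat \<Rightarrow> nat \<Rightarrow> 'a \<times> int \<Rightarrow> 'w set" where
  "exits_at A j n c = {\<omega> \<in> space M. \<exists>m\<le>n. X \<omega> (j + m) = c \<and> (\<forall>i<m. X \<omega> (j + i) \<in> A)}"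

lemma exits_at_measurable [measurable]: "exits_at A j n c \<in> events"
proof -
  note walk_pred[measurable]
  show ?thesis unfolding exits_at_def by measurable
qed

text \<open>
  One step of the walk splits the event according to its next position, which almost surely is in a
  finite set; this matches the recursion of \<^const>\<open>run\<close>.
\<close>
lemma prob_exits_at:
  assumes c: "c \<notin> A"
  shows "z j \<in> cyl \<Longrightarrow> prob (follows j z \<inter> exits_at A j n c) = prob (follows j z) * pmf (run A n (z j)) c"
proof (induction n arbitrary: j z)
  case 0
  have "follows j z \<inter> exits_at A j 0 c = (if z j = c then follows j z else {})"
    by (auto simp: exits_at_def)
  then show ?case by (simp add: indicator_def)
next
  case (Suc n)
  show ?case
  proof (cases "z j \<in> A")
    case False
    have "follows j z \<inter> exits_at A j (Suc n) c = (if z j = c then follows j z else {})"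
    proof -
      have "(\<exists>m\<le>Suc n. X \<omega> (j + m) = c \<and> (\<forall>i<m. X \<omega> (j + i) \<in> A)) \<longleftrightarrow> z j = c"
        if "X \<omega> j = z j" for \<omega>
      proof
        assume "\<exists>m\<le>Suc n. X \<omega> (j + m) = c \<and> (\<forall>i<m. X \<omega> (j + i) \<in> A)"
        then obtain m where m: "X \<omega> (j + m) = c" "\<forall>i<m. X \<omega> (j + i) \<in> A" by blast
        then have "m = 0" using False that by (cases m) auto
        then show "z j = c" using m that by simp
      qed (use that in \<open>auto intro: exI[of _ 0]\<close>)
      then show ?thesis by (auto simp: exits_at_def)
    qed
    then show ?thesis using False by (simp add: indicator_def)
  next
    case True
    let ?E = "follows j z \<inter> exits_at A j (Suc n) c" and ?S = "neighbours (z j)"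
    have next_meas: "{\<omega> \<in> space M. X \<omega> (Suc j) = w} \<in> events" for w
      using walk_pred[of "\<lambda>u. u = w" "Suc j"] by simp
    have follow_next: "{\<omega> \<in> follows j z. X \<omega> (Suc j) = w} = follows (Suc j) (z(Suc j := w))" for w
      by (auto simp: le_Suc_eq)
    have total: "(\<Sum>w\<in>?S. prob {\<omega> \<in> follows j z. X \<omega> (Suc j) = w}) = prob (follows j z)"
    proof -
      have "(\<Sum>w\<in>?S. prob {\<omega> \<in> follows j z. X \<omega> (Suc j) = w})
          = prob (follows j z) * (\<Sum>w\<in>?S. cylinder_kernel G (z j) w)"
        unfolding follow_next prob_follows_extend by (simp add: sum_distrib_left)
      then show ?thesis using sum_cylinder_kernel_1[OF Suc.prems] by simp
    qed
    have piece: "{\<omega> \<in> ?E. X \<omega> (Suc j) = w}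
        = follows (Suc j) (z(Suc j := w)) \<inter> exits_at A (Suc j) n c" for w
    proof -
      have shift: "(\<exists>m\<le>Suc n. X \<omega> (j + m) = c \<and> (\<forall>i<m. X \<omega> (j + i) \<in> A))
          \<longleftrightarrow> (\<exists>m\<le>n. X \<omega> (Suc j + m) = c \<and> (\<forall>i<m. X \<omega> (Suc j + i) \<in> A))"
        if "X \<omega> j = z j" for \<omega>
      proof
        assume "\<exists>m\<le>Suc n. X \<omega> (j + m) = c \<and> (\<forall>i<m. X \<omega> (j + i) \<in> A)"
        then obtain m where m: "m \<le> Suc n" "X \<omega> (j + m) = c" "\<forall>i<m. X \<omega> (j + i) \<in> A" by blast
        then have "m \<noteq> 0" using c True that by (cases m) auto
        then obtain m' where "m = Suc m'" using not0_implies_Suc by blast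
        then show "\<exists>m\<le>n. X \<omega> (Suc j + m) = c \<and> (\<forall>i<m. X \<omega> (Suc j + i) \<in> A)"
          using m by (intro exI[of _ m']) (auto dest: spec[of _ "Suc _"])
      next
        assume "\<exists>m\<le>n. X \<omega> (Suc j + m) = c \<and> (\<forall>i<m. X \<omega> (Suc j + i) \<in> A)"
        then obtain m where m: "m \<le> n" "X \<omega> (Suc j + m) = c" "\<forall>i<m. X \<omega> (Suc j + i) \<in> A" by blast
        have "X \<omega> (j + i) \<in> A" if "i < Suc m" for i
          using that m(3) True \<open>X \<omega> j = z j\<close> by (cases i) auto
        then show "\<exists>m\<le>Suc n. X \<omega> (j + m) = c \<and> (\<forall>i<m. X \<omega> (j + i) \<in> A)"
          using m by (intro exI[of _ "Suc m"]) auto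
      qed
      have restrict: "{\<omega> \<in> F \<inter> E. Q \<omega>} = {\<omega> \<in> F. Q \<omega>} \<inter> E'"
        if "\<And>\<omega>. \<omega> \<in> F \<Longrightarrow> \<omega> \<in> E \<longleftrightarrow> \<omega> \<in> E'" for F E E' :: "'w set" and Q
        using that by auto
      show ?thesis unfolding follow_next[symmetric]
      proof (rule restrict)
        fix \<omega> assume "\<omega> \<in> follows j z"
        then have "X \<omega> j = z j" by simp
        then show "\<omega> \<in> exits_at A j (Suc n) c \<longleftrightarrow> \<omega> \<in> exits_at A (Suc j) n c"
          unfolding exits_at_def mem_Collect_eq using shift[of \<omega>] by argo
      qed
    qed
    have "prob ?E = (\<Sum>w\<in>?S. prob {\<omega> \<in> ?E. X \<omega> (Suc j) = w})"
      by (rule prob_split_finite[OF finite_neighbours follows_measurable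
            sets.Int[OF follows_measurable exits_at_measurable] Int_lower1 next_meas total])
    also have "\<dots> = (\<Sum>w\<in>?S. prob (follows j z) * (cylinder_kernel G (z j) w * pmf (run A n w) c))"
    proof (intro sum.cong refl)
      fix w assume "w \<in> ?S"
      then have "w \<in> cyl" by (rule neighbours_in_cyl)
      then show "prob {\<omega> \<in> ?E. X \<omega> (Suc j) = w}
          = prob (follows j z) * (cylinder_kernel G (z j) w * pmf (run A n w) c)"
        unfolding piece
        using Suc.IH[of "z(Suc j := w)" "Suc j", unfolded fun_upd_same prob_follows_extend, OF \<open>w \<in> cyl\<close>]
        by (simp only: mult.assoc)
    qed
    also have "\<dots> = prob (follows j z) * pmf (run A (Suc n) (z j)) c"
      using True sum_cylinder_kernel[OF Suc.prems, of "\<lambda>w. pmf (run A n w) c"]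
      by (simp add: sum_distrib_left[symmetric] pmf_bind expectation_step[OF Suc.prems])
    finally show ?thesis .
  qed
qed

lemma prob_exits_from_start:
  assumes c: "c \<notin> A"
  shows "prob (exits_at A 0 n c) = (\<Sum>x\<in>V. pmf (run A n (x, 0)) c) / N"
proof -
  have start_meas: "{\<omega> \<in> space M. X \<omega> 0 = w} \<in> events" for w
    using walk_pred[of "\<lambda>u. u = w" 0] by simp
  have start: "{\<omega> \<in> space M. X \<omega> 0 = (x, 0)} = follows 0 (\<lambda>_. (x, 0))" for x by auto
  have prob_start: "prob (follows 0 (\<lambda>_. (x, 0))) = 1 / N" if "x \<in> V" for x
    unfolding prob_follows using that by (simp add: uniform_dist_def)
  have "(\<Sum>w\<in>V \<times> {0}. prob {\<omega> \<in> space M. X \<omega> 0 = w}) = (\<Sum>w\<in>V \<times> {0 :: int}. 1 / N)"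
  proof (rule sum.cong[OF refl])
    fix w :: "'a \<times> int" assume "w \<in> V \<times> {0}"
    then obtain x where w: "w = (x, 0)" "x \<in> V" by blast
    show "prob {\<omega> \<in> space M. X \<omega> 0 = w} = 1 / real N"
      unfolding w(1) start by (rule prob_start[OF w(2)])
  qed
  then have total: "(\<Sum>w\<in>V \<times> {0}. prob {\<omega> \<in> space M. X \<omega> 0 = w}) = prob (space M)"
    using N_pos verts_nonempty by (simp add: card_cartesian_product prob_space)
  have "prob (exits_at A 0 n c) = (\<Sum>w\<in>V \<times> {0}. prob {\<omega> \<in> exits_at A 0 n c. X \<omega> 0 = w})"
    by (rule prob_split_finite[OF _ sets.top exits_at_measurable _ start_meas total])
       (auto simp: finite_verts exits_at_def)
  also have "\<dots> = (\<Sum>x\<in>V. prob (follows 0 (\<lambda>_. (x, 0)) \<inter> exits_at A 0 n c))"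
  proof -
    have "{\<omega> \<in> exits_at A 0 n c. X \<omega> 0 = (x, 0)} = follows 0 (\<lambda>_. (x, 0)) \<inter> exits_at A 0 n c" for x
      by (auto simp: exits_at_def)
    moreover have "V \<times> {0 :: int} = (\<lambda>x. (x, 0)) ` V" by auto
    moreover have "inj_on (\<lambda>x. (x, 0 :: int)) V" by (simp add: inj_on_def)
    ultimately show ?thesis by (simp only: sum.reindex o_def)
  qed
  also have "\<dots> = (\<Sum>x\<in>V. 1 / N * pmf (run A n (x, 0)) c)"
  proof (rule sum.cong[OF refl])
    fix x assume x: "x \<in> V"
    show "prob (follows 0 (\<lambda>_. (x, 0)) \<inter> exits_at A 0 n c) = 1 / real N * pmf (run A n (x, 0)) c"
      using prob_exits_at[OF c, of "\<lambda>_. (x, 0)" 0 n] x unfolding prob_start[OF x] by simp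
  qed
  finally show ?thesis by (simp add: sum_divide_distrib)
qed

lemma pmf_exit_from_start:
  "pmf (bind_pmf (unif 0) (exit A)) c = (\<Sum>x\<in>V. pmf (exit A (x, 0)) c) / N"
  unfolding unif_def bind_map_pmf
  by (subst pmf_bind, subst integral_pmf_of_set) (auto simp: finite_verts verts_nonempty)

lemma prob_exit_site:
  assumes A: "bounded_above A" and c: "c \<notin> A"
  shows "prob {\<omega> \<in> space M. exit_site A (X \<omega>) = c} = pmf (bind_pmf (unif 0) (exit A)) c"
proof (rule LIMSEQ_unique)
  have "{\<omega> \<in> space M. exit_site A (X \<omega>) = c} = (\<Union>n. exits_at A 0 n c)"
  proof (intro equalityI subsetI)
    fix \<omega> assume \<omega>: "\<omega> \<in> {\<omega> \<in> space M. exit_site A (X \<omega>) = c}"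
    define m where "m = (LEAST n. X \<omega> n \<notin> A)"
    have "X \<omega> m = c" using \<omega> by (simp add: exit_site_def m_def)
    moreover have "X \<omega> i \<in> A" if "i < m" for i using not_less_Least[of i "\<lambda>n. X \<omega> n \<notin> A"] that m_def by blast
    ultimately have "\<omega> \<in> exits_at A 0 m c" using \<omega> by (auto simp: exits_at_def)
    then show "\<omega> \<in> (\<Union>n. exits_at A 0 n c)" by blast
  next
    fix \<omega> assume "\<omega> \<in> (\<Union>n. exits_at A 0 n c)"
    then obtain m where \<omega>: "\<omega> \<in> space M" and m: "X \<omega> m = c" "\<And>i. i < m \<Longrightarrow> X \<omega> i \<in> A"
      by (auto simp: exits_at_def)
    have "(LEAST n. X \<omega> n \<notin> A) = m"
      using m c by (intro Least_equality) (auto simp: not_less[symmetric])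
    then show "\<omega> \<in> {\<omega> \<in> space M. exit_site A (X \<omega>) = c}" using m \<omega> by (simp add: exit_site_def)
  qed
  moreover have "(\<lambda>n. prob (exits_at A 0 n c)) \<longlonglongrightarrow> prob (\<Union>n. exits_at A 0 n c)"
  proof (rule finite_Lim_measure_incseq)
    show "incseq (\<lambda>n. exits_at A 0 n c)"
    proof (rule incseq_SucI)
      show "exits_at A 0 n c \<subseteq> exits_at A 0 (Suc n) c" for n
        unfolding exits_at_def using le_SucI by blast
    qed
  qed auto
  ultimately show "(\<lambda>n. (\<Sum>x\<in>V. pmf (run A n (x, 0)) c) / N) \<longlonglongrightarrow> prob {\<omega> \<in> space M. exit_site A (X \<omega>) = c}"
    by (simp add: prob_exits_from_start[OF c])
  show "(\<lambda>n. (\<Sum>x\<in>V. pmf (run A n (x, 0)) c) / N) \<longlonglongrightarrow> pmf (bind_pmf (unif 0) (exit A)) c"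
    unfolding pmf_exit_from_start using N_pos
    by (intro tendsto_divide tendsto_sum tendsto_const pmf_exit_LIMSEQ A c) auto
qed

text \<open>
  The case \<open>B = A\<close> is the event that the walk never exits, when its exit site is by default a site of
  its path. It has probability zero because the exit probabilities of the sites outside \<open>A\<close> add up
  to one.
\<close>
lemma prob_next_cluster:
  assumes A: "bounded_above A"
  shows "prob {\<omega> \<in> space M. insert (exit_site A (X \<omega>)) A = B} = pmf (bind_pmf (unif 0) (\<lambda>z. agg UNIV z A)) B"
proof -
  let ?p = "bind_pmf (unif 0) (exit A)"
  have p_out: "c \<notin> A" if "c \<in> set_pmf ?p" for c
    using that set_exit[OF A unif_in_cyl] by auto
  have meas: "{\<omega> \<in> space M. exit_site A (X \<omega>) = c} \<in> events" for c
    using measurable_sets[OF measurable_compose[OF walk_measurable measurable_exit_site], of "{c}" A]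
    by (simp add: vimage_def Int_def conj_commute)
  have target: "bind_pmf (unif 0) (\<lambda>z. agg UNIV z A) = map_pmf (\<lambda>c. insert c A) ?p"
    by (simp add: agg_def settle_def map_bind_pmf)
  consider (new) c where "c \<notin> A" "B = insert c A" | (same) "B = A" | (other) "\<And>c. insert c A \<noteq> B"
    by blast
  then show ?thesis
  proof cases
    case (new c)
    have "insert c' A = B \<longleftrightarrow> c' = c" for c' using new by auto
    then have "{\<omega> \<in> space M. insert (exit_site A (X \<omega>)) A = B} = {\<omega> \<in> space M. exit_site A (X \<omega>) = c}"
      and "(\<lambda>c. insert c A) -` {B} = {c}" by auto
    then show ?thesis unfolding target using prob_exit_site[OF A new(1)]
      by (simp add: pmf_map measure_pmf_single del: pmf_bind)
  next
    case same
    let ?H = "\<Union>c\<in>set_pmf ?p. {\<omega> \<in> space M. exit_site A (X \<omega>) = c}"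
    have H: "?H \<in> events" by (rule sets.countable_UN'[OF countable_set_pmf]) (use meas in blast)
    have "emeasure M ?H = (\<integral>\<^sup>+ c. emeasure M {\<omega> \<in> space M. exit_site A (X \<omega>) = c} \<partial>count_space (set_pmf ?p))"
      using meas by (intro emeasure_UN_countable) (auto simp: disjoint_family_on_def simp del: set_bind_pmf)
    also have "\<dots> = (\<integral>\<^sup>+ c. ennreal (pmf ?p c) \<partial>count_space (set_pmf ?p))"
      using p_out by (intro nn_integral_cong) (simp add: emeasure_eq_measure prob_exit_site[OF A] del: set_bind_pmf)
    also have "\<dots> = 1"
      unfolding nn_integral_pmf by (simp add: measure_pmf.emeasure_eq_1_AE AE_measure_pmf_iff del: emeasure_bind_pmf set_bind_pmf)
    finally have "prob ?H = 1" by (simp add: emeasure_eq_measure del: set_bind_pmf)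
    moreover have "{\<omega> \<in> space M. insert (exit_site A (X \<omega>)) A = B} \<subseteq> space M - ?H"
    proof
      fix \<omega> assume \<omega>: "\<omega> \<in> {\<omega> \<in> space M. insert (exit_site A (X \<omega>)) A = B}"
      then have "exit_site A (X \<omega>) \<in> A" using same insertI1[of "exit_site A (X \<omega>)" A] by simp
      then show "\<omega> \<in> space M - ?H" using \<omega> p_out[of "exit_site A (X \<omega>)"] by (auto simp del: set_bind_pmf)
    qed
    ultimately have "prob {\<omega> \<in> space M. insert (exit_site A (X \<omega>)) A = B} \<le> 0"
      using finite_measure_mono[of _ "space M - ?H"] H prob_compl[OF H] by fastforce
    then have "prob {\<omega> \<in> space M. insert (exit_site A (X \<omega>)) A = B} = 0" by (simp add: measure_le_0_iff)
    moreover have "pmf (map_pmf (\<lambda>c. insert c A) ?p) B = 0"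
      using same p_out by (auto simp: pmf_eq_0_set_pmf simp del: set_bind_pmf)
    ultimately show ?thesis unfolding target by simp
  next
    case other
    then have "pmf (map_pmf (\<lambda>c. insert c A) ?p) B = 0" by (auto simp: pmf_eq_0_set_pmf)
    moreover have "{\<omega> \<in> space M. insert (exit_site A (X \<omega>)) A = B} = {}" using other by blast
    ultimately show ?thesis unfolding target by (simp only: measure_empty)
  qed
qed

end

lemma idla_subset:
  assumes "\<And>s n. s \<ge> 1 \<Longrightarrow> w s n \<in> cyl"
  shows "below G 0 \<subseteq> idla G w t \<and> idla G w t \<subseteq> cyl \<and> finite (idla G w t - below G 0)"
proof (induction t)
  case (Suc t)
  have "exit_site (idla G w t) (w (Suc t)) \<in> cyl" using assms by (simp add: exit_site_def)
  then show ?case using Suc by (auto simp: insert_Diff_if)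
qed (simp add: below_subset_cyl)

context
  fixes M :: "'w measure" and W
  assumes walks: "idla_walks M G W"
begin

interpretation prob_space M using walks by (simp add: idla_walks_def)

lemma walk_at: "t \<ge> 1 \<Longrightarrow> cylinder_walk M G (W t)"
  using walks by (simp add: idla_walks_def)

lemma W_in_cyl:
  assumes "\<omega> \<in> space M" "t \<ge> 1" shows "W t \<omega> n \<in> cyl"
  by (rule in_path_space[OF measurable_space[OF walk_measurable[OF prob_space_axioms walk_at[OF assms(2)]] assms(1)]])

lemma idla_range:
  assumes "\<omega> \<in> space M"
  shows "below G 0 \<subseteq> idla G (\<lambda>s. W s \<omega>) t \<and> idla G (\<lambda>s. W s \<omega>) t \<subseteq> cyl
    \<and> finite (idla G (\<lambda>s. W s \<omega>) t - below G 0)"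
  using W_in_cyl[OF assms] by (intro idla_subset)

text \<open>
  The additional events about later walks carry independence through the induction on \<open>t\<close>: the step
  from \<open>t\<close> to \<open>t + 1\<close> moves the requirement on walk \<open>t + 1\<close> from these events into the cluster. The
  clusters that can precede \<open>A\<close> are among the finitely many sets between the initial cluster and \<open>A\<close>.
\<close>
lemma idla_law:
  assumes "finite J" "J \<subseteq> {Suc t..}" "\<And>i. i \<in> J \<Longrightarrow> B i \<in> sets (path_space G)"
  shows "{\<omega> \<in> space M. idla G (\<lambda>s. W s \<omega>) t = A \<and> (\<forall>i\<in>J. W i \<omega> \<in> B i)} \<in> events \<and>
    prob {\<omega> \<in> space M. idla G (\<lambda>s. W s \<omega>) t = A \<and> (\<forall>i\<in>J. W i \<omega> \<in> B i)}
    = pmf (idla_pmf UNIV t) A * (\<Prod>i\<in>J. prob {\<omega> \<in> space M. W i \<omega> \<in> B i})"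
  using assms
proof (induction t arbitrary: J B A)
  case 0
  have meas: "{\<omega> \<in> space M. W i \<omega> \<in> B i} \<in> events" if "i \<in> J" for i
    using measurable_sets[OF walk_measurable[OF prob_space_axioms walk_at[of i]] 0(3)[OF that]] that 0(2)
    by (auto simp: vimage_def Int_def conj_commute)
  have joint: "{\<omega> \<in> space M. \<forall>i\<in>J. W i \<omega> \<in> B i} \<in> events \<and>
      prob {\<omega> \<in> space M. \<forall>i\<in>J. W i \<omega> \<in> B i} = (\<Prod>i\<in>J. prob {\<omega> \<in> space M. W i \<omega> \<in> B i})"
  proof (cases "J = {}")
    case False
    have "{\<omega> \<in> space M. \<forall>i\<in>J. W i \<omega> \<in> B i} = (\<Inter>i\<in>J. W i -` B i \<inter> space M)"
      using False by auto
    moreover have "W i -` B i \<inter> space M = {\<omega> \<in> space M. W i \<omega> \<in> B i}" for i by auto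
    moreover have "prob (\<Inter>i\<in>J. W i -` B i \<inter> space M) = (\<Prod>i\<in>J. prob (W i -` B i \<inter> space M))"
      by (rule indep_varsD[where I = "{1..}" and M' = "\<lambda>_. path_space G"])
         (use walks 0 False in \<open>auto simp: idla_walks_def\<close>)
    ultimately show ?thesis using meas 0(1) False by (auto intro!: sets.finite_INT)
  qed (simp add: prob_space)
  show ?case
  proof (cases "A = below G 0")
    case True
    then have "{\<omega> \<in> space M. idla G (\<lambda>s. W s \<omega>) 0 = A \<and> (\<forall>i\<in>J. W i \<omega> \<in> B i)} = {\<omega> \<in> space M. \<forall>i\<in>J. W i \<omega> \<in> B i}"
      by auto
    then show ?thesis using joint True by simp
  next
    case False
    then have "{\<omega> \<in> space M. idla G (\<lambda>s. W s \<omega>) 0 = A \<and> (\<forall>i\<in>J. W i \<omega> \<in> B i)} = {}" by auto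
    then show ?thesis using False by (simp add: indicator_def)
  qed
next
  case (Suc t)
  let ?p = "idla_pmf UNIV t"
  let ?E = "{\<omega> \<in> space M. idla G (\<lambda>s. W s \<omega>) (Suc t) = A \<and> (\<forall>i\<in>J. W i \<omega> \<in> B i)}"
  show ?case
  proof (cases "finite (A - below G 0)")
    case False
    have "?E = {}" using idla_range False by blast
    moreover have "A \<notin> set_pmf (idla_pmf UNIV (Suc t))"
      using set_growth_finite[of A UNIV 0 "Suc t" "below G 0"] False below_subset_cyl by auto
    ultimately show ?thesis by (simp only: set_pmf_iff) simp
  next
    case True
    define F where "F = {A'. below G 0 \<subseteq> A' \<and> A' \<subseteq> A}"
    have fin: "finite F"
    proof (rule finite_subset)
      show "F \<subseteq> (\<lambda>D. below G 0 \<union> D) ` Pow (A - below G 0)"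
        by (auto simp: F_def image_iff Bex_def intro!: exI[of _ "_ - below G 0"])
    qed (use True in simp)
    define step where "step A' = {p \<in> space (path_space G). insert (exit_site A' p) A' = A}" for A'
    define B' where "B' A' = B(Suc t := step A')" for A'
    let ?E' = "\<lambda>A'. {\<omega> \<in> space M. idla G (\<lambda>s. W s \<omega>) t = A' \<and> (\<forall>i\<in>insert (Suc t) J. W i \<omega> \<in> B' A' i)}"
    have new: "Suc t \<notin> J" using Suc.prems(2) by auto
    have step_meas: "step A' \<in> sets (path_space G)" for A'
    proof -
      have "step A' = exit_site A' -` {c. insert c A' = A} \<inter> space (path_space G)" by (auto simp: step_def)
      then show ?thesis by (simp only:) (rule measurable_sets[OF measurable_exit_site], simp)
    qed
    have IH: "?E' A' \<in> events \<and> prob (?E' A') = pmf ?p A' * (\<Prod>i\<in>insert (Suc t) J. prob {\<omega> \<in> space M. W i \<omega> \<in> B' A' i})"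
      for A'
      by (rule Suc.IH) (use Suc.prems step_meas in \<open>auto simp: B'_def\<close>)
    have in_space: "W (Suc t) \<omega> \<in> space (path_space G)" if "\<omega> \<in> space M" for \<omega>
      using measurable_space[OF walk_measurable[OF prob_space_axioms walk_at[of "Suc t"]]] that by simp
    have E_Un: "?E = (\<Union>A'\<in>F. ?E' A')"
    proof (intro equalityI subsetI)
      fix \<omega> assume \<omega>: "\<omega> \<in> ?E"
      let ?A' = "idla G (\<lambda>s. W s \<omega>) t"
      have "?A' \<in> F" using \<omega> idla_range[of \<omega> t] by (auto simp: F_def)
      moreover have "\<omega> \<in> ?E' ?A'" using \<omega> new in_space by (auto simp: B'_def step_def)
      ultimately show "\<omega> \<in> (\<Union>A'\<in>F. ?E' A')" by blast
    next
      fix \<omega> assume "\<omega> \<in> (\<Union>A'\<in>F. ?E' A')"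
      then obtain A' where "A' \<in> F" "\<omega> \<in> ?E' A'" by blast
      then show "\<omega> \<in> ?E" using new by (auto simp: B'_def step_def split: if_splits)
    qed
    have one: "prob {\<omega> \<in> space M. W (Suc t) \<omega> \<in> step A'} = pmf (bind_pmf (unif 0) (\<lambda>z. agg UNIV z A')) A"
      if "A' \<in> set_pmf ?p" for A'
    proof -
      have "{\<omega> \<in> space M. W (Suc t) \<omega> \<in> step A'} = {\<omega> \<in> space M. insert (exit_site A' (W (Suc t) \<omega>)) A' = A}"
        using in_space by (auto simp: step_def)
      then show ?thesis
        using prob_next_cluster[OF prob_space_axioms walk_at[of "Suc t"], of A' A] set_growth[OF that] by simp
    qed
    let ?c = "\<Prod>i\<in>J. prob {\<omega> \<in> space M. W i \<omega> \<in> B i}"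
    have "prob ?E = (\<Sum>A'\<in>F. prob (?E' A'))"
      unfolding E_Un using fin IH by (intro finite_measure_finite_Union) (auto simp: disjoint_family_on_def)
    also have "\<dots> = (\<Sum>A'\<in>F. pmf ?p A' * pmf (bind_pmf (unif 0) (\<lambda>z. agg UNIV z A')) A * ?c)"
    proof (rule sum.cong[OF refl])
      fix A'
      have "(\<Prod>i\<in>insert (Suc t) J. prob {\<omega> \<in> space M. W i \<omega> \<in> B' A' i})
          = prob {\<omega> \<in> space M. W (Suc t) \<omega> \<in> step A'} * ?c"
      proof -
        have "(\<Prod>i\<in>J. prob {\<omega> \<in> space M. W i \<omega> \<in> B' A' i}) = ?c"
          using new by (intro prod.cong) (auto simp: B'_def)
        then show ?thesis using new Suc.prems(1) by (simp add: B'_def)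
      qed
      then show "prob (?E' A') = pmf ?p A' * pmf (bind_pmf (unif 0) (\<lambda>z. agg UNIV z A')) A * ?c"
        using IH[of A'] one[of A'] by (cases "A' \<in> set_pmf ?p") (simp_all add: set_pmf_iff)
    qed
    also have "\<dots> = pmf (idla_pmf UNIV (Suc t)) A * ?c"
    proof -
      have "pmf (idla_pmf UNIV (Suc t)) A
          = (\<Sum>A'\<in>F. pmf (bind_pmf (unif 0) (\<lambda>z. agg UNIV z A')) A * pmf ?p A')"
        unfolding growth.simps pmf_bind[of ?p]
      proof (rule integral_measure_pmf_real[OF fin])
        fix A' assume A': "A' \<in> set_pmf ?p" "pmf (bind_pmf (unif 0) (\<lambda>z. agg UNIV z A')) A \<noteq> 0"
        then have "A \<in> set_pmf (bind_pmf (unif 0) (\<lambda>z. agg UNIV z A'))" by (metis set_pmf_iff)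
        then have "A' \<subseteq> A" using set_agg(1) by fastforce
        then show "A' \<in> F" using set_growth[OF A'(1)] by (simp add: F_def)
      qed
      then show ?thesis by (simp add: sum_distrib_left mult_ac)
    qed
    finally show ?thesis using E_Un fin IH by (auto intro!: sets.finite_UN)
  qed
qed

lemma prob_idla:
  "{\<omega> \<in> space M. idla G (\<lambda>s. W s \<omega>) t \<in> S} \<in> events \<and>
   prob {\<omega> \<in> space M. idla G (\<lambda>s. W s \<omega>) t \<in> S} = pr (idla_pmf UNIV t) S"
proof -
  define C where "C = {A. below G 0 \<subseteq> A \<and> A \<subseteq> cyl \<and> finite (A - below G 0)} \<inter> S"
  have "countable C"
  proof (rule countable_subset)
    show "C \<subseteq> (\<lambda>D. below G 0 \<union> D) ` {D. finite D \<and> D \<subseteq> cyl}"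
    proof
      fix A assume "A \<in> C"
      then have "A = below G 0 \<union> (A - below G 0)" "finite (A - below G 0)" "A - below G 0 \<subseteq> cyl"
        by (auto simp: C_def)
      then show "A \<in> (\<lambda>D. below G 0 \<union> D) ` {D. finite D \<and> D \<subseteq> cyl}" by blast
    qed
    have "countable cyl" using finite_verts by (simp add: cylinder_def countable_finite)
    then show "countable ((\<lambda>D. below G 0 \<union> D) ` {D. finite D \<and> D \<subseteq> cyl})"
      using countable_Collect_finite_subset by (intro countable_image) blast
  qed
  let ?p = "idla_pmf UNIV t"
  let ?E = "\<lambda>A. {\<omega> \<in> space M. idla G (\<lambda>s. W s \<omega>) t = A}"
  have law: "?E A \<in> events \<and> prob (?E A) = pmf ?p A" for A
    using idla_law[of "{}" t "\<lambda>_. {}" A] by simp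
  have eq: "{\<omega> \<in> space M. idla G (\<lambda>s. W s \<omega>) t \<in> S} = (\<Union>A\<in>C. ?E A)"
    using idla_range by (auto simp: C_def)
  have meas: "(\<Union>A\<in>C. ?E A) \<in> events"
    using law \<open>countable C\<close> by (intro sets.countable_UN') auto
  have "emeasure M (\<Union>A\<in>C. ?E A) = (\<integral>\<^sup>+ A. emeasure M (?E A) \<partial>count_space C)"
    using law \<open>countable C\<close> by (intro emeasure_UN_countable) (auto simp: disjoint_family_on_def)
  also have "\<dots> = (\<integral>\<^sup>+ A. ennreal (pmf ?p A) \<partial>count_space C)"
    using law by (simp add: emeasure_eq_measure)
  also have "\<dots> = emeasure ?p C" by (rule nn_integral_pmf)
  also have "\<dots> = emeasure ?p S"
  proof (rule emeasure_eq_AE)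
    show "AE A in ?p. A \<in> C \<longleftrightarrow> A \<in> S"
      using set_growth[of _ UNIV 0 t "below G 0"] set_growth_finite[of _ UNIV 0 t "below G 0"] below_subset_cyl
      by (intro AE_pmfI) (auto simp: C_def)
  qed auto
  finally show ?thesis unfolding eq using meas
    by (simp add: emeasure_eq_measure measure_pmf.emeasure_eq_measure)
qed

end

end

section \<open>Mixing of the lazy walk on a vertex-transitive graph\<close>

lemma card_out_neighbours: "out_degree (with_proj G) x = card {y. (x, y) \<in> parcs G}"
proof -
  have "out_arcs (with_proj G) x = Pair x ` {y. (x, y) \<in> parcs G}"
    by (auto simp: out_arcs_def)
  then show ?thesis by (simp add: out_degree_def card_image inj_on_def)
qed

lemma vertex_transitive_regular:
  assumes wf: "parcs G \<subseteq> pverts G \<times> pverts G" and trans: "vertex_transitive G"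
    and x: "x \<in> pverts G" and y: "y \<in> pverts G"
  shows "card {w. (x, w) \<in> parcs G} = card {w. (y, w) \<in> parcs G}"
proof -
  obtain f where f: "graph_automorphism G f" "f x = y"
    using trans x y by (auto simp: vertex_transitive_def)
  have "bij_betw f {w. (x, w) \<in> parcs G} {w. (y, w) \<in> parcs G}"
  proof (rule bij_betwI')
    fix v w assume "v \<in> {w. (x, w) \<in> parcs G}" "w \<in> {w. (x, w) \<in> parcs G}"
    then show "f v = f w \<longleftrightarrow> v = w"
      using f wf by (auto simp: graph_automorphism_def bij_betw_def dest: inj_onD)
  next
    fix v assume "v \<in> {w. (x, w) \<in> parcs G}"
    then show "f v \<in> {w. (y, w) \<in> parcs G}" using f x wf by (auto simp: graph_automorphism_def)
  next
    fix w assume w: "w \<in> {w. (y, w) \<in> parcs G}"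
    then have "w \<in> f ` pverts G" using f wf by (auto simp: graph_automorphism_def bij_betw_def)
    then obtain v where v: "v \<in> pverts G" "w = f v" by blast
    then have "(x, v) \<in> parcs G" using w f x by (auto simp: graph_automorphism_def)
    then show "\<exists>v\<in>{w. (x, w) \<in> parcs G}. w = f v" using v by blast
  qed
  then show ?thesis by (rule bij_betw_same_card)
qed

locale transitive_cylinder =
  fixes G :: "'a pair_pre_digraph"
  assumes pair_graph: "pair_graph G" and conn: "Digraph_Component.connected (with_proj G)"
    and trans: "vertex_transitive G" and card_ge_2: "2 \<le> card (pverts G)"
begin

interpretation pair_graph G by (rule pair_graph)

lemma arcs_wf: "parcs G \<subseteq> pverts G \<times> pverts G"
  using in_arcsD1 in_arcsD2 by auto

lemma arcs_sym: "(x, y) \<in> parcs G \<Longrightarrow> (y, x) \<in> parcs G"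
  using pair_sym_arcs by (auto simp: symmetric_def dest: symD)

lemma arcs_irrefl: "(x, x) \<notin> parcs G"
  using pair_no_loops by force

lemma reachable: "x \<in> pverts G \<Longrightarrow> y \<in> pverts G \<Longrightarrow> (x, y) \<in> (parcs G)\<^sup>*"
proof -
  assume xy: "x \<in> pverts G" "y \<in> pverts G"
  have "strongly_connected (with_proj G)"
    using symmetric_connected_imp_strongly_connected[OF pair_sym_arcs conn] .
  then have "x \<rightarrow>\<^sup>*\<^bsub>with_proj G\<^esub> y" using xy by auto
  then show ?thesis using reachable_rtranclI by fastforce
qed

lemma degree_pos: "x \<in> pverts G \<Longrightarrow> 0 < card {y. (x, y) \<in> parcs G}"
proof -
  assume x: "x \<in> pverts G"
  have "\<not> pverts G \<subseteq> {x}" using card_ge_2 card_mono[of "{x}" "pverts G"] by auto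
  then obtain y where y: "y \<in> pverts G" "y \<noteq> x" by blast
  then obtain w where "(x, w) \<in> parcs G" using reachable[OF x y(1)] by (auto elim: converse_rtranclE)
  moreover have "finite {y. (x, y) \<in> parcs G}"
    by (rule finite_subset[OF _ pair_finite_verts]) (use arcs_wf in auto)
  ultimately show ?thesis by (auto simp: card_gt_0_iff)
qed

lemma lazy_srw_self: "lazy_srw G x x = 1 / 2"
  using arcs_irrefl by (simp add: lazy_srw_def)

sublocale regular_cylinder G
proof
  show "finite (pverts G)" by (rule pair_finite_verts)
  show "pverts G \<noteq> {}" using card_ge_2 by auto
next
  fix x assume x: "x \<in> pverts G"
  let ?d = "card {y. (x, y) \<in> parcs G}"
  have nbrs: "{y. (x, y) \<in> parcs G} \<subseteq> pverts G" using arcs_wf by auto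
  have "(\<Sum>x'\<in>pverts G. lazy_srw G x x')
      = (\<Sum>x'\<in>pverts G. (if x' \<in> {y. (x, y) \<in> parcs G} then 1 / (2 * real ?d) else 0) + (if x' = x then 1 / 2 else 0))"
    using arcs_irrefl by (intro sum.cong) (auto simp: lazy_srw_def card_out_neighbours)
  also have "\<dots> = (\<Sum>x'\<in>{y. (x, y) \<in> parcs G}. 1 / (2 * real ?d)) + 1 / 2"
    using x nbrs pair_finite_verts by (simp add: sum.distrib sum.If_cases Int_absorb1)
  also have "\<dots> = 1" using degree_pos[OF x] by simp
  finally show "(\<Sum>x'\<in>pverts G. lazy_srw G x x') = 1" .
next
  fix x x' assume "x \<in> pverts G" "x' \<in> pverts G"
  then show "lazy_srw G x x' = lazy_srw G x' x"
    using vertex_transitive_regular[OF arcs_wf trans, of x x'] arcs_sym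
    by (auto simp: lazy_srw_def card_out_neighbours)
qed

lemma sum_pw_row: "x \<in> V \<Longrightarrow> (\<Sum>z\<in>V. pw n x z) = 1"
proof (induction n arbitrary: x)
  case (Suc n)
  have "(\<Sum>z\<in>V. pw (Suc n) x z) = (\<Sum>y\<in>V. P x y * (\<Sum>z\<in>V. pw n y z))"
    unfolding sum_distrib_left by (simp, rule sum.swap)
  then show ?case using Suc by (simp add: lazy_srw_stochastic)
qed (simp add: finite_verts)

lemma pw_add: "x \<in> V \<Longrightarrow> pw (m + n) x z = (\<Sum>y\<in>V. pw m x y * pw n y z)"
proof (induction m arbitrary: x)
  case (Suc m)
  have "pw (Suc m + n) x z = (\<Sum>w\<in>V. P x w * (\<Sum>y\<in>V. pw m w y * pw n y z))"
    using Suc.IH by simp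
  also have "\<dots> = (\<Sum>y\<in>V. \<Sum>w\<in>V. P x w * pw m w y * pw n y z)"
    unfolding sum_distrib_left by (subst sum.swap) (simp add: mult.assoc)
  finally show ?case by (simp add: sum_distrib_right)
next
  case 0
  have "(\<Sum>y\<in>V. pw 0 x y * pw n y z) = (\<Sum>y\<in>V. if x = y then pw n y z else 0)"
    by (intro sum.cong) auto
  then show ?case using 0 finite_verts by simp
qed

lemma pw_Suc_pos:
  assumes x: "x \<in> V" and w: "w \<in> V" "0 < P x w" "0 < pw n w z"
  shows "0 < pw (Suc n) x z"
proof -
  have "0 < P x w * pw n w z" using w by simp
  also have "\<dots> \<le> (\<Sum>y\<in>V. P x y * pw n y z)"
    using finite_verts w by (intro member_le_sum) auto
  finally show ?thesis by simp
qed

lemma pw_eventually_pos: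
  assumes x: "x \<in> V" and z: "z \<in> V"
  shows "\<exists>n0. \<forall>n\<ge>n0. 0 < pw n x z"
proof -
  have stay: "0 < pw n x z" if "0 < pw m x z" "m \<le> n" "x \<in> V" for m n x
    using that(2,1)
  proof (induction n rule: dec_induct)
    case (step n)
    then show ?case using pw_Suc_pos[OF that(3) that(3)] lazy_srw_self by simp
  qed simp
  have "\<exists>n. 0 < pw n x z"
    using reachable[OF x z]
  proof (induction rule: converse_rtrancl_induct)
    case base
    have "0 < pw 0 z z" by simp
    then show ?case by blast
  next
    case (step x w)
    then obtain n where n: "0 < pw n w z" by blast
    have "x \<in> V" "w \<in> V" using step(1) arcs_wf by auto
    moreover have "0 < P x w" using step(1) degree_pos[OF \<open>x \<in> V\<close>] by (simp add: lazy_srw_def card_out_neighbours)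
    ultimately show ?case using pw_Suc_pos n by blast
  qed
  then show ?thesis using stay x by blast
qed

lemma pw_uniformly_pos: "\<exists>n \<delta>. 0 < \<delta> \<and> (\<forall>x\<in>V. \<forall>z\<in>V. \<delta> \<le> pw n x z)"
proof -
  have "\<forall>p\<in>V \<times> V. \<exists>n0. \<forall>n\<ge>n0. 0 < pw n (fst p) (snd p)"
    using pw_eventually_pos by auto
  then obtain n0 where n0: "\<And>p n. p \<in> V \<times> V \<Longrightarrow> n0 p \<le> n \<Longrightarrow> 0 < pw n (fst p) (snd p)" by metis
  \<comment> \<open>By laziness a transition that is possible in some time is possible in every longer time.\<close>
  define n where "n = Max (n0 ` (V \<times> V))"
  define \<delta> where "\<delta> = Min ((\<lambda>p. pw n (fst p) (snd p)) ` (V \<times> V))"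
  have fin: "finite (V \<times> V)" "V \<times> V \<noteq> {}" using finite_verts verts_nonempty by auto
  have "0 < pw n (fst p) (snd p)" if "p \<in> V \<times> V" for p
    using n0[OF that, of n] that fin by (simp add: n_def)
  then have "0 < \<delta>" unfolding \<delta>_def using fin by (subst Min_gr_iff) auto
  moreover have "\<delta> \<le> pw n x z" if "x \<in> V" "z \<in> V" for x z
    unfolding \<delta>_def using fin that by (intro Min_le) (auto intro!: image_eqI[of _ _ "(x, z)"])
  ultimately show ?thesis by blast
qed

lemma weighted_difference_le:
  fixes f a b :: "'a \<Rightarrow> real"
  assumes a: "\<And>y. y \<in> V \<Longrightarrow> 0 \<le> a y" and b: "\<And>y. y \<in> V \<Longrightarrow> 0 \<le> b y"
    and mass: "(\<Sum>y\<in>V. a y) = r" "(\<Sum>y\<in>V. b y) = r"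
    and osc: "\<And>y y'. y \<in> V \<Longrightarrow> y' \<in> V \<Longrightarrow> f y - f y' \<le> c"
  shows "(\<Sum>y\<in>V. a y * f y) - (\<Sum>y\<in>V. b y * f y) \<le> r * c"
proof -
  have fin: "finite (f ` V)" "f ` V \<noteq> {}" using finite_verts verts_nonempty by auto
  obtain y1 y2 where y: "y1 \<in> V" "f y1 = Max (f ` V)" "y2 \<in> V" "f y2 = Min (f ` V)"
    using Max_in[OF fin] Min_in[OF fin] by (metis imageE)
  have r: "0 \<le> r" using a mass(1) by (metis sum_nonneg)
  have "(\<Sum>y\<in>V. a y * f y) \<le> (\<Sum>y\<in>V. a y * f y1)"
    using fin y a by (intro sum_mono mult_left_mono) auto
  moreover have "(\<Sum>y\<in>V. b y * f y2) \<le> (\<Sum>y\<in>V. b y * f y)"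
    using fin y b by (intro sum_mono mult_left_mono) auto
  ultimately have "(\<Sum>y\<in>V. a y * f y) - (\<Sum>y\<in>V. b y * f y) \<le> r * (f y1 - f y2)"
    using mass by (simp add: sum_distrib_right[symmetric] right_diff_distrib)
  also have "\<dots> \<le> r * c" using osc[OF y(1,3)] r by (intro mult_left_mono)
  finally show ?thesis .
qed

text \<open>
  Doeblin's argument: after \<open>n0\<close> steps every transition has probability at least \<open>\<delta>\<close>, and the common
  part of the transition probabilities cancels in differences. So every \<open>n0\<close> steps reduce the
  oscillation by the factor \<open>r = 1 - N \<delta>\<close>.
\<close>
lemma pw_converges: "\<epsilon> > 0 \<Longrightarrow> \<exists>n. \<forall>x\<in>V. \<forall>z\<in>V. \<bar>pw n x z - 1 / N\<bar> \<le> \<epsilon>"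
proof -
  assume \<epsilon>: "\<epsilon> > 0"
  obtain n0 \<delta> where \<delta>: "0 < \<delta>" "\<And>x z. x \<in> V \<Longrightarrow> z \<in> V \<Longrightarrow> \<delta> \<le> pw n0 x z"
    using pw_uniformly_pos by blast
  define r where "r = 1 - N * \<delta>"
  have mass: "(\<Sum>y\<in>V. pw n0 x y - \<delta>) = r" if "x \<in> V" for x
    using sum_pw_row[OF that] by (simp add: sum_subtractf r_def)
  obtain x0 where "x0 \<in> V" using verts_nonempty by blast
  then have r: "0 \<le> r" using mass \<delta> by (metis (no_types, lifting) diff_ge_0_iff_ge sum_nonneg)
  have r1: "r < 1" using \<delta> N_pos by (simp add: r_def)
  have osc: "pw (k * n0) x z - pw (k * n0) x' z \<le> r ^ k" if "x \<in> V" "x' \<in> V" for k x x' z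
    using that
  proof (induction k arbitrary: x x')
    case (Suc k)
    let ?f = "\<lambda>y. pw (k * n0) y z"
    have "pw (Suc k * n0) x z - pw (Suc k * n0) x' z
        = (\<Sum>y\<in>V. (pw n0 x y - \<delta>) * ?f y) - (\<Sum>y\<in>V. (pw n0 x' y - \<delta>) * ?f y)"
      using Suc.prems by (simp add: pw_add left_diff_distrib sum_subtractf)
    also have "\<dots> \<le> r * r ^ k"
      using \<delta> Suc mass by (intro weighted_difference_le) auto
    finally show ?case by simp
  qed simp
  obtain k where k: "r ^ k < \<epsilon>" using real_arch_pow_inv[OF \<epsilon> r1] by blast
  have "\<bar>pw (k * n0) x z - 1 / N\<bar> \<le> \<epsilon>" if x: "x \<in> V" and z: "z \<in> V" for x z
  proof (rule order_trans[OF deviation_from_mean[OF sum_pw_column[OF z] x] less_imp_le[OF k]])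
    show "\<bar>pw (k * n0) x z - pw (k * n0) x' z\<bar> \<le> r ^ k" if "x' \<in> V" for x'
      using osc[OF x that] osc[OF that x] by (simp add: abs_le_iff)
  qed
  then show ?thesis by blast
qed

lemma tv_dist_le:
  assumes "\<And>B. B \<subseteq> V \<Longrightarrow> \<bar>(\<Sum>x\<in>B. p x) - (\<Sum>x\<in>B. q x)\<bar> \<le> c"
  shows "tv_dist V p q \<le> c"
  unfolding tv_dist_def using finite_verts assms by (subst Max_le_iff) auto

lemma tv_dist_ge: "B \<subseteq> V \<Longrightarrow> \<bar>(\<Sum>x\<in>B. p x) - (\<Sum>x\<in>B. q x)\<bar> \<le> tv_dist V p q"
  unfolding tv_dist_def using finite_verts by (intro Max_ge) auto

lemma sum_uniform_dist: "B \<subseteq> V \<Longrightarrow> (\<Sum>x\<in>B. uniform_dist V x) = (\<Sum>x\<in>B. 1 / N)"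
  by (intro sum.cong) (auto simp: uniform_dist_def)

abbreviation "\<tau> \<equiv> mixing_time G"

text \<open>
  Convergence to equilibrium is needed here to know that the minimum in the definition of the mixing
  time is taken over a nonempty set.
\<close>
lemma tv_at_mixing_time: "x \<in> V \<Longrightarrow> tv_dist V (pw \<tau> x) (uniform_dist V) \<le> 1 / 4"
proof -
  assume x: "x \<in> V"
  let ?Q = "\<lambda>t. (MAX x\<in>V. tv_dist V (pw t x) (uniform_dist V)) \<le> 1 / 4"
  obtain n where n: "\<And>x z. x \<in> V \<Longrightarrow> z \<in> V \<Longrightarrow> \<bar>pw n x z - 1 / N\<bar> \<le> 1 / (4 * N)"
    using pw_converges[of "1 / (4 * N)"] N_pos by auto
  have "tv_dist V (pw n x) (uniform_dist V) \<le> 1 / 4" if x: "x \<in> V" for x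
  proof (rule tv_dist_le)
    fix B assume B: "B \<subseteq> V"
    have "\<bar>(\<Sum>z\<in>B. pw n x z) - (\<Sum>z\<in>B. uniform_dist V z)\<bar> = \<bar>\<Sum>z\<in>B. pw n x z - 1 / N\<bar>"
      by (simp add: sum_uniform_dist[OF B] sum_subtractf)
    also have "\<dots> \<le> (\<Sum>z\<in>B. 1 / (4 * N))"
      using n x B by (intro order_trans[OF sum_abs] sum_mono) auto
    also have "\<dots> \<le> (\<Sum>z\<in>V. 1 / (4 * N))"
      using B finite_verts by (intro sum_mono2) auto
    also have "\<dots> = 1 / 4" using N_pos verts_nonempty by simp
    finally show "\<bar>(\<Sum>z\<in>B. pw n x z) - (\<Sum>z\<in>B. uniform_dist V z)\<bar> \<le> 1 / 4" .
  qed
  then have "?Q n" using finite_verts verts_nonempty by (subst Max_le_iff) auto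
  then have "?Q (LEAST t. ?Q t)" by (rule LeastI)
  then have "?Q \<tau>" unfolding mixing_time_def .
  then show ?thesis using x finite_verts by (subst (asm) Max_le_iff) auto
qed

lemma mixing_time_pos: "1 \<le> \<tau>"
proof (rule ccontr)
  assume "\<not> 1 \<le> \<tau>"
  then have \<tau>: "\<tau> = 0" by simp
  obtain x where x: "x \<in> V" using verts_nonempty by blast
  have "1 / real N \<le> 1 / 2" using card_ge_2 by (simp add: divide_le_eq)
  then have "1 / 2 \<le> \<bar>(\<Sum>z\<in>{x}. pw \<tau> x z) - (\<Sum>z\<in>{x}. uniform_dist V z)\<bar>"
    using x by (simp add: \<tau> uniform_dist_def)
  also have "\<dots> \<le> 1 / 4" using tv_at_mixing_time[OF x] x by (intro order_trans[OF tv_dist_ge]) auto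
  finally show False by simp
qed

lemma l1_at_mixing_time:
  assumes x: "x \<in> V" shows "(\<Sum>z\<in>V. \<bar>pw \<tau> x z - 1 / N\<bar>) \<le> 1 / 2"
proof -
  let ?B = "{z \<in> V. 1 / N \<le> pw \<tau> x z}"
  have part: "\<bar>\<Sum>z\<in>B. pw \<tau> x z - 1 / N\<bar> \<le> 1 / 4" if "B \<subseteq> V" for B
    using tv_dist_ge[OF that, of "pw \<tau> x" "uniform_dist V"] tv_at_mixing_time[OF x]
    by (simp add: sum_uniform_dist[OF that] sum_subtractf)
  have "(\<Sum>z\<in>V. \<bar>pw \<tau> x z - 1 / N\<bar>)
      = (\<Sum>z\<in>?B. \<bar>pw \<tau> x z - 1 / N\<bar>) + (\<Sum>z\<in>V - ?B. \<bar>pw \<tau> x z - 1 / N\<bar>)"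
    using finite_verts by (subst sum.subset_diff[of ?B V]) auto
  also have "(\<Sum>z\<in>?B. \<bar>pw \<tau> x z - 1 / N\<bar>) = (\<Sum>z\<in>?B. pw \<tau> x z - 1 / N)"
    by (intro sum.cong) auto
  also have "(\<Sum>z\<in>V - ?B. \<bar>pw \<tau> x z - 1 / N\<bar>) = - (\<Sum>z\<in>V - ?B. pw \<tau> x z - 1 / N)"
    unfolding sum_negf[symmetric] by (intro sum.cong) auto
  finally show ?thesis using part[of ?B] part[of "V - ?B"] by (simp add: abs_le_iff)
qed

lemma deviation_add:
  assumes x: "x \<in> V" and z: "z \<in> V"
  shows "pw (m + n) x z - 1 / N = (\<Sum>y\<in>V. pw m x y * (pw n y z - 1 / N))"
    and "pw (m + n) x z - 1 / N = (\<Sum>y\<in>V. (pw m x y - 1 / N) * (pw n y z - 1 / N))"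
proof -
  show one: "pw (m + n) x z - 1 / N = (\<Sum>y\<in>V. pw m x y * (pw n y z - 1 / N))"
    using sum_pw_row[OF x, of m] 
    by (simp add: pw_add[OF x] right_diff_distrib sum_subtractf sum_divide_distrib[symmetric])
  have "(\<Sum>y\<in>V. 1 / N * (pw n y z - 1 / N)) = 0"
    using sum_pw_column[OF z, of n] N_pos
    by (simp add: sum_divide_distrib[symmetric] sum_subtractf)
  then show "pw (m + n) x z - 1 / N = (\<Sum>y\<in>V. (pw m x y - 1 / N) * (pw n y z - 1 / N))"
    unfolding one left_diff_distrib[of "pw m x _"] sum_subtractf by simp
qed

text \<open>
  The matrix \<open>P\<^sup>\<tau> - 1/N\<close> has row norms at most \<open>1/2\<close>, and its powers are those of \<open>P\<^sup>\<tau>\<close> minus \<open>1/N\<close>.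
\<close>
lemma deviation_multiple:
  assumes z: "z \<in> V"
  shows "x \<in> V \<Longrightarrow> \<bar>pw (k * \<tau>) x z - 1 / N\<bar> \<le> (1 / 2) ^ k"
proof (induction k arbitrary: x)
  case 0
  have "0 \<le> 1 / real N" "1 / real N \<le> 1" using N_pos by auto
  then show ?case by (cases "x = z") (simp_all add: abs_le_iff del: divide_le_eq_1_pos)
next
  case (Suc k)
  have "\<bar>pw (Suc k * \<tau>) x z - 1 / N\<bar> \<le> (\<Sum>y\<in>V. \<bar>pw \<tau> x y - 1 / N\<bar> * \<bar>pw (k * \<tau>) y z - 1 / N\<bar>)"
    using deviation_add(2)[OF Suc.prems z, of \<tau> "k * \<tau>"] sum_abs
    by (simp add: abs_mult[symmetric])
  also have "\<dots> \<le> (\<Sum>y\<in>V. \<bar>pw \<tau> x y - 1 / N\<bar> * (1 / 2) ^ k)"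
    using Suc.IH by (intro sum_mono mult_left_mono) auto
  also have "\<dots> \<le> 1 / 2 * (1 / 2) ^ k"
    unfolding sum_distrib_right[symmetric] by (intro mult_right_mono l1_at_mixing_time Suc.prems) auto
  finally show ?case by simp
qed

text \<open>
  A number with \<open>rate\<^sup>\<tau> \<ge> 1/2\<close>, by Bernoulli's inequality, so that halving after each \<open>\<tau>\<close> steps gives
  decay at this rate per step.
\<close>
definition "rate = 1 - 1 / (2 * real \<tau>)"

lemma rate_bounds: "0 \<le> rate" "rate \<le> 1" "0 < rate" "1 / 2 \<le> rate ^ \<tau>"
proof -
  have \<tau>: "1 \<le> real \<tau>" using mixing_time_pos by simp
  then have half: "1 / (2 * real \<tau>) \<le> 1 / 2" by (simp add: divide_le_eq)
  then show "0 \<le> rate" "rate \<le> 1" "0 < rate" using \<tau> by (auto simp: rate_def)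
  have "1 + real \<tau> * (- (1 / (2 * real \<tau>))) \<le> (1 + - (1 / (2 * real \<tau>))) ^ \<tau>"
    using half by (intro Bernoulli_inequality) auto
  then show "1 / 2 \<le> rate ^ \<tau>" using \<tau> by (simp add: rate_def)
qed

lemma deviation_le_rate:
  assumes x: "x \<in> V" and z: "z \<in> V"
  shows "\<bar>pw n x z - 1 / N\<bar> \<le> 2 * rate ^ n"
proof -
  define k where "k = n div \<tau>"
  define r where "r = n mod \<tau>"
  have n: "n = r + k * \<tau>" by (simp add: k_def r_def)
  have r: "r \<le> \<tau>" using mixing_time_pos by (simp add: r_def less_imp_le)
  have "\<bar>pw n x z - 1 / N\<bar> \<le> (\<Sum>y\<in>V. pw r x y * \<bar>pw (k * \<tau>) y z - 1 / N\<bar>)"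
    unfolding n deviation_add(1)[OF x z]
    by (rule order_trans[OF sum_abs]) (simp add: abs_mult)
  also have "\<dots> \<le> (\<Sum>y\<in>V. pw r x y * (1 / 2) ^ k)"
    using deviation_multiple[OF z] by (intro sum_mono mult_left_mono) auto
  also have "\<dots> = (1 / 2) ^ k" using sum_pw_row[OF x] by (simp add: sum_distrib_right[symmetric])
  also have "\<dots> \<le> (rate ^ \<tau>) ^ k" using rate_bounds by (intro power_mono) auto
  also have "\<dots> = 2 * (1 / 2 * rate ^ (k * \<tau>))" by (simp add: power_mult[symmetric] mult.commute)
  also have "1 / 2 * rate ^ (k * \<tau>) \<le> rate ^ r * rate ^ (k * \<tau>)"
    using rate_bounds r power_decreasing[OF r, of rate] by (intro mult_right_mono) auto
  also have "\<dots> = rate ^ n" by (simp add: n power_add)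
  finally show ?thesis by simp
qed

end

section \<open>The excess of hitting probabilities over uniformity\<close>

lemma sum_min_geometric_le:
  fixes g :: "nat \<Rightarrow> real"
  assumes g: "\<And>j. 0 \<le> g j" "\<And>j. g j \<le> 1" "\<And>j. g j \<le> c * q ^ j"
    and q: "0 \<le> q" "q < 1" and c: "0 \<le> c" and J: "c * q ^ J \<le> b"
  shows "(\<Sum>j<m. g j) \<le> real J + b / (1 - q)"
proof -
  have "(\<Sum>j<m. g j) \<le> (\<Sum>j<J + m. g j)"
    using g by (intro sum_mono2) auto
  also have "\<dots> = (\<Sum>j<J. g j) + (\<Sum>i<m. g (J + i))"
    by (induction m) auto
  also have "(\<Sum>j<J. g j) \<le> real J"
    using sum_mono[of "{..<J}" g "\<lambda>_. 1"] g by simp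
  also have "(\<Sum>i<m. g (J + i)) \<le> (\<Sum>i<m. c * q ^ J * q ^ i)"
  proof (rule sum_mono)
    show "g (J + i) \<le> c * q ^ J * q ^ i" for i
      using g(3)[of "J + i"] by (simp add: power_add mult.assoc)
  qed
  also have "\<dots> = c * q ^ J * (\<Sum>i<m. q ^ i)" by (simp add: sum_distrib_left)
  also have "\<dots> \<le> b * (1 / (1 - q))"
  proof (intro mult_mono J)
    have "(\<Sum>i<m. q ^ i) = (1 - q ^ m) / (1 - q)" using q by (subst sum_gp_strict) auto
    also have "\<dots> \<le> 1 / (1 - q)" using q by (intro divide_right_mono) auto
    finally show "(\<Sum>i<m. q ^ i) \<le> 1 / (1 - q)" .
    show "0 \<le> b" using J c q by (meson mult_nonneg_nonneg order_trans zero_le_power)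
    show "0 \<le> (\<Sum>i<m. q ^ i)" using q by (intro sum_nonneg) auto
  qed
  finally show ?thesis by simp
qed

context transitive_cylinder
begin

text \<open>
  The height that a walk climbs in the time \<open>\<tau>\<close>, up to constants.
\<close>
definition "mix_height = sqrt (real \<tau>)"

lemma mix_height_ge_1: "1 \<le> mix_height"
  using mixing_time_pos by (simp add: mix_height_def)

lemma mix_height_sq: "mix_height\<^sup>2 = real \<tau>"
  by (simp add: mix_height_def)

text \<open>
  The factor per level in \<open>hit_spread\<close> that belongs to \<^const>\<open>rate\<close>. The fixed point of the
  recursion is about \<open>1 - 1 / \<surd>\<tau>\<close>; half of this gap leaves room for the required inequality.
\<close>
definition "decay = 1 - 1 / (2 * mix_height)"

lemma decay_bounds: "0 \<le> decay" "decay < 1" "decay \<le> exp (- (1 / (2 * mix_height)))"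
  "1/4 + decay\<^sup>2 / 4 + rate * decay / 2 \<le> decay"
proof -
  define x where "x = 1 / (2 * mix_height)"
  have x: "0 < x" "x \<le> 1 / 2" using mix_height_ge_1 by (auto simp: x_def divide_le_eq)
  have decay: "decay = 1 - x" by (simp add: decay_def x_def)
  show "0 \<le> decay" "decay < 1" using x by (auto simp: decay)
  show "decay \<le> exp (- (1 / (2 * mix_height)))"
    using exp_ge_add_one_self[of "- x"] unfolding decay x_def by simp
  have rate: "rate = 1 - 2 * x\<^sup>2"
    using mix_height_ge_1 by (simp add: rate_def mix_height_sq[symmetric] x_def power2_eq_square)
  have "1/4 + decay\<^sup>2 / 4 + rate * decay / 2 = decay - x\<^sup>2 * (3/4 - x)"
    unfolding decay rate by (simp add: power2_eq_square field_simps)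
  also have "\<dots> \<le> decay" using x by simp
  finally show "1/4 + decay\<^sup>2 / 4 + rate * decay / 2 \<le> decay" .
qed

lemma sum_excess_le:
  assumes z: "z \<in> V"
  shows "(\<Sum>x\<in>V. max (hitting z j x - 1 / N) 0) \<le> 1"
    and "(\<Sum>x\<in>V. max (hitting z j x - 1 / N) 0) \<le> 4 * N * decay ^ j"
proof -
  have "(\<Sum>x\<in>V. max (hitting z j x - 1 / N) 0) \<le> (\<Sum>x\<in>V. hitting z j x)"
    using hitting_bounds[OF z] N_pos by (intro sum_mono) auto
  then show "(\<Sum>x\<in>V. max (hitting z j x - 1 / N) 0) \<le> 1" by (simp add: sum_hitting[OF z])
  have "max (hitting z j x - 1 / N) 0 \<le> 4 * decay ^ j" if x: "x \<in> V" for x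
  proof -
    have "\<bar>hitting z j x - 1 / N\<bar> \<le> 4 * decay ^ j"
    proof (rule hitting_near_uniform[OF z x])
      show "\<bar>pw n x z - pw n x' z\<bar> \<le> 4 * rate ^ n" if "x' \<in> V" for n x'
        using deviation_le_rate[OF x z, of n] deviation_le_rate[OF that z, of n] by linarith
    qed (use rate_bounds decay_bounds in auto)
    then show ?thesis by auto
  qed
  then have "(\<Sum>x\<in>V. max (hitting z j x - 1 / N) 0) \<le> (\<Sum>x\<in>V. 4 * decay ^ j)" by (intro sum_mono)
  then show "(\<Sum>x\<in>V. max (hitting z j x - 1 / N) 0) \<le> 4 * N * decay ^ j" by simp
qed

lemma total_excess_eq:
  assumes z: "z \<in> V"
  shows "total_excess z k = (\<Sum>j\<in>{1..nat (k - 1)}. \<Sum>x\<in>V. max (hitting z j x - 1 / N) 0)"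
  unfolding total_excess_def[OF z]
proof (rule sum.reindex_bij_witness[of _ "\<lambda>j. k - int j" "\<lambda>y. nat (k - y)"])
  fix y assume "y \<in> {1..k - 1}"
  then show "(\<Sum>x\<in>V. max (hitting z (nat (k - y)) x - 1 / N) 0) = (\<Sum>x\<in>V. max (gain z k (x, y)) 0)"
    by (intro sum.cong) (auto simp: gain_def[OF z] potential_def[OF z])
qed auto

lemma total_excess_le_level:
  assumes z: "z \<in> V" and k: "1 \<le> k" shows "total_excess z k \<le> real_of_int (k - 1)"
proof -
  have "total_excess z k \<le> (\<Sum>j\<in>{1..nat (k - 1)}. 1)"
    unfolding total_excess_eq[OF z] using sum_excess_le(1)[OF z] by (intro sum_mono)
  then show ?thesis using k by simp
qed

text \<open>
  Up to \<open>J\<close>, about \<open>2 \<surd>\<tau> log N\<close>, each level contributes at most \<open>1\<close>; beyond it the factor \<open>decay\<^sup>j\<close>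
  compensates the number \<open>N\<close> of sites of a level, and a geometric series remains.
\<close>
lemma total_excess_le_mixing:
  assumes z: "z \<in> V" and N: "1 \<le> ln (real N)"
  shows "total_excess z k \<le> 11 * mix_height * ln (real N)"
proof -
  define J where "J = nat \<lceil>2 * mix_height * ln (real N)\<rceil>"
  let ?g = "\<lambda>j. \<Sum>x\<in>V. max (hitting z j x - 1 / N) 0"
  have J: "2 * mix_height * ln (real N) \<le> real J" "real J \<le> 2 * mix_height * ln (real N) + 1"
    using mix_height_ge_1 N unfolding J_def by (auto intro: of_nat_ceiling)
  have pow: "4 * N * decay ^ J \<le> 4"
  proof -
    have "decay ^ J \<le> exp (- (1 / (2 * mix_height))) ^ J" using decay_bounds by (intro power_mono) auto
    also have "\<dots> = exp (- (real J / (2 * mix_height)))" by (simp add: exp_of_nat_mult[symmetric])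
    also have "\<dots> \<le> exp (- ln (real N))" using J mix_height_ge_1 by (simp add: le_divide_eq mult_ac)
    also have "\<dots> = 1 / N" using N_pos by (simp add: exp_minus divide_inverse)
    finally show ?thesis using N_pos by (simp add: field_simps)
  qed
  have "total_excess z k \<le> (\<Sum>j<Suc (nat (k - 1)). ?g j)"
    unfolding total_excess_eq[OF z] by (intro sum_mono2) (auto intro!: sum_nonneg)
  also have "\<dots> \<le> real J + 4 / (1 - decay)"
    using sum_excess_le[OF z] decay_bounds pow
    by (intro sum_min_geometric_le[where c = "4 * N"]) (auto intro!: sum_nonneg)
  also have "4 / (1 - decay) = 8 * mix_height" using mix_height_ge_1 by (simp add: decay_def)
  also have "real J + 8 * mix_height \<le> 11 * mix_height * ln (real N)"
  proof -
    have "mix_height * 1 \<le> mix_height * ln (real N)" using mix_height_ge_1 N by (intro mult_left_mono) auto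
    then show ?thesis using J(2) mix_height_ge_1 unfolding mult.assoc by linarith
  qed
  finally show ?thesis by simp
qed

end

section \<open>The sandwich bound\<close>

text \<open>
  A consequence of \<open>n\<^sup>n / n! \<le> e\<^sup>n\<close> and \<open>e\<^sup>2 \<le> 9\<close>.
\<close>
lemma power_over_fact_le:
  fixes r :: real
  assumes r: "0 \<le> r" and n: "9 * r \<le> n"
  shows "r ^ n / fact n \<le> exp (- real n)"
proof (cases "n = 0")
  case False
  have n_exp: "real n ^ n / fact n \<le> exp (real n)"
  proof -
    have "(\<Sum>i\<in>{n}. real n ^ i /\<^sub>R fact i) \<le> (\<Sum>i. real n ^ i /\<^sub>R fact i)"
      by (intro sum_le_suminf summable_exp_generic) auto
    then show ?thesis by (simp add: exp_def divide_inverse mult.commute)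
  qed
  have "r ^ n \<le> (real n / 9) ^ n" using assms by (intro power_mono) auto
  then have "r ^ n / fact n \<le> (real n / 9) ^ n / fact n" by (intro divide_right_mono) auto
  also have "\<dots> = (real n ^ n / fact n) / 9 ^ n" by (simp add: power_divide)
  also have "\<dots> \<le> exp (real n) / 9 ^ n" by (intro divide_right_mono n_exp) auto
  also have "exp (real n) / 9 ^ n \<le> exp (real n) / (exp 2) ^ n"
  proof (intro divide_left_mono power_mono)
    have "exp (2::real) = exp 1 * exp 1" by (simp add: exp_add[symmetric])
    also have "\<dots> \<le> 3 * 3" using exp_le by (intro mult_mono) auto
    finally show "exp (2 :: real) \<le> 9" by simp
  qed auto
  also have "\<dots> = exp (- real n)"
    by (simp add: exp_of_nat_mult[symmetric] exp_diff[symmetric])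
  finally show ?thesis .
qed simp

lemma nat_ceiling_bounds:
  fixes x :: real
  shows "x \<le> real (nat \<lceil>x\<rceil>)" and "0 \<le> x \<Longrightarrow> real (nat \<lceil>x\<rceil>) \<le> x + 1"
  using of_nat_ceiling[of x] ceiling_correct[of x] by (auto simp: of_nat_nat)

lemma below_mono: "r \<le> s \<Longrightarrow> below G r \<subseteq> below G s"
  by (auto simp: below_def)

context transitive_cylinder
begin

abbreviation "L \<equiv> ln (real N)"

definition volume_scale :: "nat \<Rightarrow> real" where
  "volume_scale T = min (real T) (T_sharp G N) / real N"

definition deviation_scale :: "nat \<Rightarrow> real" where
  "deviation_scale T = max L (sqrt (volume_scale T * L))"

context
  fixes T :: nat and \<beta> :: real
  assumes L: "1 \<le> L" and \<beta>: "1 \<le> \<beta>"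
begin

abbreviation "D \<equiv> deviation_scale T"

text \<open>
  The distance from \<open>T/N\<close> at which the exponential bounds become useful, and the parameter \<open>l\<close> of the
  supermartingale. Their product is \<open>(\<beta> + 11/16) log N\<close>, while the compensator is at most
  \<open>(11/64) log N\<close>, which leaves the tail \<open>N\<^bsup>-\<beta>\<^esup>\<close>.
\<close>
definition "margin = (16 * \<beta> + 11) * D"
definition "tilt = L / (16 * D)"

lemma volume_scale_nonneg: "0 \<le> volume_scale T"
  by (simp add: volume_scale_def T_sharp_def)

lemma D_ge: "L \<le> D" "1 \<le> D" "volume_scale T * L \<le> D\<^sup>2"
proof -
  show "L \<le> D" "1 \<le> D" using L by (auto simp: deviation_scale_def)
  have v: "0 \<le> volume_scale T" by (rule volume_scale_nonneg)
  have "sqrt (volume_scale T * L) \<le> D" by (simp add: deviation_scale_def)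
  then have "(sqrt (volume_scale T * L))\<^sup>2 \<le> D\<^sup>2" using v L by (intro power_mono) auto
  then show "volume_scale T * L \<le> D\<^sup>2" using v L by simp
qed

lemma tilt_bounds: "0 \<le> tilt" "tilt \<le> 1/16" "tilt * margin = (\<beta> + 11/16) * L"
  using D_ge L by (auto simp: tilt_def margin_def divide_le_eq field_simps)

lemma tilt_excess:
  assumes z: "z \<in> V" and k: "1 \<le> k" and kT: "k = 1 \<or> real_of_int (k - 1) \<le> real T / N"
  shows "4 * tilt\<^sup>2 * total_excess z k \<le> 11/64 * L"
proof -
  have "total_excess z k \<le> 11 * volume_scale T"
  proof (cases "k = 1")
    case True
    then show ?thesis using total_excess_le_level[OF z k] volume_scale_nonneg by simp
  next
    case False
    have "total_excess z k \<le> real T / N" using False kT total_excess_le_level[OF z k] by simp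
    moreover have "0 \<le> real T / N" by simp
    ultimately have "total_excess z k \<le> 11 * (real T / N)" by linarith
    moreover have "total_excess z k \<le> 11 * (T_sharp G N / N)"
    proof -
      have "11 * mix_height * L \<le> 11 * mix_height * L\<^sup>2"
        using L mix_height_ge_1 by (intro mult_left_mono) (auto simp: power2_eq_square)
      also have "\<dots> = 11 * (T_sharp G N / N)" using N_pos by (simp add: T_sharp_def mix_height_def)
      finally show ?thesis using total_excess_le_mixing[OF z L, of k] by linarith
    qed
    ultimately show ?thesis by (simp add: volume_scale_def min_def)
  qed
  then have "4 * tilt\<^sup>2 * total_excess z k \<le> 4 * tilt\<^sup>2 * (11 * volume_scale T)"
    by (intro mult_left_mono) auto
  also have "\<dots> = 11/64 * (L\<^sup>2 * volume_scale T / D\<^sup>2)"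
    by (simp add: tilt_def power2_eq_square)
  also have "L\<^sup>2 * volume_scale T / D\<^sup>2 \<le> L"
  proof -
    have "L\<^sup>2 * volume_scale T = L * (volume_scale T * L)" by (simp add: power2_eq_square)
    also have "\<dots> \<le> L * D\<^sup>2" using D_ge L by (intro mult_left_mono) auto
    finally show ?thesis using D_ge by (simp add: divide_le_eq)
  qed
  finally show ?thesis by simp
qed

lemma tail_le:
  assumes "z \<in> V" "1 \<le> k" "k = 1 \<or> real_of_int (k - 1) \<le> real T / N" and g: "margin \<le> g"
  shows "exp (- (tilt * g - 4 * tilt\<^sup>2 * total_excess z k)) \<le> real N powr - \<beta>"
proof -
  have "tilt * margin \<le> tilt * g" using g tilt_bounds by (intro mult_left_mono) auto
  then have "\<beta> * L \<le> tilt * g - 4 * tilt\<^sup>2 * total_excess z k"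
    using tilt_excess[OF assms(1-3)] tilt_bounds(3) L by (simp add: algebra_simps)
  then have "exp (- (tilt * g - 4 * tilt\<^sup>2 * total_excess z k)) \<le> exp (- (\<beta> * L))" by simp
  also have "\<dots> = real N powr - \<beta>" using N_pos by (simp add: powr_def)
  finally show ?thesis .
qed

lemma inner_bound:
  assumes k: "1 \<le> k" and kT: "real_of_int (k - 1) \<le> real T / N - margin"
  shows "pr (idla_pmf UNIV T) {A. \<not> full k \<subseteq> A}
    \<le> real T * real N powr - \<beta>"
proof -
  have margin: "0 \<le> margin" using D_ge \<beta> by (simp add: margin_def)
  have "pr (idla_pmf UNIV T) {A. \<not> full k \<subseteq> A}
    \<le> real N * real_of_int (k - 1) * real N powr - \<beta>"
  proof (rule prob_not_filled[OF _ k tilt_bounds(1,2)])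
    fix z j assume j: "z \<in> V" "1 \<le> j" "j < k"
    have "real_of_int (j - 1) \<le> real_of_int (k - 1)" using j by simp
    then show "exp (- (tilt * (real T / real N - real_of_int (j - 1)) - 4 * tilt\<^sup>2 * total_excess z j))
        \<le> real N powr - \<beta>"
      using j kT margin by (intro tail_le) auto
  qed auto
  also have "real N * real_of_int (k - 1) \<le> real T"
  proof -
    have "real_of_int (k - 1) \<le> real T / N" using kT margin by linarith
    then show ?thesis using N_pos by (simp only: pos_le_divide_eq mult.commute)
  qed
  finally show ?thesis by (simp add: mult_right_mono)
qed

text \<open>
  The constants: \<open>h\<close> is about \<open>4\<close> times \<^const>\<open>margin\<close>, \<open>r\<close> about \<open>2 (h + log N)\<close> so that \<open>N r\<close> uniform
  walks dominate \<open>h\<close> walks per site, and \<open>i\<close> about \<open>9 r + \<beta> log N\<close> so that \<open>r\<^sup>n / n! \<le> N\<^bsup>-\<beta>\<^esup>\<close> for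
  \<open>n = i + 1\<close>. In total \<open>i\<close> is about \<open>72\<close> times \<^const>\<open>margin\<close>, and \<open>72 \<cdot> 16 = 1152\<close>.
\<close>
lemma outer_bound:
  assumes T: "1 \<le> T"
  shows "pr (idla_pmf UNIV T)
      {A. \<not> A \<subseteq> below G (real T / N + (1160 * \<beta> + 900) * D)}
    \<le> (real T + real N) * real N powr - \<beta> + 2 * (real N * real N powr - \<beta>)"
proof -
  \<comment> \<open>For small \<open>T\<close> no level need be full; then \<open>k = 1\<close> and nothing is required below.\<close>
  define k where "k = max 1 \<lfloor>real T / N - margin\<rfloor>"
  define h where "h = nat \<lceil>4 * margin\<rceil>"
  define r where "r = nat \<lceil>2 * (real h + L + 1)\<rceil>"
  define i where "i = nat \<lceil>9 * real r + \<beta> * L\<rceil>"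
  have margin: "11 \<le> margin"
    using D_ge \<beta> mult_mono[of 11 "16 * \<beta> + 11" 1 D] by (simp add: margin_def)
  have k: "1 \<le> k" by (simp add: k_def)
  have k_le: "k = 1 \<or> real_of_int k \<le> real T / N - margin"
    unfolding k_def by (cases "1 \<le> \<lfloor>real T / N - margin\<rfloor>") (auto simp: max_def)
  have k_ge: "real T / N - margin - 1 \<le> real_of_int k"
    unfolding k_def by linarith
  have h: "4 * margin \<le> real h" "real h \<le> 4 * margin + 1"
    using margin nat_ceiling_bounds[of "4 * margin"] unfolding h_def by auto
  have r: "2 * (real h + L + 1) \<le> real r" "real r \<le> 2 * (real h + L + 1) + 1"
    using L nat_ceiling_bounds[of "2 * (real h + L + 1)"] unfolding r_def by auto
  have \<beta>L: "0 \<le> \<beta> * L" using \<beta> L by simp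
  have i: "9 * real r + \<beta> * L \<le> real i" "real i \<le> 9 * real r + \<beta> * L + 1"
    using \<beta>L nat_ceiling_bounds[of "9 * real r + \<beta> * L"] unfolding i_def by auto
  let ?m = "N * r"
  have m: "real N * exp (real h - real ?m / (2 * real N)) \<le> 1 / 2"
  proof -
    have "real h - real ?m / (2 * real N) \<le> - L - 1" using r N_pos by simp
    then have "real N * exp (real h - real ?m / (2 * real N)) \<le> real N * exp (- L - 1)"
      using N_pos by (intro mult_left_mono) auto
    also have "\<dots> = exp (- 1)" using N_pos by (simp add: exp_diff exp_minus field_simps)
    also note exp_minus_1_le_half
    finally show ?thesis .
  qed
  have "pr (idla_pmf UNIV T) (not_below (k + int i - 1))
    \<le> real N * real_of_int k * real N powr - \<beta>
      + 2 * (real N * (real ?m / real N) ^ Suc i / fact (Suc i))"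
  proof (rule prob_overshoot[OF k tilt_bounds(1,2) _ _ m])
    fix z j assume j: "z \<in> V" "1 \<le> j" "j < k"
    then have "real_of_int k \<le> real T / N - margin" using k_le by auto
    moreover have "real_of_int (j - 1) \<le> real_of_int k" using j by simp
    ultimately show "exp (- (tilt * (real T / real N - real_of_int (j - 1)) - 4 * tilt\<^sup>2 * total_excess z j))
        \<le> real N powr - \<beta>"
      using j margin by (intro tail_le) auto
  next
    fix z assume z: "z \<in> V"
    show "exp (- (tilt * (3/4 * real h - (real T / real N - real_of_int (k - 1))) - 4 * tilt\<^sup>2 * total_excess z k))
        \<le> real N powr - \<beta>"
    proof (intro tail_le z k)
      show "k = 1 \<or> real_of_int (k - 1) \<le> real T / real N" using k_le margin by auto
      show "margin \<le> 3/4 * real h - (real T / real N - real_of_int (k - 1))"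
        using h k_ge margin by simp
    qed
  qed
  also have "real N * (real ?m / real N) ^ Suc i / fact (Suc i) \<le> real N * real N powr - \<beta>"
  proof -
    have "real r ^ Suc i / fact (Suc i) \<le> exp (- real (Suc i))"
      using i \<beta>L by (intro power_over_fact_le) auto
    also have "\<dots> \<le> exp (- (\<beta> * L))" using i by simp
    also have "\<dots> = real N powr - \<beta>" using N_pos by (simp add: powr_def)
    finally have "real N * (real r ^ Suc i / fact (Suc i)) \<le> real N * real N powr - \<beta>"
      by (rule mult_left_mono) simp
    moreover have "real ?m / real N = real r" using N_pos by simp
    ultimately show ?thesis by (simp only: times_divide_eq_right)
  qed
  also have "real N * real_of_int k \<le> real T + real N"
  proof (cases "k = 1")
    case False
    then have "real_of_int k \<le> real T / N" using k_le margin by auto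
    then show ?thesis using N_pos by (simp add: le_divide_eq mult.commute)
  qed simp
  finally have bound: "pr (idla_pmf UNIV T) (not_below (k + int i - 1))
      \<le> (real T + real N) * real N powr - \<beta> + 2 * (real N * real N powr - \<beta>)"
    by (simp add: mult_right_mono)
  have level: "real_of_int (k + int i - 1) \<le> real T / N + (1160 * \<beta> + 900) * D"
  proof -
    have "real_of_int k \<le> real T / N + 1" using k_le margin by auto
    moreover have "real i \<le> 72 * margin + 18 * L + \<beta> * L + 46"
    proof -
      have "9 * real r \<le> 72 * margin + 18 * L + 45" using r(2) h(2) by simp
      then show ?thesis using i(2) by linarith
    qed
    moreover have "margin = 16 * (\<beta> * D) + 11 * D" by (simp add: margin_def algebra_simps)
    moreover have "\<beta> * L \<le> \<beta> * D" using D_ge \<beta> by (intro mult_left_mono) auto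
    moreover have "(1160 * \<beta> + 900) * D = 1160 * (\<beta> * D) + 900 * D" by (simp add: algebra_simps)
    moreover have "0 \<le> \<beta> * D" using D_ge \<beta> by simp
    ultimately have "real_of_int k + real i - 1 \<le> real T / N + (1160 * \<beta> + 900) * D"
      using D_ge(1,2) by linarith
    then show ?thesis by simp
  qed
  have "{A. \<not> A \<subseteq> below G (real T / N + (1160 * \<beta> + 900) * D)} \<subseteq> not_below (k + int i - 1)"
    using level unfolding not_below_def below_def by fastforce
  then have "pr (idla_pmf UNIV T)
      {A. \<not> A \<subseteq> below G (real T / N + (1160 * \<beta> + 900) * D)}
    \<le> pr (idla_pmf UNIV T) (not_below (k + int i - 1))"
    by (intro measure_pmf.finite_measure_mono) auto
  then show ?thesis using bound by linarith
qed

lemma sandwich_bound: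
  assumes T: "1 \<le> T" and C: "1160 * \<beta> + 900 \<le> C"
  shows "pr (idla_pmf UNIV T)
      {A. below G (real_of_int \<lfloor>real T / N - Delta C G N T\<rfloor>) \<subseteq> A \<and> A \<subseteq> below G (real T / N + Delta C G N T)}
    \<ge> 1 - (2 * real T + 3 * real N) * real N powr - \<beta>"
proof -
  let ?p = "idla_pmf UNIV T"
  let ?a = "\<lfloor>real T / N - Delta C G N T\<rfloor>" and ?b = "real T / N + Delta C G N T"
  have Delta: "C * D \<le> Delta C G N T"
  proof -
    have v: "0 \<le> volume_scale T" by (rule volume_scale_nonneg)
    have "volume_scale T * L \<le> volume_scale T * (L + log_plus (real T / real N))"
      using v by (intro mult_left_mono) (auto simp: log_plus_def)
    then have "D \<le> max L (sqrt (volume_scale T * (L + log_plus (real T / real N))))"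
      unfolding deviation_scale_def by (intro max.mono) auto
    then show ?thesis unfolding Delta_def volume_scale_def using C \<beta> by (intro mult_left_mono) auto
  qed
  have "(1160 * \<beta> + 900) * D \<le> C * D" using C D_ge by (intro mult_right_mono) auto
  then have out: "(1160 * \<beta> + 900) * D \<le> Delta C G N T" using Delta by linarith
  have "margin \<le> (1160 * \<beta> + 900) * D"
    unfolding margin_def using D_ge \<beta> by (intro mult_right_mono) auto
  then have margin: "margin \<le> Delta C G N T" using out by linarith
  have inner: "pr ?p {A. \<not> below G (real_of_int ?a) \<subseteq> A} \<le> real T * real N powr - \<beta>"
  proof (cases "0 \<le> ?a")
    case True
    have "real_of_int ?a \<le> real T / N - margin" using margin by linarith
    then show ?thesis using inner_bound[of "?a + 1"] True by simp
  next
    case False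
    have "{A. \<not> below G (real_of_int ?a) \<subseteq> A} \<inter> set_pmf ?p = {}"
    proof -
      have "below G (real_of_int ?a) \<subseteq> below G 0" using False by (intro below_mono) simp
      then show ?thesis using set_growth[of _ UNIV 0 T "below G 0"] by blast
    qed
    then have "pr ?p {A. \<not> below G (real_of_int ?a) \<subseteq> A} = 0"
      by (simp add: measure_pmf_zero_iff Int_commute)
    then show ?thesis by simp
  qed
  have "{A. \<not> A \<subseteq> below G ?b} \<subseteq> {A. \<not> A \<subseteq> below G (real T / N + (1160 * \<beta> + 900) * D)}"
    using out unfolding below_def by fastforce
  then have outer: "pr ?p {A. \<not> A \<subseteq> below G ?b}
      \<le> (real T + real N) * real N powr - \<beta> + 2 * (real N * real N powr - \<beta>)"
    by (intro order_trans[OF measure_pmf.finite_measure_mono outer_bound[OF T]]) auto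
  have "1 - pr ?p {A. below G (real_of_int ?a) \<subseteq> A \<and> A \<subseteq> below G ?b}
      = pr ?p ({A. \<not> below G (real_of_int ?a) \<subseteq> A} \<union> {A. \<not> A \<subseteq> below G ?b})"
  proof -
    have "{A. \<not> below G (real_of_int ?a) \<subseteq> A} \<union> {A. \<not> A \<subseteq> below G ?b}
        = UNIV - {A. below G (real_of_int ?a) \<subseteq> A \<and> A \<subseteq> below G ?b}" by auto
    then show ?thesis by (simp only: measure_pmf.prob_compl[simplified])
  qed
  also have "\<dots> \<le> pr ?p {A. \<not> below G (real_of_int ?a) \<subseteq> A} + pr ?p {A. \<not> A \<subseteq> below G ?b}"
    by (rule measure_Un_le) auto
  finally show ?thesis using inner outer by (simp add: algebra_simps)
qed

end

end

theorem theorem1p1: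
  fixes \<nu> m :: real
  assumes "\<nu> > 0" and "m \<ge> 1"
  shows "\<exists>C::real. \<forall>(V :: nat \<Rightarrow> 'a pair_pre_digraph) (M :: nat \<Rightarrow> 'w measure)
      (W :: nat \<Rightarrow> nat \<Rightarrow> 'w \<Rightarrow> nat \<Rightarrow> 'a \<times> int).
    (\<forall>N\<ge>2. pair_graph (V N) \<and> Digraph_Component.connected (with_proj (V N)) \<and>
       vertex_transitive (V N) \<and> card (pverts (V N)) = N \<and> idla_walks (M N) (V N) (W N)) \<longrightarrow>
    (\<forall>\<^sub>F N in sequentially. \<forall>T::nat. 1 \<le> T \<and> real T \<le> real N powr m \<longrightarrow>
       measure (M N) {\<omega> \<in> space (M N).
         below (V N) (real_of_int \<lfloor>real T / real N - Delta C (V N) N T\<rfloor>)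
           \<subseteq> idla (V N) (\<lambda>t. W N t \<omega>) T \<and>
         idla (V N) (\<lambda>t. W N t \<omega>) T
           \<subseteq> below (V N) (real T / real N + Delta C (V N) N T)}
       \<ge> 1 - real N powr (- \<nu>))"
proof -
  \<comment> \<open>The error is at most \<open>5 N\<^sup>m N\<^bsup>-\<beta>\<^esup> = 5 N\<^bsup>-\<nu>-3\<^esup>\<close>.\<close>
  define \<beta> where "\<beta> = \<nu> + m + 3"
  have \<beta>: "1 \<le> \<beta>" using assms by (simp add: \<beta>_def)
  show ?thesis
  proof (intro exI[of _ "1160 * \<beta> + 900"] allI impI, goal_cases)
    case (1 V M W)
    show ?case
      \<comment> \<open>\<open>N \<ge> 3\<close> ensures \<open>log N \<ge> 1\<close>.\<close>
      using eventually_ge_at_top[of "3 :: nat"]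
    proof eventually_elim
      case (elim N)
      then have N: "2 \<le> N" "3 \<le> N" by auto
      with 1 have hyps: "pair_graph (V N)" "Digraph_Component.connected (with_proj (V N))"
        "vertex_transitive (V N)" "card (pverts (V N)) = N" "idla_walks (M N) (V N) (W N)" by auto
      interpret transitive_cylinder "V N"
        by (rule transitive_cylinder.intro) (use hyps N in simp_all)
      have L: "1 \<le> ln (real (card (pverts (V N))))"
      proof -
        have "exp 1 \<le> real N" using exp_le N(2) by linarith
        then show ?thesis using hyps N by (simp add: ln_ge_iff)
      qed
      show ?case
      proof (intro allI impI)
        fix T :: nat assume T: "1 \<le> T \<and> real T \<le> real N powr m"
        let ?C = "1160 * \<beta> + 900" and ?R = "below (V N)"
        let ?lower = "\<lambda>T. real_of_int \<lfloor>real T / real N - Delta ?C (V N) N T\<rfloor>"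
          and ?upper = "\<lambda>T. real T / real N + Delta ?C (V N) N T"
        let ?good = "{A. ?R (?lower T) \<subseteq> A \<and> A \<subseteq> ?R (?upper T)}"
        have "real N powr 1 \<le> real N powr m" using assms N by (intro powr_mono) auto
        then have "2 * real T + 3 * real N \<le> 5 * real N powr m" using T N by simp
        then have "(2 * real T + 3 * real N) * real N powr - \<beta> \<le> 5 * real N powr m * real N powr - \<beta>"
          by (intro mult_right_mono) auto
        also have "\<dots> = 5 * (real N powr - \<nu> * real N powr - 3)"
          unfolding \<beta>_def mult.assoc powr_add[symmetric] by simp
        also have "\<dots> = real N powr - \<nu> * (5 * real N powr - 3)" by simp
        also have "5 * real N powr - 3 \<le> 1"
        proof -
          have "(3 :: real) ^ 3 \<le> real N ^ 3" using N by (intro power_mono) auto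
          then show ?thesis using N by (simp add: powr_minus divide_le_eq powr_numeral flip: divide_inverse)
        qed
        finally have "1 - real N powr - \<nu> \<le> 1 - (2 * real T + 3 * real N) * real N powr - \<beta>"
          by (simp add: mult_left_mono)
        also have "\<dots> \<le> pr (growth UNIV 0 T (below (V N) 0)) ?good"
          using sandwich_bound[OF L \<beta>, of T ?C] T hyps(4) by simp
        also have "\<dots> = measure (M N) {\<omega> \<in> space (M N). idla (V N) (\<lambda>t. W N t \<omega>) T \<in> ?good}"
          by (rule prob_idla[OF hyps(5), THEN conjunct2, symmetric])
        finally show "1 - real N powr - \<nu> \<le> measure (M N) {\<omega> \<in> space (M N).
          ?R (?lower T) \<subseteq> idla (V N) (\<lambda>t. W N t \<omega>) T \<and> idla (V N) (\<lambda>t. W N t \<omega>) T \<subseteq> ?R (?upper T)}"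
          by simp
      qed
    qed
  qed
qed

end
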